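(* Let $A=kQ/I$ be a gentle algebra with AG-invariant $\phi_A$, and let $L\subseteq\mathbb N^+$ be a finite set such that $\phi_A(0,\ell)>0$ if $\ell\in L$ and $\phi_A(0,\ell)=0$ otherwise. For a gentle algebra $B$, let $N(B)$ denote the number of isomorphism classes of indecomposable non-projective Gorenstein projective $B$-modules. Then: (1) $N(A)=\sum_{\ell\in L}\ell\cdot\phi_A(0,\ell)$, that is, $N(A)$ is the number of arrows on oriented cycles with full relations. (2) If two gentle algebras $A$ and $A'$ are AG-equivalent (i.e. $\phi_A=\phi_{A'}$), then $N(A)=N(A')$.
   Context: $k$ is an algebraically closed field. $Q$ is a finite quiver; $\alpha\beta$ denotes the path "first $\alpha$, then $\beta$". $A=kQ/I$ is gentle if: $I$ is an admissible ideal generated by paths of length $2$; every vertex is the source of at most two and the target of at most two arrows; for each arrow $\beta$ there is at most one arrow $\alpha$ with $t(\alpha)=s(\beta)$, $\alpha\beta\notin I$, at most one with $t(\alpha)=s(\beta)$, $\alpha\beta\in I$, at most one with $s(\alpha)=t(\beta)$, $\beta\alpha\notin I$, and at most one with $s(\alpha)=t(\beta)$, $\beta\alpha\in I$. Modules are finitely generated right modules. A module $G$ is Gorenstein projective if there is an exact sequence of finitely generated projective modules $\cdots\to P^{-1}\xrightarrow{d^{-1}}P^0\xrightarrow{d^0}P^1\to\cdots$ which stays exact under $\mathrm{Hom}_A(-,A)$ and such that $G\cong\mathrm{Im}\,d^{-1}$. Threads: a non-trivial permitted (respectively forbidden) path is a path $\alpha_1\cdots\alpha_m$, $m\ge1$,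 with $\alpha_i\alpha_{i+1}\notin I$ (respectively $\in I$) for $1\le i\le m-1$; a non-trivial permitted (respectively forbidden) thread is a maximal such path, i.e. $\beta\alpha_1\in I$ (respectively $\notin I$) for every arrow $\beta$ with $t(\beta)=s(\alpha_1)$, and $\alpha_m\beta'\in I$ (respectively $\notin I$) for every arrow $\beta'$ with $s(\beta')=t(\alpha_m)$. A trivial permitted (respectively forbidden) thread is a vertex $v$ that is the source of at most one arrow and the target of at most one arrow and such that, if there are arrows $\beta,\beta'$ with $t(\beta)=v=s(\beta')$, then $\beta\beta'\notin I$ (respectively $\beta\beta'\in I$). $l$ denotes length. AG-invariant: $\phi_A:\mathbb N^2\to\mathbb N$ sends $(m,n)$ to the number of times $(m,n)$ occurs in the following finite sequence of pairs. Start with a permitted thread $H_0$. Given $H_i$: if $H_i$ is non-trivial and there is a non-trivial forbidden thread with the same target as $H_i$ and a different last arrow, let $\mathit\Pi_i$ be this thread; otherwise let $\mathit\Pi_i$ be the (possibly trivial) forbidden thread ending at $t(H_i)$ (the trivial one if $H_i$ is non-trivial; if $H_i$ is trivial, the non-trivial one if it exists and the trivial one otherwise). Given $\mathit\Pi_i$: if $\mathit\Pi_i$ is non-trivial and there is a non-trivial permitted thread with the same source as $\mathit\Pi_i$ and a different first arrow, let $H_{i+1}$ be this thread; otherwise let $H_{i+1}$ be the (possibly trivial) permitted thread starting at $s(\mathit\Pi_i)$ (the trivial one if $\mathit\Pi_i$ is non-trivial; if $\mathit\Pi_i$ is trivial, the non-trivial one if it exists and the trivial one otherwise). Stop when $H_m=H_0$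 first occurs with $m\geq 1$ and record the pair $(m,n)$ with $n=\sum_{i=0}^{m-1}l(\mathit\Pi_i)$. Repeat with permitted threads not yet used until all permitted threads have been used. Finally, for every oriented cycle $\alpha_1\cdots\alpha_\ell$ with full relations (i.e. $t(\alpha_\ell)=s(\alpha_1)$ and $\alpha_i\alpha_{i+1}\in I$ for all $i$ modulo $\ell$, cycles being considered up to rotation) add a pair $(0,\ell)$. *)

theory Defs
  imports
    "HOL-Library.Poly_Mapping"
    "HOL-Computational_Algebra.Polynomial"
    "Graph_Theory.Arc_Walk"
    "HOL-Algebra.Ideal_Product"
    "HOL-Algebra.QuotRing"
    "HOL-Algebra.Module"
begin

section \<open>Bound quiver algebras\<close>

text \<open>
  A quiver is a directed multigraph \<^typ>\<open>('v, 'e) pre_digraph\<close>, with \<^const>\<open>tail\<close> as source and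
  \<^const>\<open>head\<close> as target.  A path is a start vertex together with the list of its arrows in the
  order in which they are traversed, so \<open>[\<alpha>, \<beta>]\<close> is ``first \<open>\<alpha>\<close>, then \<open>\<beta>\<close>''; the start vertex is
  needed for the trivial paths \<open>(v, [])\<close>.
\<close>

type_synonym ('v, 'e) path = "'v \<times> 'e list"

definition paths :: "('v, 'e) pre_digraph \<Rightarrow> ('v, 'e) path set" where
  "paths Q = {(u, es). \<exists>v. pre_digraph.awalk Q u es v}"

definition psource :: "('v, 'e) path \<Rightarrow> 'v" where
  "psource p = fst p"

definition ptarget :: "('v, 'e) pre_digraph \<Rightarrow> ('v, 'e) path \<Rightarrow> 'v" where
  "ptarget Q p = pre_digraph.awlast Q (fst p) (snd p)"

definition plength :: "('v, 'e) path \<Rightarrow> nat" where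
  "plength p = length (snd p)"

definition pconcat :: "('v, 'e) path \<Rightarrow> ('v, 'e) path \<Rightarrow> ('v, 'e) path" where
  "pconcat p q = (fst p, snd p @ snd q)"

definition path_mult ::
  "('v, 'e) pre_digraph \<Rightarrow> (('v, 'e) path \<Rightarrow>\<^sub>0 'k::field) \<Rightarrow> (('v, 'e) path \<Rightarrow>\<^sub>0 'k)
    \<Rightarrow> (('v, 'e) path \<Rightarrow>\<^sub>0 'k)" where
  "path_mult Q f g =
     (\<Sum>p\<in>Poly_Mapping.keys f. \<Sum>q\<in>Poly_Mapping.keys g.
        if ptarget Q p = psource q
        then Poly_Mapping.single (pconcat p q) (Poly_Mapping.lookup f p * Poly_Mapping.lookup g q)
        else 0)"

definition path_algebra :: "('v, 'e) pre_digraph \<Rightarrow> (('v, 'e) path \<Rightarrow>\<^sub>0 'k::field) ring" where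
  "path_algebra Q =
     \<lparr>carrier = {f. Poly_Mapping.keys f \<subseteq> paths Q},
      mult = path_mult Q,
      one = (\<Sum>v\<in>verts Q. Poly_Mapping.single (v, []) 1),
      zero = 0,
      add = (+)\<rparr>"

lemma path_mult_superset:
  assumes "finite A" "Poly_Mapping.keys f \<subseteq> A" "finite B" "Poly_Mapping.keys g \<subseteq> B"
  shows "path_mult Q f g =
     (\<Sum>p\<in>A. \<Sum>q\<in>B.
        if ptarget Q p = psource q
        then Poly_Mapping.single (pconcat p q) (Poly_Mapping.lookup f p * Poly_Mapping.lookup g q)
        else 0)"
proof -
  have "path_mult Q f g =
     (\<Sum>p\<in>Poly_Mapping.keys f. \<Sum>q\<in>B.
        if ptarget Q p = psource q
        then Poly_Mapping.single (pconcat p q) (Poly_Mapping.lookup f p * Poly_Mapping.lookup g q)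
        else 0)"
    unfolding path_mult_def
    by (intro sum.cong refl sum.mono_neutral_left assms) (auto simp: in_keys_iff)
  also have "\<dots> = (\<Sum>p\<in>A. \<Sum>q\<in>B.
        if ptarget Q p = psource q
        then Poly_Mapping.single (pconcat p q) (Poly_Mapping.lookup f p * Poly_Mapping.lookup g q)
        else 0)"
    by (intro sum.mono_neutral_left assms) (auto simp: in_keys_iff intro!: sum.neutral)
  finally show ?thesis .
qed

lemma path_mult_add_left: "path_mult Q (f + f') g = path_mult Q f g + path_mult Q f' g"
proof -
  let ?A = "Poly_Mapping.keys f \<union> Poly_Mapping.keys f'" and ?B = "Poly_Mapping.keys g"
  have A: "finite ?A" "Poly_Mapping.keys (f + f') \<subseteq> ?A" by simp (rule keys_add)
  show ?thesis
    unfolding path_mult_superset[OF A finite_keys order.refl]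
      path_mult_superset[OF A(1) Un_upper1 finite_keys order.refl]
      path_mult_superset[OF A(1) Un_upper2 finite_keys order.refl] sum.distrib[symmetric]
    by (intro sum.cong refl) (simp add: lookup_add distrib_right single_add)
qed

lemma path_mult_add_right: "path_mult Q f (g + g') = path_mult Q f g + path_mult Q f g'"
proof -
  let ?A = "Poly_Mapping.keys f" and ?B = "Poly_Mapping.keys g \<union> Poly_Mapping.keys g'"
  have B: "finite ?B" "Poly_Mapping.keys (g + g') \<subseteq> ?B" by simp (rule keys_add)
  show ?thesis
    unfolding path_mult_superset[OF finite_keys order.refl B]
      path_mult_superset[OF finite_keys order.refl B(1) Un_upper1]
      path_mult_superset[OF finite_keys order.refl B(1) Un_upper2] sum.distrib[symmetric]
    by (intro sum.cong refl) (simp add: lookup_add distrib_left single_add)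
qed

lemma path_mult_zero [simp]: "path_mult Q 0 g = 0" "path_mult Q f 0 = 0"
  by (simp_all add: path_mult_def)

lemma path_mult_sum_left: "path_mult Q (sum F A) g = (\<Sum>x\<in>A. path_mult Q (F x) g)"
  by (induction A rule: infinite_finite_induct) (simp_all add: path_mult_add_left)

lemma path_mult_sum_right: "path_mult Q f (sum F A) = (\<Sum>x\<in>A. path_mult Q f (F x))"
  by (induction A rule: infinite_finite_induct) (simp_all add: path_mult_add_right)

lemma path_mult_single:
  "path_mult Q (Poly_Mapping.single p c) (Poly_Mapping.single q d) =
     (if ptarget Q p = psource q then Poly_Mapping.single (pconcat p q) (c * d) else 0)"
  by (subst path_mult_superset[of "{p}" _ "{q}"]) auto

lemma sum_single_keys:
  "f = (\<Sum>p\<in>Poly_Mapping.keys f. Poly_Mapping.single p (Poly_Mapping.lookup f p))"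
  by (rule poly_mapping_eqI)
    (auto simp: lookup_sum lookup_single when_def in_keys_iff)

lemma ptarget_code: "ptarget Q (u, es) = (if es = [] then u else head Q (last es))"
  by (simp add: ptarget_def pre_digraph.awalk_verts_conv)

lemma psource_pconcat [simp]: "psource (pconcat p q) = psource p"
  by (simp add: psource_def pconcat_def)

lemma ptarget_pconcat: "ptarget Q p = psource q \<Longrightarrow> ptarget Q (pconcat p q) = ptarget Q q"
  by (cases p; cases q) (auto simp: ptarget_code psource_def pconcat_def split: if_splits)

lemma pconcat_assoc: "pconcat (pconcat p q) r = pconcat p (pconcat q r)"
  by (simp add: pconcat_def)

lemma path_mult_assoc: "path_mult Q (path_mult Q f g) h = path_mult Q f (path_mult Q g h)"
proof -
  have single: "path_mult Q (path_mult Q (Poly_Mapping.single p a) (Poly_Mapping.single q b))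
                  (Poly_Mapping.single r c) =
                path_mult Q (Poly_Mapping.single p a)
                  (path_mult Q (Poly_Mapping.single q b) (Poly_Mapping.single r c))"
    for p q r and a b c
    by (auto simp: path_mult_single ptarget_pconcat pconcat_assoc mult.assoc)
  show ?thesis
    by (subst (1 2) sum_single_keys[of f], subst (1 2) sum_single_keys[of g],
        subst (1 2) sum_single_keys[of h])
      (simp only: path_mult_sum_left path_mult_sum_right single)
qed

lemma pconcat_in_paths:
  assumes "fin_digraph Q" "p \<in> paths Q" "q \<in> paths Q" "ptarget Q p = psource q"
  shows "pconcat p q \<in> paths Q"
proof -
  interpret fin_digraph Q by fact
  obtain u es v fs where [simp]: "p = (u, es)" "q = (v, fs)" by (cases p; cases q)
  from assms obtain w w' where w: "awalk u es w" "awalk v fs w'" by (auto simp: paths_def)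
  moreover have "w = v" using w assms(4) by (auto simp: ptarget_def psource_def awalk_def awlast_if_cas)
  ultimately show ?thesis using awalk_appendI by (auto simp: paths_def pconcat_def)
qed

lemma path_ends_in_verts:
  assumes "fin_digraph Q" "p \<in> paths Q"
  shows "psource p \<in> verts Q" "ptarget Q p \<in> verts Q"
proof -
  interpret fin_digraph Q by fact
  obtain u es where [simp]: "p = (u, es)" by (cases p)
  from assms obtain w where w: "awalk u es w" by (auto simp: paths_def)
  show "psource p \<in> verts Q" "ptarget Q p \<in> verts Q" using w
    by (auto simp: ptarget_code psource_def awalk_def subset_iff intro!: head_in_verts)
qed

lemma keys_path_mult:
  assumes "fin_digraph Q" "Poly_Mapping.keys f \<subseteq> paths Q" "Poly_Mapping.keys g \<subseteq> paths Q"
  shows "Poly_Mapping.keys (path_mult Q f g) \<subseteq> paths Q"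
  unfolding path_mult_def using assms
  by (intro order.trans[OF keys_sum] UN_least) (auto intro!: pconcat_in_paths split: if_splits)

text \<open>In particular, the ideals in the definition of gentle algebras are ideals of a ring.\<close>

lemma ring_path_algebra:
  assumes "fin_digraph Q"
  shows "ring (path_algebra Q :: (('v, 'e) path \<Rightarrow>\<^sub>0 'k::field) ring)"
proof -
  interpret fin_digraph Q by fact
  let ?one = "\<Sum>v\<in>verts Q. Poly_Mapping.single (v, []) (1::'k)"
  have triv: "(v, []) \<in> paths Q" if "v \<in> verts Q" for v
    using that by (auto simp: paths_def awalk_def)
  have one_l: "path_mult Q ?one (Poly_Mapping.single p c) = Poly_Mapping.single p c"
    if "p \<in> paths Q" for p and c :: 'k
  proof -
    have "path_mult Q ?one (Poly_Mapping.single p c) =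
          (\<Sum>v\<in>verts Q. if v = psource p then Poly_Mapping.single p c else 0)"
      by (auto simp: path_mult_sum_left path_mult_single ptarget_code psource_def pconcat_def
          intro!: sum.cong)
    then show ?thesis using path_ends_in_verts[OF assms that] by simp
  qed
  have one_r: "path_mult Q (Poly_Mapping.single p c) ?one = Poly_Mapping.single p c"
    if "p \<in> paths Q" for p and c :: 'k
  proof -
    have "path_mult Q (Poly_Mapping.single p c) ?one =
          (\<Sum>v\<in>verts Q. if v = ptarget Q p then Poly_Mapping.single p c else 0)"
      by (auto simp: path_mult_sum_right path_mult_single psource_def pconcat_def
          intro!: sum.cong)
    then show ?thesis using path_ends_in_verts[OF assms that] by simp
  qed
  show ?thesis
  proof (rule ringI)
    show "abelian_group (path_algebra Q :: (('v, 'e) path \<Rightarrow>\<^sub>0 'k) ring)"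
    proof (rule abelian_groupI)
      fix x :: "('v, 'e) path \<Rightarrow>\<^sub>0 'k"
      assume "x \<in> carrier (path_algebra Q)"
      then show "\<exists>y\<in>carrier (path_algebra Q). y \<oplus>\<^bsub>path_algebra Q\<^esub> x = \<zero>\<^bsub>path_algebra Q\<^esub>"
        by (intro bexI[of _ "- x"]) (auto simp: path_algebra_def)
    qed (use keys_add in \<open>fastforce simp: path_algebra_def algebra_simps\<close>)+
    show "Group.monoid (path_algebra Q :: (('v, 'e) path \<Rightarrow>\<^sub>0 'k) ring)"
    proof (rule monoidI)
      fix f :: "('v, 'e) path \<Rightarrow>\<^sub>0 'k"
      assume "f \<in> carrier (path_algebra Q)"
      then have f: "Poly_Mapping.keys f \<subseteq> paths Q" by (simp add: path_algebra_def)
      show "\<one>\<^bsub>path_algebra Q\<^esub> \<otimes>\<^bsub>path_algebra Q\<^esub> f = f"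
      proof -
        have "path_mult Q ?one f = (\<Sum>p\<in>Poly_Mapping.keys f.
                path_mult Q ?one (Poly_Mapping.single p (Poly_Mapping.lookup f p)))"
          by (subst sum_single_keys[of f]) (rule path_mult_sum_right)
        also have "\<dots> = (\<Sum>p\<in>Poly_Mapping.keys f. Poly_Mapping.single p (Poly_Mapping.lookup f p))"
          using f by (intro sum.cong refl one_l) auto
        finally show ?thesis using sum_single_keys[of f] by (simp add: path_algebra_def)
      qed
      show "f \<otimes>\<^bsub>path_algebra Q\<^esub> \<one>\<^bsub>path_algebra Q\<^esub> = f"
      proof -
        have "path_mult Q f ?one = (\<Sum>p\<in>Poly_Mapping.keys f.
                path_mult Q (Poly_Mapping.single p (Poly_Mapping.lookup f p)) ?one)"
          by (subst sum_single_keys[of f]) (rule path_mult_sum_left)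
        also have "\<dots> = (\<Sum>p\<in>Poly_Mapping.keys f. Poly_Mapping.single p (Poly_Mapping.lookup f p))"
          using f by (intro sum.cong refl one_r) auto
        finally show ?thesis using sum_single_keys[of f] by (simp add: path_algebra_def)
      qed
    qed (use keys_path_mult[OF assms, THEN subsetD] triv in
          \<open>auto simp: path_algebra_def path_mult_assoc dest!: keys_sum[THEN subsetD]\<close>)
  qed (auto simp: path_algebra_def path_mult_add_left path_mult_add_right)
qed

abbreviation path_elem :: "('v, 'e) path \<Rightarrow> (('v, 'e) path \<Rightarrow>\<^sub>0 'k::field)" where
  "path_elem p \<equiv> Poly_Mapping.single p 1"

definition arrow_ideal :: "('v, 'e) pre_digraph \<Rightarrow> (('v, 'e) path \<Rightarrow>\<^sub>0 'k::field) set" where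
  "arrow_ideal Q = Idl\<^bsub>path_algebra Q\<^esub> {path_elem (tail Q a, [a]) | a. a \<in> arcs Q}"

definition ideal_power :: "('a, 'b) ring_scheme \<Rightarrow> 'a set \<Rightarrow> nat \<Rightarrow> 'a set" where
  "ideal_power R J n = ((\<lambda>X. ideal_prod R X J) ^^ n) (carrier R)"

definition admissible_ideal ::
  "('v, 'e) pre_digraph \<Rightarrow> (('v, 'e) path \<Rightarrow>\<^sub>0 'k::field) set \<Rightarrow> bool" where
  "admissible_ideal Q I \<longleftrightarrow>
     ideal I (path_algebra Q) \<and>
     I \<subseteq> ideal_power (path_algebra Q) (arrow_ideal Q) 2 \<and>
     (\<exists>m\<ge>2. ideal_power (path_algebra Q) (arrow_ideal Q) m \<subseteq> I)"

definition rel_in :: "('v, 'e) pre_digraph \<Rightarrow> (('v, 'e) path \<Rightarrow>\<^sub>0 'k::field) set \<Rightarrow> 'e \<Rightarrow> 'e \<Rightarrow> bool" where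
  "rel_in Q I a b \<longleftrightarrow> path_elem (tail Q a, [a, b]) \<in> I"

definition bound_quiver_algebra ::
  "('v, 'e) pre_digraph \<Rightarrow> (('v, 'e) path \<Rightarrow>\<^sub>0 'k::field) set \<Rightarrow> (('v, 'e) path \<Rightarrow>\<^sub>0 'k) set ring" where
  "bound_quiver_algebra Q I = path_algebra Q Quot I"

text \<open>The pair \<open>(Q, I)\<close> defines a gentle algebra \<open>kQ/I\<close>.\<close>

locale gentle = fin_digraph Q
  for Q :: "('v, 'e) pre_digraph" and I :: "(('v, 'e) path \<Rightarrow>\<^sub>0 'k::field) set" +
  assumes admissible: "admissible_ideal Q I"
    and generated: "\<exists>S\<subseteq>{p \<in> paths Q. plength p = 2}. I = Idl\<^bsub>path_algebra Q\<^esub> (path_elem ` S)"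
    and out_le_2: "v \<in> verts Q \<Longrightarrow> card {a \<in> arcs Q. tail Q a = v} \<le> 2"
    and in_le_2: "v \<in> verts Q \<Longrightarrow> card {a \<in> arcs Q. head Q a = v} \<le> 2"
    and pre_notin: "b \<in> arcs Q \<Longrightarrow> card {a \<in> arcs Q. head Q a = tail Q b \<and> \<not> rel_in Q I a b} \<le> 1"
    and pre_in: "b \<in> arcs Q \<Longrightarrow> card {a \<in> arcs Q. head Q a = tail Q b \<and> rel_in Q I a b} \<le> 1"
    and post_notin: "b \<in> arcs Q \<Longrightarrow> card {a \<in> arcs Q. tail Q a = head Q b \<and> \<not> rel_in Q I b a} \<le> 1"
    and post_in: "b \<in> arcs Q \<Longrightarrow> card {a \<in> arcs Q. tail Q a = head Q b \<and> rel_in Q I b a} \<le> 1"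


section \<open>Right modules over a ring\<close>

text \<open>
  The library's record \<^typ>\<open>('a, 'm) module\<close> and its \<^locale>\<open>submodule\<close> are reused, but since
  \<^locale>\<open>module\<close> is about left modules over commutative rings, right modules get their own locale.
  The field \<open>smult\<close> takes the scalar as first argument: \<open>r \<odot>\<^bsub>M\<^esub> x\<close> stands for \<open>x \<cdot> r\<close>.
  The fields \<open>mult\<close> and \<open>one\<close> of a module record have no meaning.
\<close>

locale right_module = R?: ring R + M?: abelian_group M
  for R (structure) and M :: "('a, 'm, 'd) module_scheme" (structure) +
  assumes rsmult_closed [simp, intro]:
      "\<lbrakk>r \<in> carrier R; x \<in> carrier M\<rbrakk> \<Longrightarrow> r \<odot>\<^bsub>M\<^esub> x \<in> carrier M"
    and rsmult_add_ring:
      "\<lbrakk>r \<in> carrier R; s \<in> carrier R; x \<in> carrier M\<rbrakk> \<Longrightarrow>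
       (r \<oplus>\<^bsub>R\<^esub> s) \<odot>\<^bsub>M\<^esub> x = r \<odot>\<^bsub>M\<^esub> x \<oplus>\<^bsub>M\<^esub> s \<odot>\<^bsub>M\<^esub> x"
    and rsmult_add_module:
      "\<lbrakk>r \<in> carrier R; x \<in> carrier M; y \<in> carrier M\<rbrakk> \<Longrightarrow>
       r \<odot>\<^bsub>M\<^esub> (x \<oplus>\<^bsub>M\<^esub> y) = r \<odot>\<^bsub>M\<^esub> x \<oplus>\<^bsub>M\<^esub> r \<odot>\<^bsub>M\<^esub> y"
    and rsmult_assoc:
      "\<lbrakk>r \<in> carrier R; s \<in> carrier R; x \<in> carrier M\<rbrakk> \<Longrightarrow>
       (r \<otimes>\<^bsub>R\<^esub> s) \<odot>\<^bsub>M\<^esub> x = s \<odot>\<^bsub>M\<^esub> (r \<odot>\<^bsub>M\<^esub> x)"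
    and rsmult_one [simp]:
      "x \<in> carrier M \<Longrightarrow> \<one>\<^bsub>R\<^esub> \<odot>\<^bsub>M\<^esub> x = x"

definition regular_module :: "('a, 'b) ring_scheme \<Rightarrow> ('a, 'a) module" where
  "regular_module R =
     \<lparr>carrier = carrier R, mult = mult R, one = one R, zero = zero R, add = add R,
      smult = (\<lambda>r x. x \<otimes>\<^bsub>R\<^esub> r)\<rparr>"

definition finitely_generated :: "('a, 'b) ring_scheme \<Rightarrow> ('a, 'm) module \<Rightarrow> bool" where
  "finitely_generated R M \<longleftrightarrow>
     (\<exists>S. finite S \<and> S \<subseteq> carrier M \<and>
        (\<forall>x\<in>carrier M. \<exists>r\<in>S \<rightarrow> carrier R. x = (\<Oplus>\<^bsub>M\<^esub>s\<in>S. r s \<odot>\<^bsub>M\<^esub> s)))"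

definition mod_hom ::
  "('a, 'b) ring_scheme \<Rightarrow> ('a, 'm) module \<Rightarrow> ('a, 'n) module \<Rightarrow> ('m \<Rightarrow> 'n) set" where
  "mod_hom R M N =
     {f \<in> hom (add_monoid M) (add_monoid N).
        \<forall>r\<in>carrier R. \<forall>x\<in>carrier M. f (r \<odot>\<^bsub>M\<^esub> x) = r \<odot>\<^bsub>N\<^esub> f x}"

definition mod_iso :: "('a, 'b) ring_scheme \<Rightarrow> ('a, 'm) module \<Rightarrow> ('a, 'n) module \<Rightarrow> bool" where
  "mod_iso R M N \<longleftrightarrow> (\<exists>f\<in>mod_hom R M N. bij_betw f (carrier M) (carrier N))"

text \<open>
  The finitely generated right \<open>R\<close>-modules.  HOL cannot quantify over all carrier types at once, so
  they are taken with carrier in the type of lists of ring elements.  This loses nothing: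
  by \<open>finitely_generated_copy\<close> below every finitely generated module, on whatever type, is
  isomorphic to one of these (send a module element to the list of coefficients that express it
  through fixed generators).
\<close>

definition fg_modules :: "('a, 'b) ring_scheme \<Rightarrow> ('a, 'a list) module set" where
  "fg_modules R = {M. right_module R M \<and> finitely_generated R M}"

lemma finitely_generated_copy:
  fixes R :: "('a, 'b) ring_scheme" and M :: "('a, 'm) module"
  assumes "right_module R M" "finitely_generated R M"
  shows "\<exists>N\<in>fg_modules R. mod_iso R M N"
proof -
  interpret M: right_module R M by fact
  from assms(2) obtain S where S: "finite S" "S \<subseteq> carrier M"
    and gen: "\<And>x. x \<in> carrier M \<Longrightarrow> \<exists>r\<in>S \<rightarrow> carrier R. x = (\<Oplus>\<^bsub>M\<^esub>s\<in>S. r s \<odot>\<^bsub>M\<^esub> s)"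
    unfolding finitely_generated_def by blast
  from gen obtain c where c: "\<And>x. x \<in> carrier M \<Longrightarrow> x = (\<Oplus>\<^bsub>M\<^esub>s\<in>S. c x s \<odot>\<^bsub>M\<^esub> s)"
    by metis
  from c gen have "\<exists>c. \<forall>x\<in>carrier M. c x \<in> S \<rightarrow> carrier R \<and> x = (\<Oplus>\<^bsub>M\<^esub>s\<in>S. c x s \<odot>\<^bsub>M\<^esub> s)"
    by (intro bchoice) blast
  then obtain c where cR: "\<And>x. x \<in> carrier M \<Longrightarrow> c x \<in> S \<rightarrow> carrier R"
    and c: "\<And>x. x \<in> carrier M \<Longrightarrow> x = (\<Oplus>\<^bsub>M\<^esub>s\<in>S. c x s \<odot>\<^bsub>M\<^esub> s)"
    by blast
  obtain ss where ss: "set ss = S" using S(1) finite_list by blast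
  define f where "f x = map (c x) ss" for x
  define g where "g = the_inv_into (carrier M) f"
  have inj: "inj_on f (carrier M)"
  proof (rule inj_onI)
    fix x y assume xy: "x \<in> carrier M" "y \<in> carrier M" "f x = f y"
    then have eq: "c x s = c y s" if "s \<in> S" for s using that ss by (auto simp: f_def)
    have "x = (\<Oplus>\<^bsub>M\<^esub>s\<in>S. c x s \<odot>\<^bsub>M\<^esub> s)" using c xy by blast
    also have "\<dots> = (\<Oplus>\<^bsub>M\<^esub>s\<in>S. c y s \<odot>\<^bsub>M\<^esub> s)"
      using eq S cR[OF xy(2)] by (intro M.M.finsum_cong') (auto simp: Pi_iff subset_iff)
    also have "\<dots> = y" using c xy by metis
    finally show "x = y" .
  qed
  have gf [simp]: "g (f x) = x" if "x \<in> carrier M" for x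
    using that inj by (simp add: g_def the_inv_into_f_f)
  define N :: "('a, 'a list) module" where
    "N = \<lparr>carrier = f ` carrier M, mult = undefined, one = undefined, zero = f \<zero>\<^bsub>M\<^esub>,
          add = (\<lambda>x y. f (g x \<oplus>\<^bsub>M\<^esub> g y)), smult = (\<lambda>r x. f (r \<odot>\<^bsub>M\<^esub> g x))\<rparr>"
  have N: "carrier N = f ` carrier M" "\<zero>\<^bsub>N\<^esub> = f \<zero>\<^bsub>M\<^esub>"
    "x \<oplus>\<^bsub>N\<^esub> y = f (g x \<oplus>\<^bsub>M\<^esub> g y)" "r \<odot>\<^bsub>N\<^esub> x = f (r \<odot>\<^bsub>M\<^esub> g x)" for x y r
    by (simp_all add: N_def)
  have ab: "abelian_group N"
  proof (rule abelian_groupI)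
    fix x assume "x \<in> carrier N"
    then obtain y where "y \<in> carrier M" "x = f y" by (auto simp: N)
    then show "\<exists>z\<in>carrier N. z \<oplus>\<^bsub>N\<^esub> x = \<zero>\<^bsub>N\<^esub>"
      by (intro bexI[of _ "f (\<ominus>\<^bsub>M\<^esub> y)"]) (auto simp: N M.M.l_neg)
  qed (auto simp: N M.M.a_ac)
  have rm: "right_module R N"
    by (intro right_module.intro right_module_axioms.intro ab M.R.ring_axioms)
      (auto simp: N M.rsmult_add_ring M.rsmult_add_module M.rsmult_assoc)
  interpret N: right_module R N by (rule rm)
  have f_finsum: "f (finsum M h A) = finsum N (\<lambda>a. f (h a)) A"
    if "finite A" "h \<in> A \<rightarrow> carrier M" for h and A :: "'m set"
    using that
  proof (induction A rule: finite_induct)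
    case (insert a A)
    then have h: "h a \<in> carrier M" "h \<in> A \<rightarrow> carrier M" by auto
    have "f (finsum M h (insert a A)) = f (h a) \<oplus>\<^bsub>N\<^esub> f (finsum M h A)"
      using insert.hyps h by (simp add: N)
    also have "\<dots> = finsum N (\<lambda>a. f (h a)) (insert a A)"
      using insert.hyps insert.IH h by (subst N.M.finsum_insert) (auto simp: N)
    finally show ?case .
  qed (simp add: N)
  have fg: "finitely_generated R N"
    unfolding finitely_generated_def
  proof (intro exI conjI ballI)
    fix y assume "y \<in> carrier N"
    then obtain x where x: "x \<in> carrier M" "y = f x" by (auto simp: N)
    have injS: "inj_on f S" using inj S(2) by (rule inj_on_subset)
    have "y = f (\<Oplus>\<^bsub>M\<^esub>s\<in>S. c x s \<odot>\<^bsub>M\<^esub> s)" using c x by metis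
    also have "\<dots> = (\<Oplus>\<^bsub>N\<^esub>s\<in>S. f (c x s \<odot>\<^bsub>M\<^esub> s))"
      using S cR[OF x(1)] by (intro f_finsum) (auto simp: Pi_iff subset_iff)
    also have "\<dots> = (\<Oplus>\<^bsub>N\<^esub>s\<in>S. c x (g (f s)) \<odot>\<^bsub>N\<^esub> f s)"
      using S cR[OF x(1)] by (intro N.M.finsum_cong') (auto simp: N Pi_iff subset_iff)
    also have "\<dots> = (\<Oplus>\<^bsub>N\<^esub>t\<in>f ` S. c x (g t) \<odot>\<^bsub>N\<^esub> t)"
      using S cR[OF x(1)] injS
      by (subst N.M.finsum_reindex) (auto simp: N Pi_iff subset_iff)
    finally show "\<exists>r\<in>f ` S \<rightarrow> carrier R. y = (\<Oplus>\<^bsub>N\<^esub>s\<in>f ` S. r s \<odot>\<^bsub>N\<^esub> s)"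
      using S cR[OF x(1)]
      by (intro bexI[of _ "\<lambda>t. c x (g t)"]) (auto simp: Pi_iff subset_iff)
  qed (use S in \<open>auto simp: N\<close>)
  have "f \<in> mod_hom R M N" by (auto simp: mod_hom_def hom_def N)
  moreover have "bij_betw f (carrier M) (carrier N)" using inj by (simp add: bij_betw_def N)
  ultimately show ?thesis using rm fg unfolding fg_modules_def mod_iso_def by blast
qed

definition projective :: "('a, 'b) ring_scheme \<Rightarrow> ('a, 'a list) module \<Rightarrow> bool" where
  "projective R P \<longleftrightarrow>
     P \<in> fg_modules R \<and>
     (\<forall>M\<in>fg_modules R. \<forall>N\<in>fg_modules R. \<forall>g\<in>mod_hom R M N. \<forall>f\<in>mod_hom R P N.
        g ` carrier M = carrier N \<longrightarrow> (\<exists>h\<in>mod_hom R P M. \<forall>x\<in>carrier P. g (h x) = f x))"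

definition indecomposable :: "('a, 'b) ring_scheme \<Rightarrow> ('a, 'm) module \<Rightarrow> bool" where
  "indecomposable R M \<longleftrightarrow>
     carrier M \<noteq> {\<zero>\<^bsub>M\<^esub>} \<and>
     (\<forall>X Y. submodule X R M \<and> submodule Y R M \<and> X <+>\<^bsub>M\<^esub> Y = carrier M \<and> X \<inter> Y = {\<zero>\<^bsub>M\<^esub>}
        \<longrightarrow> X = {\<zero>\<^bsub>M\<^esub>} \<or> Y = {\<zero>\<^bsub>M\<^esub>})"

text \<open>
  \<open>d i\<close> is the differential from \<open>P i\<close> to \<open>P (i + 1)\<close>.  In the second condition both sides are sets
  of homomorphisms from \<open>P i\<close> to \<open>R\<close>: the kernel of \<open>Hom(d (i - 1), R)\<close> and the image of
  \<open>Hom(d i, R)\<close>.  As functions are only relevant on carriers, equality of functions is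
  stated pointwise on the carrier.
\<close>

definition totally_acyclic ::
  "('a, 'b) ring_scheme \<Rightarrow> (int \<Rightarrow> ('a, 'a list) module) \<Rightarrow> (int \<Rightarrow> 'a list \<Rightarrow> 'a list) \<Rightarrow> bool" where
  "totally_acyclic R P d \<longleftrightarrow>
     (\<forall>i. projective R (P i)) \<and>
     (\<forall>i. d i \<in> mod_hom R (P i) (P (i + 1))) \<and>
     (\<forall>i. d (i - 1) ` carrier (P (i - 1)) = {x \<in> carrier (P i). d i x = \<zero>\<^bsub>P (i + 1)\<^esub>}) \<and>
     (\<forall>i. {f \<in> mod_hom R (P i) (regular_module R).
             \<forall>x\<in>carrier (P (i - 1)). f (d (i - 1) x) = \<zero>\<^bsub>R\<^esub>} =
          {f \<in> mod_hom R (P i) (regular_module R).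
             \<exists>g\<in>mod_hom R (P (i + 1)) (regular_module R). \<forall>x\<in>carrier (P i). f x = g (d i x)})"

definition gorenstein_projective :: "('a, 'b) ring_scheme \<Rightarrow> ('a, 'a list) module \<Rightarrow> bool" where
  "gorenstein_projective R G \<longleftrightarrow>
     G \<in> fg_modules R \<and>
     (\<exists>P d. totally_acyclic R P d \<and>
        mod_iso R G ((P 0)\<lparr>carrier := d (-1) ` carrier (P (-1))\<rparr>))"

definition gproj_iso_classes :: "('a, 'b) ring_scheme \<Rightarrow> ('a, 'a list) module set set" where
  "gproj_iso_classes R =
     (let X = {G. gorenstein_projective R G \<and> indecomposable R G \<and> \<not> projective R G}
      in X // {(M, N). M \<in> X \<and> N \<in> X \<and> mod_iso R M N})"

definition num_gproj :: "('a, 'b) ring_scheme \<Rightarrow> nat" where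
  "num_gproj R = card (gproj_iso_classes R)"


section \<open>Threads and the AG-invariant\<close>

text \<open>
  Permitted and forbidden threads are defined by the same conditions, relative to the relation \<open>r\<close>
  that consecutive arrows have to satisfy: ``\<open>\<alpha>\<beta> \<notin> I\<close>'' for permitted and ``\<open>\<alpha>\<beta> \<in> I\<close>'' for
  forbidden threads.
\<close>

definition nontrivial_thread ::
  "('v, 'e) pre_digraph \<Rightarrow> ('e \<Rightarrow> 'e \<Rightarrow> bool) \<Rightarrow> ('v, 'e) path \<Rightarrow> bool" where
  "nontrivial_thread Q r p \<longleftrightarrow>
     p \<in> paths Q \<and> snd p \<noteq> [] \<and> successively r (snd p) \<and>
     (\<forall>b\<in>arcs Q. head Q b = psource p \<longrightarrow> \<not> r b (hd (snd p))) \<and>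
     (\<forall>b\<in>arcs Q. tail Q b = ptarget Q p \<longrightarrow> \<not> r (last (snd p)) b)"

definition trivial_thread ::
  "('v, 'e) pre_digraph \<Rightarrow> ('e \<Rightarrow> 'e \<Rightarrow> bool) \<Rightarrow> ('v, 'e) path \<Rightarrow> bool" where
  "trivial_thread Q r p \<longleftrightarrow>
     (\<exists>v\<in>verts Q. p = (v, []) \<and>
        card {a \<in> arcs Q. tail Q a = v} \<le> 1 \<and> card {a \<in> arcs Q. head Q a = v} \<le> 1 \<and>
        (\<forall>b\<in>arcs Q. \<forall>b'\<in>arcs Q. head Q b = v \<and> tail Q b' = v \<longrightarrow> r b b'))"

definition permitted :: "('v, 'e) pre_digraph \<Rightarrow> (('v, 'e) path \<Rightarrow>\<^sub>0 'k::field) set \<Rightarrow> 'e \<Rightarrow> 'e \<Rightarrow> bool" where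
  "permitted Q I a b \<longleftrightarrow> \<not> rel_in Q I a b"

definition forbidden :: "('v, 'e) pre_digraph \<Rightarrow> (('v, 'e) path \<Rightarrow>\<^sub>0 'k::field) set \<Rightarrow> 'e \<Rightarrow> 'e \<Rightarrow> bool" where
  "forbidden Q I a b \<longleftrightarrow> rel_in Q I a b"

definition permitted_threads ::
  "('v, 'e) pre_digraph \<Rightarrow> (('v, 'e) path \<Rightarrow>\<^sub>0 'k::field) set \<Rightarrow> ('v, 'e) path set" where
  "permitted_threads Q I =
     {p. nontrivial_thread Q (permitted Q I) p \<or> trivial_thread Q (permitted Q I) p}"

text \<open>\<open>forbidden_of Q I H\<^sub>i\<close> is \<open>\<Pi>\<^sub>i\<close>, and \<open>permitted_of Q I \<Pi>\<^sub>i\<close> is \<open>H\<^sub>i\<^sub>+\<^sub>1\<close>.\<close>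

definition forbidden_of ::
  "('v, 'e) pre_digraph \<Rightarrow> (('v, 'e) path \<Rightarrow>\<^sub>0 'k::field) set \<Rightarrow> ('v, 'e) path \<Rightarrow> ('v, 'e) path" where
  "forbidden_of Q I H =
     (let cand = (\<lambda>P. nontrivial_thread Q (forbidden Q I) P \<and> ptarget Q P = ptarget Q H \<and>
                      (snd H \<noteq> [] \<longrightarrow> last (snd P) \<noteq> last (snd H)))
      in if \<exists>P. cand P then THE P. cand P
         else THE P. trivial_thread Q (forbidden Q I) P \<and> ptarget Q P = ptarget Q H)"

definition permitted_of ::
  "('v, 'e) pre_digraph \<Rightarrow> (('v, 'e) path \<Rightarrow>\<^sub>0 'k::field) set \<Rightarrow> ('v, 'e) path \<Rightarrow> ('v, 'e) path" where
  "permitted_of Q I P =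
     (let cand = (\<lambda>H. nontrivial_thread Q (permitted Q I) H \<and> psource H = psource P \<and>
                      (snd P \<noteq> [] \<longrightarrow> hd (snd H) \<noteq> hd (snd P)))
      in if \<exists>H. cand H then THE H. cand H
         else THE H. trivial_thread Q (permitted Q I) H \<and> psource H = psource P)"

definition thread_seq ::
  "('v, 'e) pre_digraph \<Rightarrow> (('v, 'e) path \<Rightarrow>\<^sub>0 'k::field) set \<Rightarrow> ('v, 'e) path \<Rightarrow> nat \<Rightarrow> ('v, 'e) path" where
  "thread_seq Q I H0 i = ((\<lambda>H. permitted_of Q I (forbidden_of Q I H)) ^^ i) H0"

definition records ::
  "('v, 'e) pre_digraph \<Rightarrow> (('v, 'e) path \<Rightarrow>\<^sub>0 'k::field) set \<Rightarrow> ('v, 'e) path \<Rightarrow> nat \<Rightarrow> nat \<Rightarrow> bool" where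
  "records Q I H0 m n \<longleftrightarrow>
     1 \<le> m \<and> thread_seq Q I H0 m = H0 \<and> (\<forall>j. 1 \<le> j \<and> j < m \<longrightarrow> thread_seq Q I H0 j \<noteq> H0) \<and>
     n = (\<Sum>i<m. plength (forbidden_of Q I (thread_seq Q I H0 i)))"

text \<open>
  Cycles are lists of pairwise distinct arrows: without distinctness the powers of a cycle would be
  counted as further cycles.  Vertices may repeat.
\<close>

definition full_relation_cycle ::
  "('v, 'e) pre_digraph \<Rightarrow> (('v, 'e) path \<Rightarrow>\<^sub>0 'k::field) set \<Rightarrow> 'e list \<Rightarrow> bool" where
  "full_relation_cycle Q I es \<longleftrightarrow>
     es \<noteq> [] \<and> distinct es \<and>
     (tail Q (hd es), es) \<in> paths Q \<and> ptarget Q (tail Q (hd es), es) = tail Q (hd es) \<and>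
     (\<forall>i<length es. rel_in Q I (es ! i) (es ! (Suc i mod length es)))"

definition rotation_class :: "'e list \<Rightarrow> 'e list set" where
  "rotation_class es = {rotate k es | k. True}"

text \<open>
  A round of the algorithm is identified with the set of permitted threads that it uses up.  The
  rounds partition the permitted threads, and the algorithm performs each of them exactly once,
  whatever starting threads are chosen.
\<close>

definition ag_invariant ::
  "('v, 'e) pre_digraph \<Rightarrow> (('v, 'e) path \<Rightarrow>\<^sub>0 'k::field) set \<Rightarrow> nat \<times> nat \<Rightarrow> nat" where
  "ag_invariant Q I = (\<lambda>(m, n).
     card {thread_seq Q I H0 ` {..<m} | H0. H0 \<in> permitted_threads Q I \<and> records Q I H0 m n} +
     (if m = 0 then card {rotation_class es | es. full_relation_cycle Q I es \<and> length es = n} else 0))"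

end

theory Submission
  imports Defs "HOL-Library.Function_Algebras"
begin

text \<open>
  Let \<open>M\<close> be a submodule of a free right module \<open>F\<close> over the gentle algebra.  In terms of the
  path basis of \<open>F\<close>, let \<open>N\<^sub>\<alpha>\<close> be the part of \<open>M\<close> supported on paths that end with the arrow \<open>\<alpha>\<close>.
  The \<open>N\<^sub>\<alpha>\<close> are independent, and right multiplication by an arrow \<open>\<beta>\<close> has kernel \<open>N\<^sub>\<alpha>\<close> on \<open>M\<close> for the
  unique \<open>\<alpha>\<close> with \<open>\<alpha>\<beta> \<in> I\<close> (and is injective if there is none).  Choosing complements of \<open>M\<alpha>\<close> in
  \<open>N\<^sub>\<alpha>\<close>, and of the sum of the \<open>N\<^sub>\<alpha>\<close> in \<open>M e\<^sub>v\<close>, one can prescribe a retraction of \<open>M\<close> onto a submodule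
  isomorphic to some \<open>e\<^sub>v A\<close> or \<open>\<alpha> A\<close>.  So an indecomposable \<open>M\<close> is itself of this form.

  If \<open>\<alpha> A\<close> is the image of a differential of an exact complex of projectives, with generator
  \<open>x = y \<alpha> \<notin> M \<alpha>\<close>, then the next differential sends \<open>y\<close> to an element of the same kind for the arrow \<open>\<gamma>\<close>
  with \<open>\<gamma>\<alpha> \<in> I\<close>.  Iterating and using finiteness, \<open>\<alpha>\<close> lies on a cycle with full relations.
  Conversely, along such a cycle the left multiplications by its arrows form a totally acyclic
  complex whose images are the modules \<open>\<alpha> A\<close>; these are local, non-projective and pairwise
  non-isomorphic.
\<close>

section \<open>The standard basis of a gentle algebra\<close>

text \<open>The delicate point is that a map prescribed on complements need not be well defined,
  since an element of M may arise from them in several ways. The map is therefore built as a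
  relation \<open>W\<close>, the smallest stable space of pairs containing the prescribed values,
  and it has to be shown that \<open>(0, r)\<close> in \<open>W\<close> forces \<open>r = 0\<close>.
  Ambiguity can only come from an element killed by an arrow \<open>a\<close>. Its part at the tail
  of \<open>a\<close> ends in the unique \<open>b\<close> forming a relation with \<open>a\<close>,
  and so do the values prescribed over it, which are therefore killed by \<open>a\<close> as well.
  Free modules enter because an image in a complex of projectives embeds in one. Their elements
  become functions on pairs of an index and a path, so that linear algebra on a type supplies the
  complements. The bound on the length of paths without relations plays the part of nilpotency of
  the radical in each Nakayama-type argument. For the cycles, uniqueness of the successor in a
  relation makes a backward chain of relations purely periodic, not merely eventually periodic, so
  that the starting arrow itself is on the cycle.\<close>

abbreviation (input) "keys \<equiv> Poly_Mapping.keys"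
abbreviation (input) "lookup \<equiv> Poly_Mapping.lookup"
abbreviation (input) "single \<equiv> Poly_Mapping.single"

text \<open>Exposes the failing pair as consecutive entries, so that a path outside
  \<open>good_paths\<close> can be factored around a relation of length two.\<close>

lemma not_successively_iff:
  "\<not> successively P xs \<longleftrightarrow> (\<exists>us a b vs. xs = us @ a # b # vs \<and> \<not> P a b)"
proof (induction P xs rule: successively.induct)
  case (3 P x y xs)
  show ?case
  proof
    assume "\<not> successively P (x # y # xs)"
    then consider "\<not> P x y" | "\<not> successively P (y # xs)" by auto
    then show "\<exists>us a b vs. x # y # xs = us @ a # b # vs \<and> \<not> P a b"
    proof cases
      case 2
      then obtain us a b vs where "y # xs = us @ a # b # vs" "\<not> P a b" using 3 by blast
      then show ?thesis by (intro exI[of _ "x # us"]) auto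
    qed blast
  next
    assume "\<exists>us a b vs. x # y # xs = us @ a # b # vs \<and> \<not> P a b"
    then obtain us a b vs where u: "x # y # xs = us @ a # b # vs" "\<not> P a b" by blast
    then show "\<not> successively P (x # y # xs)"
    proof (cases us)
      case (Cons z us')
      then have "\<not> successively P (y # xs)" unfolding 3 using u by auto
      then show ?thesis by simp
    qed (use u in auto)
  qed
qed auto

lemma (in fin_digraph) Nil_in_paths: "(u, []) \<in> paths G \<longleftrightarrow> u \<in> verts G"
  by (auto simp: paths_def awalk_Nil_iff)

lemma (in fin_digraph) Cons_in_paths:
  "(u, a # es) \<in> paths G \<longleftrightarrow> a \<in> arcs G \<and> tail G a = u \<and> (head G a, es) \<in> paths G"
  by (auto simp: paths_def awalk_Cons_iff)

lemma (in fin_digraph) append_in_paths: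
  "(u, xs @ ys) \<in> paths G \<longleftrightarrow> (u, xs) \<in> paths G \<and> (ptarget G (u, xs), ys) \<in> paths G"
proof (induction xs arbitrary: u)
  case Nil
  have "u \<in> verts G" if "(u, ys) \<in> paths G"
    using that by (auto simp: paths_def awalk_def)
  then show ?case by (auto simp: ptarget_code Nil_in_paths)
next
  case (Cons a xs)
  have "ptarget G (u, a # xs) = ptarget G (head G a, xs)" by (simp add: ptarget_code)
  then show ?case by (auto simp: Cons_in_paths Cons)
qed

lemma (in fin_digraph) snoc_in_paths:
  "(u, xs @ [a]) \<in> paths G \<longleftrightarrow> (u, xs) \<in> paths G \<and> a \<in> arcs G \<and> tail G a = ptarget G (u, xs)"
  by (auto simp: append_in_paths Cons_in_paths Nil_in_paths)

text \<open>Paths with no relation as a factor. Since \<open>I\<close> is generated by paths, their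
  classes form the basis of the quotient to which all later coefficients refer.\<close>

definition good_paths ::
  "('v, 'e) pre_digraph \<Rightarrow> (('v, 'e) path \<Rightarrow>\<^sub>0 'k::field) set \<Rightarrow> ('v, 'e) path set" where
  "good_paths Q I = {p \<in> paths Q. successively (\<lambda>a b. \<not> rel_in Q I a b) (snd p)}"

section \<open>The relation ideal as the span of the paths that contain a relation\<close>

context gentle
begin

abbreviation A :: "(('v, 'e) path \<Rightarrow>\<^sub>0 'k) ring" where "A \<equiv> path_algebra Q"
abbreviation B :: "(('v, 'e) path \<Rightarrow>\<^sub>0 'k) set ring" where "B \<equiv> bound_quiver_algebra Q I"
abbreviation B_mult (infixl "\<bullet>" 70) where "x \<bullet> y \<equiv> x \<otimes>\<^bsub>B\<^esub> y"
abbreviation gp where "gp \<equiv> good_paths Q I"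
abbreviation rel where "rel \<equiv> rel_in Q I"

lemma A_simps [simp]:
  "f \<in> carrier A \<longleftrightarrow> keys f \<subseteq> paths Q"
  "f \<otimes>\<^bsub>A\<^esub> g = path_mult Q f g" "f \<oplus>\<^bsub>A\<^esub> g = f + g" "\<zero>\<^bsub>A\<^esub> = 0"
  "\<one>\<^bsub>A\<^esub> = (\<Sum>v\<in>verts Q. single (v, []) 1)"
  by (auto simp: path_algebra_def)

lemma ring_A: "ring A"
  by (rule ring_path_algebra) (rule fin_digraph_axioms)

lemma ideal_I: "ideal I A"
  using admissible by (simp add: admissible_ideal_def)

lemma I_add: "f \<in> I \<Longrightarrow> g \<in> I \<Longrightarrow> f + g \<in> I"
  using additive_subgroup.a_closed[OF ideal.axioms(1)[OF ideal_I]] by fastforce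

lemma I_zero: "0 \<in> I"
  using additive_subgroup.zero_closed[OF ideal.axioms(1)[OF ideal_I]] by simp

lemma I_mult:
  "f \<in> I \<Longrightarrow> g \<in> carrier A \<Longrightarrow> path_mult Q f g \<in> I"
  "f \<in> I \<Longrightarrow> g \<in> carrier A \<Longrightarrow> path_mult Q g f \<in> I"
  using ideal.I_r_closed[OF ideal_I, of f g] ideal.I_l_closed[OF ideal_I, of f g] by simp_all

lemma I_sum: "finite X \<Longrightarrow> (\<And>x. x \<in> X \<Longrightarrow> F x \<in> I) \<Longrightarrow> sum F X \<in> I"
  by (induction X rule: finite_induct) (auto intro: I_zero I_add)

text \<open>The elements supported on paths with a factor from \<open>S\<close> form a two-sided
  ideal that contains the generators, hence all of \<open>I\<close>. Only this upper bound is
  recorded here; the exact description of \<open>I\<close> is \<open>I_iff\<close>.\<close>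

lemma relation_shape:
  obtains S where "S \<subseteq> {p \<in> paths Q. plength p = 2}"
    "I \<subseteq> {f. \<forall>p\<in>keys f. p \<in> paths Q \<and>
            (\<exists>xs a b ys. snd p = xs @ a # b # ys \<and> (tail Q a, [a, b]) \<in> S)}"
    "I = Idl\<^bsub>A\<^esub> (path_elem ` S)"
proof -
  obtain S where S: "S \<subseteq> {p \<in> paths Q. plength p = 2}" "I = Idl\<^bsub>A\<^esub> (path_elem ` S)"
    using generated by blast
  define bd where "bd p \<longleftrightarrow> p \<in> paths Q \<and> (\<exists>xs a b ys. snd p = xs @ a # b # ys \<and> (tail Q a, [a, b]) \<in> S)"
    for p
  define J where "J = {f::('v, 'e) path \<Rightarrow>\<^sub>0 'k. \<forall>p\<in>keys f. bd p}"
  interpret A: ring A by (rule ring_A)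
  have bd_l: "bd (pconcat p q)" if "p \<in> paths Q" "bd q" "ptarget Q p = psource q" for p q
  proof -
    from that obtain xs a b ys where "snd q = xs @ a # b # ys" "(tail Q a, [a, b]) \<in> S"
      by (auto simp: bd_def)
    then have "snd (pconcat p q) = (snd p @ xs) @ a # b # ys" "(tail Q a, [a, b]) \<in> S"
      by (auto simp: pconcat_def)
    then show ?thesis unfolding bd_def using that pconcat_in_paths[OF fin_digraph_axioms]
      by (metis bd_def)
  qed
  have bd_r: "bd (pconcat q p)" if "p \<in> paths Q" "bd q" "ptarget Q q = psource p" for p q
  proof -
    from that obtain xs a b ys where "snd q = xs @ a # b # ys" "(tail Q a, [a, b]) \<in> S"
      by (auto simp: bd_def)
    then have "snd (pconcat q p) = xs @ a # b # (ys @ snd p)" "(tail Q a, [a, b]) \<in> S"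
      by (auto simp: pconcat_def)
    then show ?thesis unfolding bd_def using that pconcat_in_paths[OF fin_digraph_axioms]
      by (metis bd_def)
  qed
  have keys_mult: "\<exists>p q. r = pconcat p q \<and> p \<in> keys f \<and> q \<in> keys g \<and>
      ptarget Q p = psource q" if "r \<in> keys (path_mult Q f g)"
    for r and f g :: "('v, 'e) path \<Rightarrow>\<^sub>0 'k"
    using that unfolding path_mult_def
    by (auto dest!: keys_sum[THEN subsetD] split: if_splits) blast
  have "ideal J A"
  proof (rule idealI[OF ring_A])
    show "subgroup J (add_monoid A)"
    proof (rule A.add.subgroupI)
      show "J \<subseteq> carrier A" by (auto simp: J_def bd_def)
      show "J \<noteq> {}" by (auto simp: J_def intro!: exI[of _ 0])
      fix f assume f: "f \<in> J"
      have "\<ominus>\<^bsub>A\<^esub> f = - f"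
        using f by (intro A.minus_equality) (auto simp: J_def bd_def)
      then show "\<ominus>\<^bsub>A\<^esub> f \<in> J" using f by (auto simp: J_def)
      fix g assume "g \<in> J"
      then show "f \<oplus>\<^bsub>A\<^esub> g \<in> J" using f keys_add[of f g] by (auto simp: J_def)
    qed
  next
    fix a x assume ax: "a \<in> J" "x \<in> carrier A"
    show "x \<otimes>\<^bsub>A\<^esub> a \<in> J" using ax by (auto simp: J_def dest!: keys_mult intro!: bd_l)
    show "a \<otimes>\<^bsub>A\<^esub> x \<in> J" using ax by (auto simp: J_def dest!: keys_mult intro!: bd_r)
  qed
  moreover have "path_elem ` S \<subseteq> J"
  proof
    fix f :: "('v, 'e) path \<Rightarrow>\<^sub>0 'k" assume "f \<in> path_elem ` S"
    then obtain p where p: "p \<in> S" "f = path_elem p" by blast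
    obtain u es where [simp]: "p = (u, es)" by (cases p)
    from p S(1) have "(u, es) \<in> paths Q" "length es = 2" by (auto simp: plength_def)
    then obtain a b where "es = [a, b]" "tail Q a = u"
      by (auto simp: numeral_2_eq_2 length_Suc_conv Cons_in_paths)
    then have "snd p = [] @ a # b # []" "(tail Q a, [a, b]) \<in> S" using p by auto
    then have "bd p" unfolding bd_def using p S(1) by blast
    then show "f \<in> J" using p by (auto simp: J_def)
  qed
  ultimately have "I \<subseteq> J" unfolding S(2) by (rule A.genideal_minimal)
  with S show ?thesis by (intro that[of S]) (auto simp: J_def bd_def)
qed

text \<open>\<open>rel_in\<close> speaks only of membership in \<open>I\<close>. Since elements of
  \<open>I\<close> are supported on genuine paths, composability of the two arrows follows.\<close>

lemma rel_in_arcs: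
  assumes "rel a b" shows "a \<in> arcs Q" "b \<in> arcs Q" "head Q a = tail Q b"
proof -
  obtain S where S: "S \<subseteq> {p \<in> paths Q. plength p = 2}"
    "I \<subseteq> {f. \<forall>p\<in>keys f. p \<in> paths Q \<and>
            (\<exists>xs a b ys. snd p = xs @ a # b # ys \<and> (tail Q a, [a, b]) \<in> S)}"
    by (rule relation_shape)
  from assms S(2) have "(tail Q a, [a, b]) \<in> paths Q" by (auto simp: rel_in_def)
  then show "a \<in> arcs Q" "b \<in> arcs Q" "head Q a = tail Q b" by (auto simp: Cons_in_paths)
qed

text \<open>\<open>I\<close> is monomial: a factor from the generating set is a relation in the
  sense of \<open>rel\<close>, and conversely a path containing a relation is the product of that
  relation with the pieces before and after it.\<close>

lemma I_iff: "f \<in> I \<longleftrightarrow> keys f \<subseteq> paths Q - gp"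
proof
  assume f: "f \<in> I"
  obtain S where S: "S \<subseteq> {p \<in> paths Q. plength p = 2}"
    "I \<subseteq> {f. \<forall>p\<in>keys f. p \<in> paths Q \<and>
            (\<exists>xs a b ys. snd p = xs @ a # b # ys \<and> (tail Q a, [a, b]) \<in> S)}"
    "I = Idl\<^bsub>A\<^esub> (path_elem ` S)"
    by (rule relation_shape)
  have "path_elem ` S \<subseteq> I" unfolding S(3)
    using S(1) by (intro ring.genideal_self[OF ring_A]) auto
  then have "rel a b" if "(tail Q a, [a, b]) \<in> S" for a b
    using that by (auto simp: rel_in_def)
  then have "\<not> successively (\<lambda>a b. \<not> rel a b) (snd p)" if "p \<in> keys f" for p
    using S(2) f that unfolding not_successively_iff by blast
  then show "keys f \<subseteq> paths Q - gp" using S(2) f by (auto simp: good_paths_def)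
next
  assume f: "keys f \<subseteq> paths Q - gp"
  have "single p c \<in> I" if p: "p \<in> paths Q - gp" for p c
  proof -
    obtain u es where [simp]: "p = (u, es)" by (cases p)
    from p have "\<not> successively (\<lambda>a b. \<not> rel a b) es" by (auto simp: good_paths_def)
    then obtain us a b vs where es: "es = us @ a # b # vs" "rel a b"
      unfolding not_successively_iff by blast
    have 1: "(u, us) \<in> paths Q" "(head Q b, vs) \<in> paths Q" "ptarget Q (u, us) = tail Q a"
      using p es by (auto simp: append_in_paths Cons_in_paths)
    have "path_mult Q (path_mult Q (single (u, us) c) (path_elem (tail Q a, [a, b])))
        (path_elem (head Q b, vs)) \<in> I"
      using es 1 by (intro I_mult) (auto simp: rel_in_def)
    moreover have "path_mult Q (path_mult Q (single (u, us) c) (path_elem (tail Q a, [a, b])))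
        (path_elem (head Q b, vs)) = single p c"
      using 1 es by (simp add: path_mult_single psource_def ptarget_code pconcat_def)
    ultimately show ?thesis by simp
  qed
  then show "f \<in> I" using f by (subst sum_single_keys) (intro I_sum, auto)
qed

lemma path_elem_ideal_power:
  "p \<in> paths Q \<Longrightarrow> path_elem p \<in> ideal_power A (arrow_ideal Q) (plength p)"
proof (cases p)
  fix u es assume "p \<in> paths Q" and [simp]: "p = (u, es)"
  then have "(u, es) \<in> paths Q" by simp
  then have "path_elem (u, es) \<in> ideal_power A (arrow_ideal Q) (length es)"
  proof (induction es rule: rev_induct)
    case Nil
    then show ?case by (simp add: ideal_power_def)
  next
    case (snoc a es)
    then have p: "(u, es) \<in> paths Q" "a \<in> arcs Q" "tail Q a = ptarget Q (u, es)"
      by (auto simp: snoc_in_paths)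
    have "path_elem (tail Q a, [a]) \<in> (arrow_ideal Q :: (('v, 'e) path \<Rightarrow>\<^sub>0 'k) set)"
      unfolding arrow_ideal_def
      by (rule subsetD[OF ring.genideal_self[OF ring_A]])
        (use p in \<open>auto simp: Cons_in_paths Nil_in_paths intro!: exI[of _ a]\<close>)
    then have "path_elem (u, es) \<otimes>\<^bsub>A\<^esub> path_elem (tail Q a, [a]) \<in>
        ideal_prod A (ideal_power A (arrow_ideal Q) (length es)) (arrow_ideal Q)"
      using snoc.IH[OF p(1)] by (intro ideal_prod.prod)
    then show ?case
      using p by (simp add: ideal_power_def path_mult_single psource_def pconcat_def)
  qed
  then show ?thesis by (simp add: plength_def)
qed

text \<open>Admissibility puts all paths of some length \<open>m\<close> into \<open>I\<close>, so
  the initial piece of length \<open>m\<close> of a good path at least that long would have to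
  contain a relation.\<close>

lemma good_path_bound: "\<exists>N. \<forall>p\<in>gp. plength p < N"
proof -
  obtain m where m: "ideal_power A (arrow_ideal Q) m \<subseteq> I"
    using admissible by (auto simp: admissible_ideal_def)
  have "plength p < m" if p: "p \<in> gp" for p
  proof (rule ccontr)
    assume "\<not> plength p < m"
    obtain u es where [simp]: "p = (u, es)" by (cases p)
    have q: "(u, take m es) \<in> paths Q"
      using p append_in_paths[of u "take m es" "drop m es"] by (auto simp: good_paths_def)
    have "plength (u, take m es) = m" using \<open>\<not> plength p < m\<close> by (simp add: plength_def)
    then have "path_elem (u, take m es) \<in> I" using path_elem_ideal_power[OF q] m by auto
    then have "\<not> successively (\<lambda>a b. \<not> rel a b) (take m es)"
      using q by (auto simp: I_iff good_paths_def)
    then obtain us a b vs where "take m es = us @ a # b # vs" "rel a b"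
      unfolding not_successively_iff by blast
    then have "es = us @ a # b # vs @ drop m es" "rel a b"
      by (metis append_take_drop_id append_assoc append_Cons)+
    then have "\<not> successively (\<lambda>a b. \<not> rel a b) es" unfolding not_successively_iff by blast
    then show False using p by (simp add: good_paths_def)
  qed
  then show ?thesis by blast
qed

lemma finite_gp: "finite gp"
proof -
  obtain N where N: "\<forall>p\<in>gp. plength p < N" using good_path_bound by blast
  have "gp \<subseteq> verts Q \<times> {es. set es \<subseteq> arcs Q \<and> length es \<le> N}"
    using N by (fastforce simp: good_paths_def paths_def awalk_def plength_def)
  then show ?thesis by (rule finite_subset) (auto intro!: finite_lists_length_le)
qed

lemma gp_Nil: "(v, []) \<in> gp \<longleftrightarrow> v \<in> verts Q"
  by (auto simp: good_paths_def Nil_in_paths)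

lemma gp_single: "(u, [a]) \<in> gp \<longleftrightarrow> a \<in> arcs Q \<and> u = tail Q a"
  by (auto simp: good_paths_def Nil_in_paths Cons_in_paths)

lemma gp_snoc:
  "(u, es @ [a]) \<in> gp \<longleftrightarrow>
    (u, es) \<in> gp \<and> a \<in> arcs Q \<and> tail Q a = ptarget Q (u, es) \<and> (es \<noteq> [] \<longrightarrow> \<not> rel (last es) a)"
  by (auto simp: good_paths_def snoc_in_paths successively_append_iff)

lemma gp_Cons:
  "(u, a # es) \<in> gp \<longleftrightarrow>
    a \<in> arcs Q \<and> u = tail Q a \<and> (head Q a, es) \<in> gp \<and> (es \<noteq> [] \<longrightarrow> \<not> rel a (hd es))"
  by (auto simp: good_paths_def Cons_in_paths successively_Cons)

lemma gp_appendD: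
  assumes "(u, xs @ ys) \<in> gp"
  shows "(u, xs) \<in> gp" "(ptarget Q (u, xs), ys) \<in> gp"
  using assms by (auto simp: good_paths_def append_in_paths successively_append_iff)

end


lemma poly_mapping_single_induct [case_names zero single add]:
  fixes f :: "'a \<Rightarrow>\<^sub>0 'b::comm_monoid_add"
  assumes "P 0" "\<And>p c. P (single p c)" "\<And>f g. P f \<Longrightarrow> P g \<Longrightarrow> P (f + g)"
  shows "P f"
proof -
  have "P (\<Sum>p\<in>X. single p (lookup f p))" if "finite X" for X
    using that by (induction X rule: finite_induct) (auto intro: assms)
  from this[OF finite_keys[of f]] show ?thesis by (simp flip: sum_single_keys)
qed

section \<open>Coordinates of the quotient algebra with respect to good paths\<close>

context gentle
begin

definition cls where "cls f = I +>\<^bsub>A\<^esub> f"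

text \<open>\<open>cf r p\<close> is the coefficient of \<open>r\<close> at the good path \<open>p\<close>; it is \<open>0\<close> at all other \<open>p\<close>.\<close>

definition cf where
  "cf r p = (if p \<in> gp then lookup (SOME f. f \<in> carrier A \<and> cls f = r) p else 0)"

text \<open>The quotient is encoded as a bare ring, so scalars of the field have to act through ring
  elements; this is why the vertex idempotent carries a coefficient.\<close>

definition ce where "ce v c = cls (single (v, []) c)"

definition ar where "ar a = cls (path_elem (tail Q a, [a]))"

lemma ring_B: "ring B"
  unfolding bound_quiver_algebra_def by (rule ideal.quotient_is_ring[OF ideal_I])

sublocale B: ring B
  by (rule ring_B)

lemma carrier_B: "r \<in> carrier B \<longleftrightarrow> (\<exists>f. keys f \<subseteq> paths Q \<and> r = cls f)"
proof -
  have "carrier B = {cls f | f. f \<in> carrier A}"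
    by (auto simp: bound_quiver_algebra_def FactRing_def A_RCOSETS_def' cls_def)
  then show ?thesis by auto
qed

lemma cls_carrier: "keys f \<subseteq> paths Q \<Longrightarrow> cls f \<in> carrier B"
  by (auto simp: carrier_B)

lemma cls_hom: "cls \<in> ring_hom A B"
proof -
  have "cls = (+>\<^bsub>A\<^esub>) I" by (simp add: fun_eq_iff cls_def)
  then show ?thesis using ideal.rcos_ring_hom[OF ideal_I] by (simp add: bound_quiver_algebra_def)
qed

lemma cls_add:
  "keys f \<subseteq> paths Q \<Longrightarrow> keys g \<subseteq> paths Q \<Longrightarrow> cls (f + g) = cls f \<oplus>\<^bsub>B\<^esub> cls g"
  using ring_hom_add[OF cls_hom, of f g] by simp

lemma cls_mult:
  "keys f \<subseteq> paths Q \<Longrightarrow> keys g \<subseteq> paths Q \<Longrightarrow>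
    cls (path_mult Q f g) = cls f \<bullet> cls g"
  using ring_hom_mult[OF cls_hom, of f g] by simp

lemma cls_zero: "cls 0 = \<zero>\<^bsub>B\<^esub>"
  using ring_hom_zero[OF cls_hom ring_A ring_B] by simp

lemma cls_eq_iff:
  assumes "keys f \<subseteq> paths Q" "keys g \<subseteq> paths Q"
  shows "cls f = cls g \<longleftrightarrow> f - g \<in> I"
proof -
  interpret A: ring A by (rule ring_A)
  have "\<ominus>\<^bsub>A\<^esub> g = - g" using assms by (intro A.minus_equality) auto
  then have "f \<ominus>\<^bsub>A\<^esub> g = f - g" by (simp add: a_minus_def)
  then show ?thesis
    using A.quotient_eq_iff_same_a_r_cos[OF ideal_I, of f g] assms by (simp add: cls_def)
qed

lemma cf_cls:
  assumes "keys f \<subseteq> paths Q"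
  shows "cf (cls f) p = (if p \<in> gp then lookup f p else 0)"
proof -
  define g where "g = (SOME g. g \<in> carrier A \<and> cls g = cls f)"
  have g: "g \<in> carrier A \<and> cls g = cls f" unfolding g_def
    by (rule someI[of _ f]) (use assms in auto)
  then have "g - f \<in> I" using cls_eq_iff assms by auto
  then have "lookup (g - f) p = 0" if "p \<in> gp"
    using that by (auto simp: I_iff in_keys_iff)
  then show ?thesis by (auto simp: cf_def g_def lookup_minus)
qed

text \<open>Representatives with equal coefficients at good paths differ only at paths containing a
  relation, and such a difference lies in \<open>I\<close>. Equalities in the quotient are checked
  coefficientwise from here on.\<close>

lemma cf_eqI:
  assumes "r \<in> carrier B" "s \<in> carrier B" "\<And>p. cf r p = cf s p"
  shows "r = s"
proof -
  from assms(1,2) obtain f g where fg: "keys f \<subseteq> paths Q" "r = cls f"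
      "keys g \<subseteq> paths Q" "s = cls g"
    by (auto simp: carrier_B)
  have "lookup f p = lookup g p" if "p \<in> gp" for p
    using assms(3)[of p] that by (simp add: fg cf_cls)
  then have "keys (f - g) \<subseteq> paths Q - gp"
    using fg keys_diff[of f g] by (auto simp: in_keys_iff lookup_minus)
  then show ?thesis using fg by (simp add: cls_eq_iff I_iff)
qed

text \<open>There are only finitely many good paths, so any function on them is finitely supported
  and defines a representative.\<close>

lemma cf_surj:
  assumes "\<And>p. \<phi> p \<noteq> 0 \<Longrightarrow> p \<in> gp"
  obtains r where "r \<in> carrier B" "\<And>p. cf r p = \<phi> p"
proof -
  define f where "f = Abs_poly_mapping \<phi>"
  have "finite {p. \<phi> p \<noteq> 0}" by (rule finite_subset[OF _ finite_gp]) (use assms in auto)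
  then have f: "lookup f = \<phi>" by (simp add: f_def)
  then have k: "keys f \<subseteq> paths Q"
    using assms by (auto simp: in_keys_iff good_paths_def)
  show ?thesis
    by (rule that[of "cls f"]) (use k assms in \<open>auto simp: carrier_B cf_cls f\<close>)
qed

lemma cf_outside: "p \<notin> gp \<Longrightarrow> cf r p = 0"
  by (simp add: cf_def)

lemma cf_zero [simp]: "cf \<zero>\<^bsub>B\<^esub> p = 0"
  by (simp add: cls_zero[symmetric] cf_cls)

lemma cf_add:
  assumes "r \<in> carrier B" "s \<in> carrier B"
  shows "cf (r \<oplus>\<^bsub>B\<^esub> s) p = cf r p + cf s p"
proof -
  from assms obtain f g where fg: "keys f \<subseteq> paths Q" "r = cls f"
      "keys g \<subseteq> paths Q" "s = cls g"
    by (auto simp: carrier_B)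
  have "keys (f + g) \<subseteq> paths Q" using fg keys_add[of f g] by auto
  then show ?thesis using fg by (simp add: cls_add[symmetric] cf_cls lookup_add)
qed

lemma cf_uminus:
  assumes "r \<in> carrier B"
  shows "cf (\<ominus>\<^bsub>B\<^esub> r) p = - cf r p"
proof -
  have "cf (\<ominus>\<^bsub>B\<^esub> r \<oplus>\<^bsub>B\<^esub> r) p = 0" using assms by (simp add: B.l_neg)
  then show ?thesis using assms by (simp add: cf_add eq_neg_iff_add_eq_0)
qed

text \<open>A convolution over the cut points of the path. Bilinearity reduces it to two single
  paths, where only the cut after the length of the first one can contribute.\<close>

lemma lookup_path_mult:
  "lookup (path_mult Q f g) (u, es) =
    (\<Sum>i\<le>length es. lookup f (u, take i es) *
       lookup g (ptarget Q (u, take i es), drop i es))"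
proof (induction f rule: poly_mapping_single_induct)
  case (single p c)
  show ?case
  proof (induction g rule: poly_mapping_single_induct)
    case (single q d)
    have "(\<Sum>i\<le>length es. lookup (single p c) (u, take i es) *
        lookup (single q d) (ptarget Q (u, take i es), drop i es)) =
        (\<Sum>i\<le>length es. if i = plength p then
          (if ptarget Q p = psource q \<and> pconcat p q = (u, es) then c * d else 0) else 0)"
    proof (intro sum.cong refl)
      fix i assume "i \<in> {..length es}"
      then have eq: "(p = (u, take i es) \<and> q = (ptarget Q (u, take i es), drop i es)) \<longleftrightarrow>
          (i = plength p \<and> ptarget Q p = psource q \<and> pconcat p q = (u, es))"
        by (cases p; cases q) (auto simp: psource_def pconcat_def plength_def)
      have "lookup (single p c) (u, take i es) *
          lookup (single q d) (ptarget Q (u, take i es), drop i es) =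
          (if p = (u, take i es) \<and> q = (ptarget Q (u, take i es), drop i es) then c * d else 0)"
        by (simp add: lookup_single when_def)
      also have "\<dots> = (if i = plength p then
          (if ptarget Q p = psource q \<and> pconcat p q = (u, es) then c * d else 0) else 0)"
        unfolding eq by simp
      finally show "lookup (single p c) (u, take i es) *
          lookup (single q d) (ptarget Q (u, take i es), drop i es) = \<dots>" .
    qed
    also have "\<dots> = (if ptarget Q p = psource q \<and> pconcat p q = (u, es) then c * d else 0)"
      by (cases p; cases q) (auto simp: plength_def pconcat_def)
    finally show ?case by (simp add: path_mult_single lookup_single when_def)
  qed (simp_all add: path_mult_add_right lookup_add distrib_left sum.distrib)
qed (simp_all add: path_mult_add_left lookup_add distrib_right sum.distrib)

text \<open>The convolution descends to classes because both pieces of a cut good path are good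
  again, so no coefficient in the sum depends on the representative.\<close>

lemma cf_mult:
  assumes "r \<in> carrier B" "s \<in> carrier B" "(u, es) \<in> gp"
  shows "cf (r \<bullet> s) (u, es) =
    (\<Sum>i\<le>length es. cf r (u, take i es) * cf s (ptarget Q (u, take i es), drop i es))"
proof -
  from assms obtain f g where fg: "keys f \<subseteq> paths Q" "r = cls f"
      "keys g \<subseteq> paths Q" "s = cls g"
    by (auto simp: carrier_B)
  have k: "keys (path_mult Q f g) \<subseteq> paths Q"
    using fg by (intro keys_path_mult fin_digraph_axioms)
  have "(u, take i es) \<in> gp \<and> (ptarget Q (u, take i es), drop i es) \<in> gp" for i
    using gp_appendD[of u "take i es" "drop i es"] assms(3) by simp
  then show ?thesis
    using fg k assms(3) by (simp add: cls_mult[symmetric] cf_cls lookup_path_mult)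
qed

lemma ce_carrier [simp, intro]: "v \<in> verts Q \<Longrightarrow> ce v c \<in> carrier B"
  by (force simp: ce_def carrier_B Nil_in_paths intro!: exI[of _ "single (v, []) c"] split: if_splits)

lemma ar_carrier [simp, intro]: "a \<in> arcs Q \<Longrightarrow> ar a \<in> carrier B"
  by (auto simp: ar_def carrier_B Nil_in_paths Cons_in_paths intro!: exI[of _ "path_elem (tail Q a, [a])"])

lemma cf_ce: "v \<in> verts Q \<Longrightarrow> cf (ce v c) p = (if p = (v, []) then c else 0)"
  by (auto simp: ce_def cf_cls Nil_in_paths gp_Nil lookup_single when_def)

lemma cf_ar: "a \<in> arcs Q \<Longrightarrow> cf (ar a) p = (if p = (tail Q a, [a]) then 1 else 0)"
  by (auto simp: ar_def cf_cls Nil_in_paths Cons_in_paths gp_single lookup_single when_def)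

lemma cf_mult_ce:
  assumes "r \<in> carrier B" "v \<in> verts Q"
  shows "cf (r \<bullet> ce v c) p = (if ptarget Q p = v then cf r p * c else 0)"
proof (cases "p \<in> gp")
  case True
  obtain u es where [simp]: "p = (u, es)" by (cases p)
  have "cf (r \<bullet> ce v c) p = (\<Sum>i\<le>length es. if i = length es then
      (if ptarget Q p = v then cf r p * c else 0) else 0)"
    using True assms unfolding \<open>p = (u, es)\<close> cf_mult[OF assms(1) ce_carrier[OF assms(2)] True[unfolded \<open>p = (u, es)\<close>]]
    by (intro sum.cong refl) (auto simp: cf_ce)
  then show ?thesis by simp
qed (simp add: cf_outside)

lemma cf_ce_mult:
  assumes "r \<in> carrier B" "v \<in> verts Q"
  shows "cf (ce v c \<bullet> r) p = (if psource p = v then c * cf r p else 0)"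
proof (cases "p \<in> gp")
  case True
  obtain u es where [simp]: "p = (u, es)" by (cases p)
  have "cf (ce v c \<bullet> r) p = (\<Sum>i\<le>length es. if i = 0 then
      (if psource p = v then c * cf r p else 0) else 0)"
    using True assms unfolding \<open>p = (u, es)\<close> cf_mult[OF ce_carrier[OF assms(2)] assms(1) True[unfolded \<open>p = (u, es)\<close>]]
    by (intro sum.cong refl) (auto simp: cf_ce psource_def ptarget_code)
  then show ?thesis by simp
qed (simp add: cf_outside)

lemma cf_mult_ar:
  assumes "r \<in> carrier B" "a \<in> arcs Q"
  shows "cf (r \<bullet> ar a) p =
    (if p \<in> gp \<and> snd p \<noteq> [] \<and> last (snd p) = a then cf r (fst p, butlast (snd p)) else 0)"
proof (cases "p \<in> gp")
  case True
  obtain u es where [simp]: "p = (u, es)" by (cases p)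
  show ?thesis
  proof (cases es rule: rev_cases)
    case Nil
    then show ?thesis using True assms by (simp add: cf_mult cf_ar)
  next
    case (snoc xs b)
    have "cf (r \<bullet> ar a) p = (\<Sum>i\<le>length es. if i = length xs then
      (if b = a then cf r (u, xs) else 0) else 0)"
      using True assms snoc
      unfolding \<open>p = (u, es)\<close> cf_mult[OF assms(1) ar_carrier[OF assms(2)] True[unfolded \<open>p = (u, es)\<close>]]
    proof (intro sum.cong refl)
      fix i assume i: "i \<in> {..length es}"
      have d: "drop i es = [a] \<longleftrightarrow> i = length xs \<and> b = a"
      proof
        assume 1: "drop i es = [a]"
        then have "length (drop i es) = 1" by simp
        then have "i = length xs" using snoc by auto
        then show "i = length xs \<and> b = a" using 1 snoc by auto
      qed (use snoc in auto)
      have "ptarget Q (u, take (length xs) es) = tail Q b"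
        using True snoc by (simp add: gp_snoc)
      then show "cf r (u, take i es) * cf (ar a) (ptarget Q (u, take i es), drop i es) =
          (if i = length xs then if b = a then cf r (u, xs) else 0 else 0)"
        using d snoc assms(2) by (cases "drop i es = [a]") (simp_all add: cf_ar)
    qed
    then show ?thesis using True snoc by simp
  qed
qed (simp add: cf_outside)

lemma cf_ar_mult:
  assumes "r \<in> carrier B" "a \<in> arcs Q"
  shows "cf (ar a \<bullet> r) p =
    (if p \<in> gp \<and> snd p \<noteq> [] \<and> hd (snd p) = a then cf r (head Q a, tl (snd p)) else 0)"
proof (cases "p \<in> gp")
  case True
  obtain u es where [simp]: "p = (u, es)" by (cases p)
  show ?thesis
  proof (cases es)
    case Nil
    then show ?thesis using True assms by (simp add: cf_mult cf_ar)
  next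
    case (Cons b xs)
    have "cf (ar a \<bullet> r) p = (\<Sum>i\<le>length es. if i = 1 then
      (if b = a then cf r (head Q a, xs) else 0) else 0)"
      using True assms Cons
      unfolding \<open>p = (u, es)\<close> cf_mult[OF ar_carrier[OF assms(2)] assms(1) True[unfolded \<open>p = (u, es)\<close>]]
      by (intro sum.cong refl) (auto simp: cf_ar gp_Cons take_Cons' ptarget_code)
    then show ?thesis using True Cons by (cases xs) (auto simp: Suc_le_eq)
  qed
qed (simp add: cf_outside)

text \<open>A trivial path has only one cut. The coefficient at a vertex is thus multiplicative; it
  later separates generators of \<open>a B\<close> from radical elements.\<close>

lemma cf_mult_trivial:
  "r \<in> carrier B \<Longrightarrow> s \<in> carrier B \<Longrightarrow> cf (r \<bullet> s) (v, []) = cf r (v, []) * cf s (v, [])"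
  by (cases "(v, []) \<in> gp") (simp_all add: cf_mult cf_outside ptarget_code)

text \<open>Path length defines a multiplicative filtration; with the length bound, elements without
  trivial paths become nilpotent.\<close>

lemma cf_mult_length:
  assumes "r \<in> carrier B" "s \<in> carrier B"
    "\<And>p. cf r p \<noteq> 0 \<Longrightarrow> m \<le> plength p" "\<And>p. cf s p \<noteq> 0 \<Longrightarrow> n \<le> plength p"
    "cf (r \<bullet> s) p \<noteq> 0"
  shows "m + n \<le> plength p"
proof -
  obtain u es where [simp]: "p = (u, es)" by (cases p)
  have "p \<in> gp" using assms(5) cf_outside by blast
  then have "(\<Sum>i\<le>length es. cf r (u, take i es) * cf s (ptarget Q (u, take i es), drop i es)) \<noteq> 0"
    using assms(5) cf_mult[OF assms(1,2), of u es] by simp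
  then obtain i where i: "i \<le> length es"
      "cf r (u, take i es) * cf s (ptarget Q (u, take i es), drop i es) \<noteq> 0"
    by (meson atMost_iff sum.not_neutral_contains_not_neutral)
  then have "m \<le> plength (u, take i es)" "n \<le> plength (ptarget Q (u, take i es), drop i es)"
    by (auto intro!: assms(3,4))
  then show ?thesis using i(1) by (simp add: plength_def)
qed

text \<open>Stripping the last arrow from every path in the support gives the coefficients of the
  left factor; these live on good paths because initial pieces of good paths are good.\<close>

lemma right_factor:
  assumes "r \<in> carrier B" "a \<in> arcs Q" "\<And>p. cf r p \<noteq> 0 \<Longrightarrow> snd p \<noteq> [] \<and> last (snd p) = a"
  obtains s where "s \<in> carrier B" "r = s \<bullet> ar a"
proof -
  have *: "p \<in> gp" if "cf r (fst p, snd p @ [a]) \<noteq> 0" for p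
    using that cf_outside gp_appendD(1) by (metis prod.collapse)
  obtain s where s: "s \<in> carrier B" "\<And>p. cf s p = cf r (fst p, snd p @ [a])"
    using cf_surj[of "\<lambda>p. cf r (fst p, snd p @ [a])"] *  by blast
  show ?thesis
  proof (rule that[OF s(1)], rule cf_eqI)
    fix p show "cf r p = cf (s \<bullet> ar a) p"
      using assms(3)[of p] cf_outside[of p r]
      by (cases "cf r p = 0") (auto simp: cf_mult_ar[OF s(1) assms(2)] s(2))
  qed (use assms s in auto)
qed

lemma left_factor:
  assumes "r \<in> carrier B" "a \<in> arcs Q" "\<And>p. cf r p \<noteq> 0 \<Longrightarrow> snd p \<noteq> [] \<and> hd (snd p) = a"
  obtains s where "s \<in> carrier B" "r = ar a \<bullet> s"
proof -
  \<comment> \<open>The guard on the start vertex is there because a path carries its source: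
    without it every choice of \<open>fst p\<close> would receive the same coefficient, even if
    \<open>p\<close> cannot follow \<open>a\<close>.\<close>
  have *: "p \<in> gp" if "(if fst p = head Q a then cf r (tail Q a, a # snd p) else 0) \<noteq> 0" for p
    using that cf_outside gp_Cons by (metis prod.collapse)
  obtain s where s: "s \<in> carrier B" "\<And>p. cf s p = (if fst p = head Q a then cf r (tail Q a, a # snd p) else 0)"
    using cf_surj[of "\<lambda>p. if fst p = head Q a then cf r (tail Q a, a # snd p) else 0"] * by blast
  show ?thesis
  proof (rule that[OF s(1)], rule cf_eqI)
    fix p show "cf r p = cf (ar a \<bullet> s) p"
      using assms(3)[of p] cf_outside[of p r]
      by (cases p; cases "snd p"; cases "cf r p = 0")
        (auto simp: cf_ar_mult[OF s(1) assms(2)] s(2) gp_Cons)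
  qed (use assms s in auto)
qed

text \<open>As a ring the quotient is generated by the elements \<open>ce v c\<close> and the
  arrows, since a path is the product of its arrows. Linearity of a map is thereby reduced to these
  generators.\<close>

lemma B_induct [consumes 1, case_names zero vertex arrow add mult]:
  assumes "r \<in> carrier B" "P \<zero>\<^bsub>B\<^esub>" "\<And>v c. v \<in> verts Q \<Longrightarrow> P (ce v c)"
    "\<And>a. a \<in> arcs Q \<Longrightarrow> P (ar a)"
    "\<And>r s. r \<in> carrier B \<Longrightarrow> s \<in> carrier B \<Longrightarrow> P r \<Longrightarrow> P s \<Longrightarrow> P (r \<oplus>\<^bsub>B\<^esub> s)"
    "\<And>r s. r \<in> carrier B \<Longrightarrow> s \<in> carrier B \<Longrightarrow> P r \<Longrightarrow> P s \<Longrightarrow> P (r \<bullet> s)"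
  shows "P r"
proof -
  have single: "P (cls (single (u, es) c))" if "(u, es) \<in> paths Q" for u es c
    using that
  proof (induction es rule: rev_induct)
    case Nil
    then show ?case using assms(3)[of u c] by (simp add: ce_def Nil_in_paths)
  next
    case (snoc a es)
    then have p: "(u, es) \<in> paths Q" "a \<in> arcs Q" "tail Q a = ptarget Q (u, es)"
      by (auto simp: snoc_in_paths)
    have "cls (single (u, es @ [a]) c) =
        cls (path_mult Q (single (u, es) c) (path_elem (tail Q a, [a])))"
      using p by (simp add: path_mult_single psource_def pconcat_def)
    also have "\<dots> = cls (single (u, es) c) \<bullet> ar a"
      using p by (subst cls_mult) (auto simp: ar_def Cons_in_paths Nil_in_paths)
    finally have eq: "cls (single (u, es @ [a]) c) = cls (single (u, es) c) \<bullet> ar a" .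
    have "cls (single (u, es) c) \<in> carrier B"
      unfolding carrier_B by (rule exI[of _ "single (u, es) c"]) (use p in auto)
    then show ?case unfolding eq using p snoc.IH by (intro assms(4,6)) auto
  qed
  obtain f where f: "keys f \<subseteq> paths Q" "r = cls f" using assms(1) by (auto simp: carrier_B)
  have "keys (\<Sum>p\<in>X. single p (lookup f p)) \<subseteq> paths Q \<and>
     P (cls (\<Sum>p\<in>X. single p (lookup f p)))"
    if "finite X" "X \<subseteq> paths Q" for X
    using that
  proof (induction X rule: finite_induct)
    case empty
    then show ?case using assms(2) by (simp add: cls_zero)
  next
    case (insert p X)
    let ?s = "\<lambda>X. \<Sum>p\<in>X. single p (lookup f p)"
    have k: "keys (single p (lookup f p)) \<subseteq> paths Q"
      "keys (?s X) \<subseteq> paths Q" "P (cls (?s X))" using insert by auto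
    have "P (cls (single p (lookup f p)) \<oplus>\<^bsub>B\<^esub> cls (?s X))"
      using k insert.prems single[of "fst p" "snd p"] by (intro assms(5) cls_carrier) auto
    then have "P (cls (?s (insert p X)))" using k insert.hyps by (simp add: cls_add)
    moreover have "keys (?s (insert p X)) \<subseteq> paths Q"
      using k insert.hyps keys_add[of "single p (lookup f p)" "?s X"] by auto
    ultimately show ?case by blast
  qed
  from this[OF finite_keys f(1)] show ?thesis using f(2) sum_single_keys[of f] by simp
qed

lemma ce_idem: "v \<in> verts Q \<Longrightarrow> ce v 1 \<bullet> ce v 1 = ce v 1"
  by (rule cf_eqI) (auto simp: cf_mult_ce cf_ce ptarget_code)

lemma ce_mult_ar: "a \<in> arcs Q \<Longrightarrow> ce (tail Q a) 1 \<bullet> ar a = ar a"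
  by (rule cf_eqI) (auto simp: cf_ce_mult cf_ar psource_def)

lemma ar_mult_ce: "a \<in> arcs Q \<Longrightarrow> ar a \<bullet> ce (head Q a) 1 = ar a"
  by (rule cf_eqI) (auto simp: cf_mult_ce cf_ar ptarget_code)

lemma ar_mult_ar:
  assumes "rel a b" shows "ar a \<bullet> ar b = \<zero>\<^bsub>B\<^esub>"
proof (rule cf_eqI)
  fix p :: "('v, 'e) path"
  have *: "a \<in> arcs Q" "b \<in> arcs Q" "head Q a = tail Q b" using rel_in_arcs assms by auto
  have False if "p \<in> gp" "snd p \<noteq> []" "last (snd p) = b" "(fst p, butlast (snd p)) = (tail Q a, [a])"
  proof -
    from that have "p = (tail Q a, [a] @ [b])" using append_butlast_last_id[of "snd p"] by (cases p) auto
    then show False using that(1) assms by (simp only: gp_snoc) simp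
  qed
  then show "cf (ar a \<bullet> ar b) p = cf \<zero>\<^bsub>B\<^esub> p" using * by (auto simp: cf_mult_ar cf_ar)
qed (use rel_in_arcs[OF assms] in auto)

text \<open>Together with \<open>rel_unique_post\<close> this makes \<open>rel\<close> a partial
  injection on the arrows: relations can be followed in either direction without choice.\<close>

lemma rel_unique_pre:
  assumes "rel a c" "rel b c" shows "a = b"
proof -
  have c: "c \<in> arcs Q" using assms rel_in_arcs by blast
  have "card {a, b} \<le> card {a \<in> arcs Q. head Q a = tail Q c \<and> rel a c}"
    using assms rel_in_arcs by (intro card_mono) auto
  then show ?thesis using pre_in[OF c] by (cases "a = b") auto
qed

lemma rel_unique_post:
  assumes "rel c a" "rel c b" shows "a = b"
proof -
  have c: "c \<in> arcs Q" using assms rel_in_arcs by blast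
  have "card {a, b} \<le> card {a \<in> arcs Q. tail Q a = head Q c \<and> rel c a}"
    using assms rel_in_arcs(2) rel_in_arcs(3)[symmetric] by (intro card_mono) auto
  then show ?thesis using post_in[OF c] by (cases "a = b") auto
qed

end


section \<open>Submodules of free modules, combinatorially\<close>

text \<open>Functions into the field form a vector space on a whole type, so the linear algebra of
  \<open>vector_space\<close> applies without carrier sets.\<close>

definition fscale :: "'k::field \<Rightarrow> ('j \<Rightarrow> 'k) \<Rightarrow> 'j \<Rightarrow> 'k" where
  "fscale c x = (\<lambda>j. c * x j)"

lemma fscale_apply [simp]: "fscale c x j = c * x j"
  by (simp add: fscale_def)

interpretation fs: vector_space fscale
  by unfold_locales (auto simp: fun_eq_iff algebra_simps)

interpretation fsp: vector_space_pair fscale fscale ..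

lemma sum_fun_apply: "(\<Sum>i\<in>A. f i) j = (\<Sum>i\<in>A. f i j)"
  by (induction A rule: infinite_finite_induct) auto

text \<open>A basis \<open>B0\<close> of \<open>D\<close> is extended to a basis \<open>B\<close> of
  \<open>N\<close>. The linear map that kills \<open>B0\<close> and fixes the other basis vectors is
  a projection along \<open>D\<close>, and its image of \<open>N\<close> is the complement.\<close>

lemma subspace_complement:
  assumes "fs.subspace D" "fs.subspace N" "D \<subseteq> N"
  shows "\<exists>T. fs.subspace T \<and> T \<subseteq> N \<and> T \<inter> D \<subseteq> {0} \<and> (\<forall>x\<in>N. \<exists>s\<in>T. \<exists>d\<in>D. x = s + d)"
proof -
  obtain B0 where B0: "B0 \<subseteq> D" "fs.independent B0" "D \<subseteq> fs.span B0"
    using fs.maximal_independent_subset by blast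
  obtain B where B: "B0 \<subseteq> B" "B \<subseteq> N" "fs.independent B" "N \<subseteq> fs.span B"
    using fs.maximal_independent_subset_extend[of B0 N] B0 assms(3) by blast
  obtain f where f: "Vector_Spaces.linear fscale fscale f" "\<And>b. b \<in> B \<Longrightarrow> f b = (if b \<in> B0 then 0 else b)"
    using fsp.linear_independent_extend[OF B(3), of "\<lambda>b. if b \<in> B0 then 0 else b"] by blast
  interpret f: Vector_Spaces.linear fscale fscale f by (rule f(1))
  have D0: "f x = 0" if "x \<in> D" for x
    by (rule f.eq_0_on_span[of B0]) (use B0 B f(2) that in auto)
  have N: "f x \<in> N \<and> x - f x \<in> D" if "x \<in> N" for x
  proof -
    have "fs.subspace {x. f x \<in> N \<and> x - f x \<in> D}"
    proof (rule fs.subspaceI)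
      fix x y assume "x \<in> {x. f x \<in> N \<and> x - f x \<in> D}" "y \<in> {x. f x \<in> N \<and> x - f x \<in> D}"
      then show "x + y \<in> {x. f x \<in> N \<and> x - f x \<in> D}"
        using fs.subspace_add[OF assms(2), of "f x" "f y"] fs.subspace_add[OF assms(1), of "x - f x" "y - f y"]
        by (simp add: f.add algebra_simps)
    next
      fix c x assume "x \<in> {x. f x \<in> N \<and> x - f x \<in> D}"
      then show "fscale c x \<in> {x. f x \<in> N \<and> x - f x \<in> D}"
        using fs.subspace_scale[OF assms(2), of "f x" c] fs.subspace_scale[OF assms(1), of "x - f x" c]
        by (simp add: f.scale fs.scale_right_diff_distrib)
    qed (use assms fs.subspace_0 in auto)
    moreover have "b \<in> {x. f x \<in> N \<and> x - f x \<in> D}" if "b \<in> B" for b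
      using that f(2)[OF that] B B0 assms fs.subspace_0 by auto
    ultimately show ?thesis using fs.span_minimal[of B] B(4) that by blast
  qed
  show ?thesis
  proof (intro exI[of _ "f ` N"] conjI ballI)
    show "fs.subspace (f ` N)" using f.subspace_image assms(2) by blast
    show "f ` N \<subseteq> N" using N by auto
    show "f ` N \<inter> D \<subseteq> {0}"
    proof
      fix y assume "y \<in> f ` N \<inter> D"
      then obtain x where x: "x \<in> N" "y = f x" "f x \<in> D" by auto
      have "f (x - f x) = 0" using N D0 x(1) by blast
      then have "y = f (f x)" using x(2) by (simp add: f.diff)
      then show "y \<in> {0}" using D0 x by simp
    qed
    fix x assume "x \<in> N"
    then show "\<exists>s\<in>f ` N. \<exists>d\<in>D. x = s + d"
      using N by (intro bexI[of _ "f x"] bexI[of _ "x - f x"]) auto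
  qed
qed

context gentle
begin

text \<open>
  Elements of free modules are functions on pairs of an index and a good path; \<open>ev w\<close> and \<open>act a\<close>
  are right multiplication by the idempotent of \<open>w\<close> and by \<open>a\<close>.  A tag \<open>Inl v\<close> or \<open>Inr a\<close> stands
  for the generator \<open>e\<^sub>v\<close> or \<open>a\<close> of a right ideal.
\<close>

definition ev :: "'v \<Rightarrow> (nat \<times> ('v, 'e) path \<Rightarrow> 'k) \<Rightarrow> nat \<times> ('v, 'e) path \<Rightarrow> 'k" where
  "ev w x = (\<lambda>(i, p). if ptarget Q p = w then x (i, p) else 0)"

definition act :: "'e \<Rightarrow> (nat \<times> ('v, 'e) path \<Rightarrow> 'k) \<Rightarrow> nat \<times> ('v, 'e) path \<Rightarrow> 'k" where
  "act a x = (\<lambda>(i, p). if p \<in> gp \<and> snd p \<noteq> [] \<and> last (snd p) = a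
                       then x (i, (fst p, butlast (snd p))) else 0)"

definition supported :: "(nat \<times> ('v, 'e) path \<Rightarrow> 'k) \<Rightarrow> bool" where
  "supported x \<longleftrightarrow> (\<forall>i p. x (i, p) \<noteq> 0 \<longrightarrow> p \<in> gp)"

text \<open>Submodules in the language of representations: stability under idempotents and arrows
  stands for stability under the whole algebra.\<close>

definition rep_closed :: "(nat \<times> ('v, 'e) path \<Rightarrow> 'k) set \<Rightarrow> bool" where
  "rep_closed M \<longleftrightarrow> fs.subspace M \<and> (\<forall>w\<in>verts Q. \<forall>x\<in>M. ev w x \<in> M) \<and> (\<forall>a\<in>arcs Q. \<forall>x\<in>M. act a x \<in> M)"

definition inn :: "'v \<Rightarrow> 'e set" where "inn w = {a \<in> arcs Q. head Q a = w}"

definition tags :: "('v + 'e) set" where "tags = Inl ` verts Q \<union> Inr ` arcs Q"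

definition ending :: "'v + 'e \<Rightarrow> ('v, 'e) path \<Rightarrow> bool" where
  "ending \<tau> p = (case \<tau> of Inl w \<Rightarrow> ptarget Q p = w | Inr a \<Rightarrow> snd p \<noteq> [] \<and> last (snd p) = a)"

definition tag_path :: "'v + 'e \<Rightarrow> ('v, 'e) path" where
  "tag_path \<tau> = (case \<tau> of Inl w \<Rightarrow> (w, []) | Inr a \<Rightarrow> (tail Q a, [a]))"

text \<open>The index is \<open>0\<close> because right ideals are realised inside the free module
  of rank one; \<open>emb_gelem\<close> identifies this function with the generator of the
  ideal.\<close>

definition tag_elem :: "'v + 'e \<Rightarrow> nat \<times> ('v, 'e) path \<Rightarrow> 'k" where
  "tag_elem \<tau> = (\<lambda>(i, p). if i = 0 \<and> p = tag_path \<tau> then 1 else 0)"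

lemma tags_simps [simp]: "Inl w \<in> tags \<longleftrightarrow> w \<in> verts Q" "Inr a \<in> tags \<longleftrightarrow> a \<in> arcs Q"
  by (auto simp: tags_def)

lemma finite_inn [simp]: "finite (inn w)" by (simp add: inn_def)

lemma ev_linear [simp]:
  "ev w 0 = 0" "ev w (x + y) = ev w x + ev w y" "ev w (fscale c x) = fscale c (ev w x)"
  by (auto simp: ev_def fun_eq_iff)

lemma act_linear [simp]:
  "act a 0 = 0" "act a (x + y) = act a x + act a y" "act a (fscale c x) = fscale c (act a x)"
  by (auto simp: act_def fun_eq_iff)

lemma act_diff [simp]: "act a (x - y) = act a x - act a y"
  by (auto simp: act_def fun_eq_iff)

lemma ev_ev: "ev w (ev v x) = (if v = w then ev w x else 0)"
  by (auto simp: ev_def fun_eq_iff)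

lemma ev_act: "ev w (act a x) = (if head Q a = w then act a x else 0)"
  by (auto simp: ev_def act_def fun_eq_iff ptarget_code)

lemma ev_ending_arrow: "(\<And>i p. x (i, p) \<noteq> 0 \<Longrightarrow> ending (Inr a) p) \<Longrightarrow>
    ev w x = (if head Q a = w then x else 0)"
  by (fastforce simp: ev_def fun_eq_iff ptarget_code ending_def)

lemma ev_ending_vertex: "(\<And>i p. x (i, p) \<noteq> 0 \<Longrightarrow> ending (Inl v) p) \<Longrightarrow>
    ev w x = (if v = w then x else 0)"
  by (fastforce simp: ev_def fun_eq_iff ending_def)

lemma ending_tag_path: "ending \<tau> (tag_path \<tau>)"
  by (auto simp: ending_def tag_path_def ptarget_code split: sum.splits)

lemma tag_elem_ending: "tag_elem \<tau> (i, p) \<noteq> 0 \<Longrightarrow> ending \<tau> p"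
  using ending_tag_path by (auto simp: tag_elem_def split: if_splits)

lemma tag_path_gp: "\<tau> \<in> tags \<Longrightarrow> tag_path \<tau> \<in> gp"
  by (auto simp: tags_def tag_path_def gp_Nil gp_single)

lemma supported_tag_elem: "\<tau> \<in> tags \<Longrightarrow> supported (tag_elem \<tau>)"
  using tag_path_gp by (auto simp: supported_def tag_elem_def split: if_splits)

lemma act_ending: "act a x (i, p) \<noteq> 0 \<Longrightarrow> ending (Inr a) p"
  by (auto simp: act_def ending_def split: if_splits)

lemma supported_act: "supported (act a x)"
  by (auto simp: supported_def act_def split: if_splits)

lemma supported_linear:
  "supported 0" "supported x \<Longrightarrow> supported y \<Longrightarrow> supported (x + y)"
  "supported x \<Longrightarrow> supported (fscale c x)" "supported x \<Longrightarrow> supported (ev w x)"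
  unfolding supported_def ev_def by (auto split: if_splits) (metis add.right_neutral)

lemma supportedD: "supported x \<Longrightarrow> x (i, p) \<noteq> 0 \<Longrightarrow> p \<in> gp"
  unfolding supported_def by blast

lemma sum_ev: "supported x \<Longrightarrow> (\<Sum>w\<in>verts Q. ev w x) = x"
proof
  fix j :: "nat \<times> ('v, 'e) path"
  obtain i p where j: "j = (i, p)" by (cases j)
  assume x: "supported x"
  have "(\<Sum>w\<in>verts Q. ev w x) j = (\<Sum>w\<in>verts Q. if w = ptarget Q p then x (i, p) else 0)"
    unfolding sum_fun_apply by (intro sum.cong refl) (auto simp: ev_def j)
  also have "\<dots> = x j"
    using x path_ends_in_verts[OF fin_digraph_axioms, of p]
    using supportedD[OF x, of i p] by (cases "x (i, p) = 0") (auto simp: good_paths_def j)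
  finally show "(\<Sum>w\<in>verts Q. ev w x) j = x j" .
qed

lemma act_ev_tail: "act a (ev (tail Q a) x) = act a x"
proof
  fix j :: "nat \<times> ('v, 'e) path"
  obtain i u es where j: "j = (i, (u, es))" by (metis prod.collapse)
  show "act a (ev (tail Q a) x) j = act a x j"
    using gp_snoc[of u "butlast es" "last es"]
    by (cases "es = []") (auto simp: act_def ev_def j)
qed

text \<open>A path \<open>p\<close> in the support with \<open>p a\<close> good would leave its
  coefficient in \<open>act a x\<close> at \<open>p a\<close>. So each path in the support ends in
  an arrow that forms a relation with \<open>a\<close>, and gentleness allows only one such
  arrow.\<close>

lemma act_kernel:
  assumes x: "supported x" "ev (tail Q a) x = x" and a: "a \<in> arcs Q" and 0: "act a x = 0"
  shows "x = 0 \<or> (\<exists>b. rel b a \<and> (\<forall>i p. x (i, p) \<noteq> 0 \<longrightarrow> ending (Inr b) p))"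
proof -
  have *: "snd p \<noteq> [] \<and> rel (last (snd p)) a" if p: "x (i, p) \<noteq> 0" for i p
  proof (rule ccontr)
    assume n: "\<not> ?thesis"
    obtain u es where [simp]: "p = (u, es)" by (cases p)
    have "ev (tail Q a) x (i, p) \<noteq> 0" using p x(2) by simp
    then have "ptarget Q p = tail Q a" by (simp add: ev_def split: if_splits)
    moreover have "p \<in> gp" using x(1) p by (rule supportedD)
    ultimately have "(u, es @ [a]) \<in> gp" using n a by (auto simp: gp_snoc)
    then have "act a x (i, (u, es @ [a])) = x (i, p)" by (simp add: act_def)
    then show False using p 0 by simp
  qed
  show ?thesis
  proof (cases "x = 0")
    case False
    then obtain i p where p: "x (i, p) \<noteq> 0" by (metis ext zero_fun_apply surj_pair)
    have "last (snd q) = last (snd p)" if "x (j, q) \<noteq> 0" for j q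
      using *[OF that] *[OF p] rel_unique_pre by blast
    then have "\<forall>j q. x (j, q) \<noteq> 0 \<longrightarrow> ending (Inr (last (snd p))) q"
      using * unfolding ending_def sum.case by blast
    then show ?thesis using *[OF p] by blast
  qed simp
qed

text \<open>The converse of \<open>act_kernel\<close>: a path ending in \<open>b\<close> cannot be
  prolonged by \<open>a\<close> to a good path. It will be applied to values of the
  retraction.\<close>

lemma act_of_ending:
  assumes "rel b a" "\<And>i p. x (i, p) \<noteq> 0 \<Longrightarrow> ending (Inr b) p"
  shows "act a x = 0"
proof
  fix j :: "nat \<times> ('v, 'e) path"
  obtain i u es where j: "j = (i, (u, es))" by (metis prod.collapse)
  show "act a x j = 0 j"
    using gp_snoc[of u "butlast es" "last es"] assms(1) assms(2)[of i "(u, butlast es)"]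
    by (cases "es = []") (auto simp: act_def j ending_def)
qed

end

section \<open>Complements inside a submodule of a free module\<close>

locale rep_submodule = gentle Q I
  for Q :: "('v, 'e) pre_digraph" and I :: "(('v, 'e) path \<Rightarrow>\<^sub>0 'k::field) set" +
  fixes M :: "(nat \<times> ('v, 'e) path \<Rightarrow> 'k) set"
  assumes closed: "rep_closed M" and supp: "x \<in> M \<Longrightarrow> supported x"
begin

lemma M_closed:
  "0 \<in> M" "x \<in> M \<Longrightarrow> y \<in> M \<Longrightarrow> x + y \<in> M" "x \<in> M \<Longrightarrow> fscale c x \<in> M"
  "x \<in> M \<Longrightarrow> y \<in> M \<Longrightarrow> x - y \<in> M"
  "w \<in> verts Q \<Longrightarrow> x \<in> M \<Longrightarrow> ev w x \<in> M" "a \<in> arcs Q \<Longrightarrow> x \<in> M \<Longrightarrow> act a x \<in> M"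
  using closed fs.subspace_0 fs.subspace_add fs.subspace_scale fs.subspace_diff
  by (auto simp: rep_closed_def)

definition N :: "'v + 'e \<Rightarrow> (nat \<times> ('v, 'e) path \<Rightarrow> 'k) set" where
  "N \<tau> = {x \<in> M. \<forall>i p. x (i, p) \<noteq> 0 \<longrightarrow> ending \<tau> p}"

text \<open>The part of \<open>N \<tau>\<close> that is accounted for elsewhere: by elements ending
  in single arrows if \<tau> is a vertex, by multiples of the arrow inside \<open>M\<close> if
  \<tau> is an arrow. What \<open>D\<close> misses yields direct summands, of the form
  \<open>e_v B\<close> for a vertex and \<open>a B\<close> for an arrow.\<close>

definition D :: "'v + 'e \<Rightarrow> (nat \<times> ('v, 'e) path \<Rightarrow> 'k) set" where
  "D \<tau> = (case \<tau> of Inl w \<Rightarrow> {\<Sum>a\<in>inn w. n a | n. \<forall>a\<in>inn w. n a \<in> N (Inr a)}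
                   | Inr a \<Rightarrow> act a ` M)"

lemma subspace_N: "fs.subspace (N \<tau>)"
proof (rule fs.subspaceI)
  fix x y assume "x \<in> N \<tau>" "y \<in> N \<tau>"
  then show "x + y \<in> N \<tau>"
    by (auto simp: N_def M_closed) (metis add.right_neutral)
qed (auto simp: N_def M_closed)

lemma D_subset_N:
  assumes "\<tau> \<in> tags" shows "D \<tau> \<subseteq> N \<tau>"
proof (cases \<tau>)
  case (Inr a)
  then show ?thesis using assms act_ending by (auto simp: D_def N_def tags_def intro: M_closed)
next
  case (Inl w)
  have sub: "N (Inr a) \<subseteq> N (Inl w)" if "a \<in> inn w" for a
    using that by (auto simp: N_def ending_def ptarget_code inn_def)
  show ?thesis using sub by (auto simp: D_def Inl intro!: fs.subspace_sum[OF subspace_N])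
qed

lemma subspace_D:
  assumes "\<tau> \<in> tags" shows "fs.subspace (D \<tau>)"
proof (cases \<tau>)
  case (Inr a)
  show ?thesis
  proof (rule fs.subspaceI)
    show "0 \<in> D \<tau>" using M_closed(1) by (force simp: D_def Inr)
    fix x y c assume "x \<in> D \<tau>"
    then obtain x' where x': "x' \<in> M" "x = act a x'" by (auto simp: D_def Inr)
    then show "fscale c x \<in> D \<tau>" using M_closed(3)[of x' c] by (force simp: D_def Inr)
    assume "y \<in> D \<tau>"
    then obtain y' where "y' \<in> M" "y = act a y'" by (auto simp: D_def Inr)
    then show "x + y \<in> D \<tau>" using x' M_closed(2)[of x' y'] by (force simp: D_def Inr)
  qed
next
  case (Inl w)
  show ?thesis
  proof (rule fs.subspaceI)
    show "0 \<in> D \<tau>" using fs.subspace_0[OF subspace_N] by (auto simp: D_def Inl intro!: exI[of _ "\<lambda>_. 0"])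
    fix x y c assume "x \<in> D \<tau>"
    then obtain x' where x': "\<forall>a\<in>inn w. x' a \<in> N (Inr a)" "x = (\<Sum>a\<in>inn w. x' a)" by (auto simp: D_def Inl)
    then show "fscale c x \<in> D \<tau>" using fs.subspace_scale[OF subspace_N]
      by (auto simp: D_def Inl fs.scale_sum_right intro!: exI[of _ "\<lambda>a. fscale c (x' a)"])
    assume "y \<in> D \<tau>"
    then obtain y' where "\<forall>a\<in>inn w. y' a \<in> N (Inr a)" "y = (\<Sum>a\<in>inn w. y' a)" by (auto simp: D_def Inl)
    then show "x + y \<in> D \<tau>" using x' fs.subspace_add[OF subspace_N]
      by (auto simp: D_def Inl sum.distrib intro!: exI[of _ "\<lambda>a. x' a + y' a"])
  qed
qed

definition T :: "'v + 'e \<Rightarrow> (nat \<times> ('v, 'e) path \<Rightarrow> 'k) set" where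
  "T \<tau> = (SOME T. fs.subspace T \<and> T \<subseteq> N \<tau> \<and> T \<inter> D \<tau> \<subseteq> {0} \<and> (\<forall>x\<in>N \<tau>. \<exists>s\<in>T. \<exists>d\<in>D \<tau>. x = s + d))"

lemma T_props:
  assumes "\<tau> \<in> tags"
  shows "fs.subspace (T \<tau>)" "T \<tau> \<subseteq> N \<tau>" "T \<tau> \<inter> D \<tau> \<subseteq> {0}"
    "x \<in> N \<tau> \<Longrightarrow> \<exists>s\<in>T \<tau>. \<exists>d\<in>D \<tau>. x = s + d"
proof -
  have *: "fs.subspace (T \<tau>) \<and> T \<tau> \<subseteq> N \<tau> \<and> T \<tau> \<inter> D \<tau> \<subseteq> {0} \<and> (\<forall>x\<in>N \<tau>. \<exists>s\<in>T \<tau>. \<exists>d\<in>D \<tau>. x = s + d)"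
    unfolding T_def
    by (rule someI_ex) (rule subspace_complement[OF subspace_D[OF assms] subspace_N D_subset_N[OF assms]])
  then show "fs.subspace (T \<tau>)" "T \<tau> \<subseteq> N \<tau>" "T \<tau> \<inter> D \<tau> \<subseteq> {0}"
    "x \<in> N \<tau> \<Longrightarrow> \<exists>s\<in>T \<tau>. \<exists>d\<in>D \<tau>. x = s + d" by blast+
qed

text \<open>Split \<open>x\<close> by end vertices, split off \<open>T\<close> at each vertex, then
  split each remaining component at its arrow. The terms \<open>act a (y a)\<close> contain one more
  arrow than \<open>y a\<close>, which drives the inductions on path length.\<close>

lemma M_decomposition:
  assumes x: "x \<in> M"
  shows "\<exists>s \<sigma> y. (\<forall>w\<in>verts Q. s w \<in> T (Inl w)) \<and> (\<forall>a\<in>arcs Q. \<sigma> a \<in> T (Inr a) \<and> y a \<in> M) \<and>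
    x = (\<Sum>w\<in>verts Q. s w) + (\<Sum>a\<in>arcs Q. \<sigma> a + act a (y a))"
proof -
  have "\<exists>s n. s \<in> T (Inl w) \<and> (\<forall>a\<in>inn w. n a \<in> N (Inr a)) \<and> ev w x = s + (\<Sum>a\<in>inn w. n a)"
    if w: "w \<in> verts Q" for w
  proof -
    have "ev w x \<in> N (Inl w)" using M_closed(5)[OF w x] by (auto simp: N_def ending_def ev_def)
    moreover have "Inl w \<in> tags" using w by (auto simp: tags_def)
    ultimately obtain s d where "s \<in> T (Inl w)" "d \<in> D (Inl w)" "ev w x = s + d"
      using T_props(4) by blast
    then show ?thesis by (auto simp: D_def)
  qed
  then obtain s n where sn: "\<And>w. w \<in> verts Q \<Longrightarrow> s w \<in> T (Inl w)"
    "\<And>w a. w \<in> verts Q \<Longrightarrow> a \<in> inn w \<Longrightarrow> n w a \<in> N (Inr a)"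
    "\<And>w. w \<in> verts Q \<Longrightarrow> ev w x = s w + (\<Sum>a\<in>inn w. n w a)" by metis
  have "\<exists>\<sigma> y. \<sigma> \<in> T (Inr a) \<and> y \<in> M \<and> n (head Q a) a = \<sigma> + act a y" if a: "a \<in> arcs Q" for a
  proof -
    have "n (head Q a) a \<in> N (Inr a)" using a sn(2) by (auto simp: inn_def)
    then show ?thesis using T_props(4)[of "Inr a"] a by (fastforce simp: tags_def D_def)
  qed
  then obtain \<sigma> y where \<sigma>: "\<And>a. a \<in> arcs Q \<Longrightarrow> \<sigma> a \<in> T (Inr a) \<and> y a \<in> M \<and> n (head Q a) a = \<sigma> a + act a (y a)"
    by metis
  have "x = (\<Sum>w\<in>verts Q. ev w x)" using sum_ev[OF supp[OF x]] by simp
  also have "\<dots> = (\<Sum>w\<in>verts Q. s w) + (\<Sum>w\<in>verts Q. \<Sum>a\<in>inn w. n w a)"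
    using sn(3) by (simp add: sum.distrib)
  also have "(\<Sum>w\<in>verts Q. \<Sum>a\<in>inn w. n w a) =
      (\<Sum>w\<in>verts Q. \<Sum>a | a \<in> arcs Q \<and> head Q a = w. \<sigma> a + act a (y a))"
    using \<sigma> by (intro sum.cong) (auto simp: inn_def)
  \<comment> \<open>Each arrow is counted once, at its head.\<close>
  also have "\<dots> = (\<Sum>a\<in>arcs Q. \<sigma> a + act a (y a))"
    by (rule sum.group) auto
  finally show ?thesis using sn(1) \<sigma> by blast
qed

text \<open>Nakayama's lemma: the radical is nilpotent because the lengths of good paths are bounded.\<close>

lemma rep_closed_nakayama:
  assumes M': "rep_closed M'" and T: "\<And>\<tau>. \<tau> \<in> tags \<Longrightarrow> T \<tau> \<subseteq> M'"
  shows "M \<subseteq> M'"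
proof
  fix x assume x: "x \<in> M"
  have sub: "fs.subspace M'" using M' by (simp add: rep_closed_def)
  obtain n where n: "\<forall>p\<in>gp. plength p < n" using good_path_bound by blast
  \<comment> \<open>\<open>x\<close> is approximated from \<open>M'\<close> up to paths of length at
    least \<open>k\<close>: approximating each \<open>y a\<close> up to \<open>k\<close> and
    applying \<open>act a\<close> gains one arrow. At \<open>k = n\<close>, the length bound, no
    error is left.\<close>
  have "\<exists>m\<in>M'. \<forall>i p. (x - m) (i, p) \<noteq> 0 \<longrightarrow> p \<in> gp \<and> k \<le> plength p" if "x \<in> M" for x k
    using that
  proof (induction k arbitrary: x)
    case 0
    then show ?case using supp[OF 0] fs.subspace_0[OF sub] by (auto simp: supported_def intro!: bexI[of _ 0])
  next
    case (Suc k)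
    obtain s \<sigma> y where 1: "\<forall>w\<in>verts Q. s w \<in> T (Inl w)" "\<forall>a\<in>arcs Q. \<sigma> a \<in> T (Inr a) \<and> y a \<in> M"
      "x = (\<Sum>w\<in>verts Q. s w) + (\<Sum>a\<in>arcs Q. \<sigma> a + act a (y a))"
      using M_decomposition[OF Suc.prems] by blast
    have "\<forall>a\<in>arcs Q. \<exists>m\<in>M'. \<forall>i p. (y a - m) (i, p) \<noteq> 0 \<longrightarrow> p \<in> gp \<and> k \<le> plength p"
      using Suc.IH 1 by blast
    then obtain m where m: "\<And>a. a \<in> arcs Q \<Longrightarrow> m a \<in> M'"
      "\<And>a i p. a \<in> arcs Q \<Longrightarrow> (y a - m a) (i, p) \<noteq> 0 \<Longrightarrow> p \<in> gp \<and> k \<le> plength p" by metis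
    let ?m = "(\<Sum>w\<in>verts Q. s w) + (\<Sum>a\<in>arcs Q. \<sigma> a + act a (m a))"
    have sM': "s w \<in> M'" if "w \<in> verts Q" for w
      using T[of "Inl w"] that 1(1) by auto
    have \<sigma>M': "\<sigma> a \<in> M'" if "a \<in> arcs Q" for a
      using T[of "Inr a"] that 1(2) by auto
    have mM': "?m \<in> M'"
      using m(1) M' sM' \<sigma>M'
      by (intro fs.subspace_add[OF sub] fs.subspace_sum[OF sub])
        (auto simp: rep_closed_def)
    have xm: "x - ?m = (\<Sum>a\<in>arcs Q. act a (y a - m a))"
      unfolding 1(3) act_diff by (simp add: sum_subtractf sum.distrib)
    have long: "p \<in> gp \<and> Suc k \<le> plength p"
      if "(\<Sum>a\<in>arcs Q. act a (y a - m a)) (i, p) \<noteq> 0" for i p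
    proof -
      from that obtain a where a: "a \<in> arcs Q" "act a (y a - m a) (i, p) \<noteq> 0"
        unfolding sum_fun_apply by (meson sum.not_neutral_contains_not_neutral)
      then have "p \<in> gp" "snd p \<noteq> []" "(y a - m a) (i, (fst p, butlast (snd p))) \<noteq> 0"
        by (auto simp: act_def split: if_splits)
      moreover from this have "k \<le> plength (fst p, butlast (snd p))" using m(2)[OF a(1)] by blast
      ultimately show ?thesis by (cases "snd p" rule: rev_cases) (auto simp: plength_def)
    qed
    have "\<forall>i p. (x - ?m) (i, p) \<noteq> 0 \<longrightarrow> p \<in> gp \<and> Suc k \<le> plength p"
      unfolding xm using long by blast
    then show ?case using mM' by blast
  qed
  from this[OF x, of n] obtain m where "m \<in> M'" "\<forall>i p. (x - m) (i, p) \<noteq> 0 \<longrightarrow> p \<in> gp \<and> n \<le> plength p"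
    by blast
  moreover from this n have "(x - m) (i, p) = 0" for i p by (meson not_le)
  then have "x - m = 0" by (intro ext) (metis surj_pair zero_fun_apply)
  ultimately show "x \<in> M'" by simp
qed

end

section \<open>The graph of the prescribed retraction\<close>

locale rep_retraction = rep_submodule Q I M
  for Q :: "('v, 'e) pre_digraph" and I :: "(('v, 'e) path \<Rightarrow>\<^sub>0 'k::field) set" and M +
  fixes \<tau>0 :: "'v + 'e" and lam :: "(nat \<times> ('v, 'e) path \<Rightarrow> 'k) \<Rightarrow> 'k"
  assumes \<tau>0: "\<tau>0 \<in> tags" and lam: "lam (x + y) = lam x + lam y" "lam (fscale c x) = c * lam x"
begin

definition coeff :: "'v + 'e \<Rightarrow> (nat \<times> ('v, 'e) path \<Rightarrow> 'k) \<Rightarrow> nat \<times> ('v, 'e) path \<Rightarrow> 'k" where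
  "coeff \<tau> s = fscale (if \<tau> = \<tau>0 then lam s else 0) (tag_elem \<tau>)"

text \<open>
  \<open>W\<close> is generated by the pairs \<open>(s, \<lambda>(s) g)\<close> for \<open>s\<close> in the complement \<open>T \<tau>0\<close>, with \<open>g\<close> the element of
  the tag \<open>\<tau>0\<close>, and \<open>(s, 0)\<close> for the other complements.  It turns out to be the graph of a function on \<open>M\<close>.
\<close>

inductive_set W where
  base: "\<tau> \<in> tags \<Longrightarrow> s \<in> T \<tau> \<Longrightarrow> (s, coeff \<tau> s) \<in> W"
| zero: "(0, 0) \<in> W"
| add: "(x, r) \<in> W \<Longrightarrow> (y, q) \<in> W \<Longrightarrow> (x + y, r + q) \<in> W"
| scale: "(x, r) \<in> W \<Longrightarrow> (fscale c x, fscale c r) \<in> W"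
| ev: "(x, r) \<in> W \<Longrightarrow> w \<in> verts Q \<Longrightarrow> (ev w x, ev w r) \<in> W"
| act: "(x, r) \<in> W \<Longrightarrow> a \<in> arcs Q \<Longrightarrow> (act a x, act a r) \<in> W"

lemma W_diff:
  assumes "(x, r) \<in> W" "(y, q) \<in> W" shows "(x - y, r - q) \<in> W"
proof -
  have "(x + fscale (-1) y, r + fscale (-1) q) \<in> W" by (intro W.add W.scale assms)
  moreover have "x + fscale (-1) y = x - y" "r + fscale (-1) q = r - q" by (auto simp: fun_eq_iff)
  ultimately show ?thesis by simp
qed

lemma coeff_linear:
  "coeff \<tau> 0 = 0" "coeff \<tau> (x + y) = coeff \<tau> x + coeff \<tau> y"
  "coeff \<tau> (fscale c x) = fscale c (coeff \<tau> x)"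
proof -
  have "lam 0 = 0" using lam(2)[of 0 0] by simp
  then show "coeff \<tau> 0 = 0" "coeff \<tau> (x + y) = coeff \<tau> x + coeff \<tau> y"
    "coeff \<tau> (fscale c x) = fscale c (coeff \<tau> x)"
    by (auto simp: coeff_def lam fs.scale_left_distrib)
qed

lemma coeff_ending: "coeff \<tau> s (i, p) \<noteq> 0 \<Longrightarrow> ending \<tau> p"
  using tag_elem_ending[of \<tau> i p] by (auto simp: coeff_def)

lemma supported_coeff: "\<tau> \<in> tags \<Longrightarrow> supported (coeff \<tau> s)"
  by (simp add: coeff_def supported_linear supported_tag_elem)

lemma T_0: "\<tau> \<in> tags \<Longrightarrow> 0 \<in> T \<tau>"
  using fs.subspace_0 T_props(1) by blast

lemma T_ending: "\<tau> \<in> tags \<Longrightarrow> s \<in> T \<tau> \<Longrightarrow> s \<in> M \<and> (\<forall>i p. s (i, p) \<noteq> 0 \<longrightarrow> ending \<tau> p)"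
  using T_props(2) by (fastforce simp: N_def)

lemma W_mem: "(x, r) \<in> W \<Longrightarrow> x \<in> M \<and> supported r"
proof (induction rule: W.induct)
  case (base \<tau> s)
  then show ?case using T_ending supported_coeff by blast
qed (blast intro: M_closed supported_linear supported_act)+

text \<open>Both components are expanded with the same \<open>s\<close> and \<sigma> and with pairs
  \<open>(x' a, r' a)\<close> that lie in \<open>W\<close> again. This coupling allows vanishing in
  the first component to be transferred to the second.\<close>

definition decomposition where
  "decomposition w x r s \<sigma> x' r' \<longleftrightarrow> s \<in> T (Inl w) \<and>
     (\<forall>a\<in>inn w. \<sigma> a \<in> T (Inr a) \<and> (x' a, r' a) \<in> W) \<and>
     ev w x = s + (\<Sum>a\<in>inn w. \<sigma> a + act a (x' a)) \<and>
     ev w r = coeff (Inl w) s + (\<Sum>a\<in>inn w. coeff (Inr a) (\<sigma> a) + act a (r' a))"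

definition decomposable where
  "decomposable w x r \<longleftrightarrow> (\<exists>s \<sigma> x' r'. decomposition w x r s \<sigma> x' r')"

lemma decomposable_zero: "w \<in> verts Q \<Longrightarrow> ev w x = 0 \<Longrightarrow> ev w r = 0 \<Longrightarrow> decomposable w x r"
  unfolding decomposable_def decomposition_def
  by (rule exI[of _ 0], rule exI[of _ "\<lambda>_. 0"], rule exI[of _ "\<lambda>_. 0"], rule exI[of _ "\<lambda>_. 0"])
    (auto simp: T_0 tags_def coeff_linear W.zero inn_def)

lemma decomposable_T:
  assumes "\<tau> \<in> tags" "s \<in> T \<tau>" "w \<in> verts Q"
  shows "decomposable w s (coeff \<tau> s)"
proof (cases \<tau>)
  case (Inl v)
  have e: "ev w s = (if v = w then s else 0)" "ev w (coeff \<tau> s) = (if v = w then coeff \<tau> s else 0)"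
    by (rule ev_ending_vertex; use T_ending[OF assms(1,2)] coeff_ending[of \<tau> s] Inl in blast)+
  show ?thesis
  proof (cases "v = w")
    case True
    show ?thesis unfolding decomposable_def decomposition_def
      by (rule exI[of _ s], rule exI[of _ "\<lambda>_. 0"], rule exI[of _ "\<lambda>_. 0"], rule exI[of _ "\<lambda>_. 0"])
        (use True Inl e assms in \<open>auto simp: T_0 tags_def coeff_linear W.zero inn_def\<close>)
  qed (use e assms decomposable_zero in auto)
next
  case (Inr a)
  have e: "ev w s = (if head Q a = w then s else 0)"
    "ev w (coeff \<tau> s) = (if head Q a = w then coeff \<tau> s else 0)"
    by (rule ev_ending_arrow; use T_ending[OF assms(1,2)] coeff_ending[of \<tau> s] Inr in blast)+
  show ?thesis
  proof (cases "head Q a = w")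
    case True
    then have a: "a \<in> inn w" using assms Inr by (auto simp: inn_def tags_def)
    let ?\<sigma> = "\<lambda>b. if b = a then s else 0"
    have "(\<Sum>b\<in>inn w. ?\<sigma> b + act b 0) = (\<Sum>b\<in>inn w. if b = a then s else 0)"
      by (intro sum.cong) auto
    moreover have "(\<Sum>b\<in>inn w. coeff (Inr b) (?\<sigma> b) + act b 0) =
        (\<Sum>b\<in>inn w. if b = a then coeff (Inr a) s else 0)"
      by (intro sum.cong) (auto simp: coeff_linear)
    ultimately have "ev w s = 0 + (\<Sum>b\<in>inn w. ?\<sigma> b + act b 0)"
      "ev w (coeff \<tau> s) = coeff (Inl w) 0 + (\<Sum>b\<in>inn w. coeff (Inr b) (?\<sigma> b) + act b 0)"
      using e True Inr a by (simp_all add: coeff_linear)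
    note e2 = this
    show ?thesis unfolding decomposable_def decomposition_def
      by (rule exI[of _ 0], rule exI[of _ ?\<sigma>], rule exI[of _ "\<lambda>_. 0"], rule exI[of _ "\<lambda>_. 0"],
          intro conjI ballI e2)
        (use assms Inr in \<open>auto simp: T_0 W.zero inn_def\<close>)
  qed (use e assms decomposable_zero in auto)
qed

lemma decomposable_add:
  assumes w: "w \<in> verts Q" and x: "decomposable w x r" and y: "decomposable w y q"
  shows "decomposable w (x + y) (r + q)"
proof -
  obtain s \<sigma> x' r' where 1: "decomposition w x r s \<sigma> x' r'" using x unfolding decomposable_def by blast
  obtain s2 \<sigma>2 x2 r2 where 2: "decomposition w y q s2 \<sigma>2 x2 r2" using y unfolding decomposable_def by blast
  note d = 1[unfolded decomposition_def] 2[unfolded decomposition_def]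
  have "decomposition w (x + y) (r + q) (s + s2) (\<lambda>a. \<sigma> a + \<sigma>2 a) (\<lambda>a. x' a + x2 a) (\<lambda>a. r' a + r2 a)"
    unfolding decomposition_def
  proof (intro conjI ballI)
    show "s + s2 \<in> T (Inl w)" using d w T_props(1) fs.subspace_add[of "T (Inl w)"] by auto
    fix a assume "a \<in> inn w"
    then show "\<sigma> a + \<sigma>2 a \<in> T (Inr a)" "(x' a + x2 a, r' a + r2 a) \<in> W"
      using d by (auto simp: inn_def intro!: W.add fs.subspace_add T_props(1))
  qed (use d in \<open>simp_all add: sum.distrib coeff_linear\<close>)
  then show ?thesis unfolding decomposable_def by blast
qed

lemma decomposable_scale:
  assumes w: "w \<in> verts Q" and x: "decomposable w x r"
  shows "decomposable w (fscale c x) (fscale c r)"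
proof -
  obtain s \<sigma> x' r' where 1: "decomposition w x r s \<sigma> x' r'" using x unfolding decomposable_def by blast
  note d = 1[unfolded decomposition_def]
  have "decomposition w (fscale c x) (fscale c r) (fscale c s) (\<lambda>a. fscale c (\<sigma> a))
      (\<lambda>a. fscale c (x' a)) (\<lambda>a. fscale c (r' a))"
    unfolding decomposition_def
  proof (intro conjI ballI)
    show "fscale c s \<in> T (Inl w)" using d w T_props(1) fs.subspace_scale[of "T (Inl w)"] by auto
    fix a assume "a \<in> inn w"
    then show "fscale c (\<sigma> a) \<in> T (Inr a)" "(fscale c (x' a), fscale c (r' a)) \<in> W"
      using d by (auto simp: inn_def intro!: W.scale fs.subspace_scale T_props(1))
  qed (use d in \<open>simp_all add: fs.scale_right_distrib fs.scale_sum_right coeff_linear\<close>)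
  then show ?thesis unfolding decomposable_def by blast
qed

lemma decomposable_act:
  assumes "w \<in> verts Q" "(x, r) \<in> W" "a \<in> arcs Q"
  shows "decomposable w (act a x) (act a r)"
proof (cases "head Q a = w")
  case True
  then have a: "a \<in> inn w" using assms by (auto simp: inn_def)
  let ?x = "\<lambda>b. if b = a then x else 0" and ?r = "\<lambda>b. if b = a then r else 0"
  have "(\<Sum>b\<in>inn w. 0 + act b (?x b)) = (\<Sum>b\<in>inn w. if b = a then act a x else 0)"
    by (intro sum.cong) auto
  moreover have "(\<Sum>b\<in>inn w. coeff (Inr b) 0 + act b (?r b)) =
      (\<Sum>b\<in>inn w. if b = a then act a r else 0)"
    by (intro sum.cong) (auto simp: coeff_linear)
  ultimately have "ev w (act a x) = 0 + (\<Sum>b\<in>inn w. 0 + act b (?x b))"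
      "ev w (act a r) = coeff (Inl w) 0 + (\<Sum>b\<in>inn w. coeff (Inr b) 0 + act b (?r b))"
    using True a by (simp_all add: coeff_linear ev_act)
  note e2 = this
  show ?thesis unfolding decomposable_def decomposition_def
    by (rule exI[of _ 0], rule exI[of _ "\<lambda>_. 0"], rule exI[of _ ?x], rule exI[of _ ?r], intro conjI ballI e2)
      (use assms in \<open>auto simp: T_0 W.zero inn_def\<close>)
qed (use assms decomposable_zero ev_act in auto)

text \<open>The existence of coupled expansions is stable under all rules that generate
  \<open>W\<close>; under the idempotent rule only the expansion at the same vertex
  survives.\<close>

lemma W_decomposable: "(x, r) \<in> W \<Longrightarrow> w \<in> verts Q \<Longrightarrow> decomposable w x r"
proof (induction rule: W.induct)
  case (base \<tau> s)
  then show ?case using decomposable_T by blast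
next
  case (ev x r v)
  show ?case
  proof (cases "v = w")
    case True
    then show ?thesis using ev by (simp add: decomposable_def decomposition_def ev_ev)
  qed (use ev in \<open>auto intro!: decomposable_zero simp: ev_ev\<close>)
next
  case (act x r a)
  then show ?case by (intro decomposable_act)
qed (auto intro: decomposable_zero decomposable_add decomposable_scale)

text \<open>The first components form a stable subspace containing every complement, so Nakayama's
  lemma gives all of \<open>M\<close>.\<close>

lemma W_total: "x \<in> M \<Longrightarrow> \<exists>r. (x, r) \<in> W"
proof -
  have "rep_closed (fst ` W)"
    unfolding rep_closed_def
  proof (intro conjI ballI fs.subspaceI)
    show "0 \<in> fst ` W" using W.zero by force
    fix x assume "x \<in> fst ` W"
    then obtain r where r: "(x, r) \<in> W" by auto
    then show "fscale c x \<in> fst ` W" for c using W.scale by force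
    show "ev w x \<in> fst ` W" if "w \<in> verts Q" for w using r that using W.ev by force
    show "act a x \<in> fst ` W" if "a \<in> arcs Q" for a using r that using W.act by force
    fix y assume "y \<in> fst ` W"
    then obtain q where "(y, q) \<in> W" by auto
    then show "x + y \<in> fst ` W" using r using W.add by force
  qed
  moreover have "T \<tau> \<subseteq> fst ` W" if "\<tau> \<in> tags" for \<tau>
    using that using W.base by force
  ultimately show "x \<in> M \<Longrightarrow> \<exists>r. (x, r) \<in> W" using rep_closed_nakayama by fastforce
qed

text \<open>
  If \<open>x a = 0\<close>, then \<open>x e\<close> lies in \<open>N (Inr b)\<close> for the \<open>b\<close> with \<open>ba \<in> I\<close>, hence in
  \<open>T (Inr b) + M b\<close>; subtracting an element of \<open>W\<close> over it does not affect the product with \<open>a\<close>.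
\<close>

lemma W_kernel_act:
  assumes "(x, r) \<in> W" "a \<in> arcs Q" "act a x = 0"
  shows "\<exists>u. (0, u) \<in> W \<and> act a u = act a r"
proof -
  define y q where "y = ev (tail Q a) x" and "q = ev (tail Q a) r"
  have yq: "(y, q) \<in> W" using assms by (auto simp: y_def q_def intro: W.intros)
  have y: "y \<in> M" "supported y" "ev (tail Q a) y = y" "act a y = 0" "act a q = act a r"
    using W_mem[OF yq] supp assms by (auto simp: y_def q_def ev_ev act_ev_tail)
  consider "y = 0" | b where "rel b a" "\<forall>i p. y (i, p) \<noteq> 0 \<longrightarrow> ending (Inr b) p"
    using act_kernel[OF y(2,3) assms(2) y(4)] by blast
  then show ?thesis
  proof cases
    case 1
    then show ?thesis using yq y by blast
  next
    case 2
    have b: "Inr b \<in> tags" "b \<in> arcs Q" using rel_in_arcs[OF 2(1)] by (auto simp: tags_def)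
    have "y \<in> N (Inr b)" using y 2 by (auto simp: N_def)
    then obtain s d where "s \<in> T (Inr b)" "d \<in> D (Inr b)" "y = s + d" using T_props(4)[OF b(1)] by blast
    then obtain m where m: "s \<in> T (Inr b)" "m \<in> M" "y = s + act b m" by (auto simp: D_def)
    obtain \<rho> where \<rho>: "(m, \<rho>) \<in> W" using W_total m by blast
    have "(s, coeff (Inr b) s) \<in> W" using m b by (intro W.base)
    moreover have "(act b m, act b \<rho>) \<in> W" using \<rho> b by (intro W.act)
    ultimately have "(y - s - act b m, q - coeff (Inr b) s - act b \<rho>) \<in> W"
      using yq by (intro W_diff)
    moreover have "y - s - act b m = 0" using m by simp
    \<comment> \<open>Both subtracted values end in \<open>b\<close>, and \<open>b\<close> followed
      by \<open>a\<close> is a relation.\<close>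
    moreover have "act a (q - coeff (Inr b) s - act b \<rho>) = act a r"
      using act_of_ending[OF 2(1), of "coeff (Inr b) s"] act_of_ending[OF 2(1), of "act b \<rho>"]
        coeff_ending act_ending y(5) by auto
    ultimately show ?thesis by auto
  qed
qed

text \<open>A path has only one last arrow, so the supports of the summands are disjoint and nothing
  can cancel.\<close>

lemma arrow_sum_eq_0:
  assumes "\<And>a i p. a \<in> X \<Longrightarrow> n a (i::nat, p) \<noteq> (0::'k) \<Longrightarrow> ending (Inr a) p" "finite X"
    "(\<Sum>a\<in>X. n a) = 0" "a \<in> X"
  shows "n a = 0"
proof
  fix j :: "nat \<times> ('v, 'e) path"
  obtain i p where j: "j = (i, p)" by (cases j)
  show "n a j = 0 j"
  proof (rule ccontr)
    assume "n a j \<noteq> 0 j"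
    then have "last (snd p) = a" using assms(1,4) j by (fastforce simp: ending_def)
    then have "n b j = 0" if "b \<in> X - {a}" for b
      using that assms(1)[of b i p] j by (auto simp: ending_def)
    then have "(\<Sum>b\<in>X. n b j) = n a j" using assms(2,4) by (subst sum.remove[of _ a]) auto
    then show False using assms(3) \<open>n a j \<noteq> 0 j\<close> by (metis sum_fun_apply)
  qed
qed

text \<open>The expansion of the zero vector has only zero terms: \<open>T\<close> meets
  \<open>D\<close> trivially at the vertex, the arrow components are independent, and
  \<open>T\<close> meets \<open>D\<close> trivially at each arrow. What remains is
  \<open>act a (x' a) = 0\<close>, and \<open>W_kernel_act\<close> replaces \<open>x' a\<close> by
  \<open>0\<close> without changing the value.\<close>

lemma W_kernel_step:
  assumes "(0, r) \<in> W" "w \<in> verts Q"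
  shows "\<exists>u. (\<forall>a\<in>inn w. (0, u a) \<in> W) \<and> ev w r = (\<Sum>a\<in>inn w. act a (u a))"
proof -
  obtain s \<sigma> x' r' where 1: "s \<in> T (Inl w)" "\<forall>a\<in>inn w. \<sigma> a \<in> T (Inr a) \<and> (x' a, r' a) \<in> W"
     "ev w 0 = s + (\<Sum>a\<in>inn w. \<sigma> a + act a (x' a))"
     "ev w r = coeff (Inl w) s + (\<Sum>a\<in>inn w. coeff (Inr a) (\<sigma> a) + act a (r' a))"
    using W_decomposable[OF assms] unfolding decomposable_def decomposition_def by blast
  have w: "Inl w \<in> tags" and in_tags: "Inr a \<in> tags" "a \<in> arcs Q" if "a \<in> inn w" for a
    using assms that by (auto simp: tags_def inn_def)
  have w: "Inl w \<in> tags" using assms by (auto simp: tags_def)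
  let ?n = "\<lambda>a. \<sigma> a + act a (x' a)"
  have d: "act a (x' a) \<in> D (Inr a)" if "a \<in> inn w" for a
    using 1 that W_mem by (auto simp: D_def)
  have n: "?n a \<in> N (Inr a)" if "a \<in> inn w" for a
    using d[OF that] 1 T_props(2)[OF in_tags(1)[OF that]] D_subset_N[OF in_tags(1)[OF that]] that
    by (intro fs.subspace_add[OF subspace_N]) auto
  then have "(\<Sum>a\<in>inn w. ?n a) \<in> D (Inl w)" by (auto simp: D_def)
  then have "0 - (\<Sum>a\<in>inn w. ?n a) \<in> D (Inl w)"
    using fs.subspace_diff[OF subspace_D[OF w]] fs.subspace_0[OF subspace_D[OF w]] by blast
  moreover have "s = 0 - (\<Sum>a\<in>inn w. ?n a)" using 1(3) by (simp add: eq_neg_iff_add_eq_0)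
  ultimately have s: "s = 0" using T_props(3)[OF w] 1(1) by auto
  then have "(\<Sum>a\<in>inn w. ?n a) = 0" using 1(3) by simp
  then have n0: "?n a = 0" if "a \<in> inn w" for a
    using arrow_sum_eq_0[of "inn w" ?n a] n that by (auto simp: N_def)
  have \<sigma>: "\<sigma> a = 0" if a: "a \<in> inn w" for a
  proof -
    have "0 - act a (x' a) \<in> D (Inr a)"
      using fs.subspace_diff[OF subspace_D[OF in_tags(1)[OF a]]]
        fs.subspace_0[OF subspace_D[OF in_tags(1)[OF a]]] d[OF a] by blast
    moreover have "\<sigma> a = 0 - act a (x' a)" using n0[OF a] by (simp add: eq_neg_iff_add_eq_0)
    ultimately show ?thesis using T_props(3)[OF in_tags(1)[OF a]] 1(2) a by auto
  qed
  have "\<exists>u. (0, u) \<in> W \<and> act a u = act a (r' a)" if a: "a \<in> inn w" for a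
    using W_kernel_act[of "x' a" "r' a" a] 1(2) a n0[OF a] \<sigma>[OF a] in_tags(2)[OF a] by auto
  then obtain u where u: "\<And>a. a \<in> inn w \<Longrightarrow> (0, u a) \<in> W \<and> act a (u a) = act a (r' a)" by metis
  have "ev w r = (\<Sum>a\<in>inn w. coeff (Inr a) (\<sigma> a) + act a (r' a))"
    using 1(4) by (simp add: s coeff_linear)
  also have "\<dots> = (\<Sum>a\<in>inn w. act a (u a))"
    using u \<sigma> by (intro sum.cong) (auto simp: coeff_linear)
  finally show ?thesis using u by blast
qed

text \<open>By \<open>W_kernel_step\<close>, a path in the support of \<open>r\<close> loses its
  last arrow and the shorter path is in the support of another value over \<open>0\<close>.
  Repeating this, the length of the path would exceed every bound.\<close>

lemma W_kernel: "(0, r) \<in> W \<Longrightarrow> r = 0"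
proof -
  obtain n where n: "\<forall>p\<in>gp. plength p < n" using good_path_bound by blast
  have *: "k \<le> plength p" if "(0, r) \<in> W" "r (i, p) \<noteq> 0" for r i p k
    using that
  proof (induction k arbitrary: r p)
    case (Suc k)
    have p: "p \<in> gp" using W_mem[OF Suc.prems(1)] supportedD Suc.prems(2) by blast
    then have "ptarget Q p \<in> verts Q"
      using path_ends_in_verts[OF fin_digraph_axioms] by (auto simp: good_paths_def)
    then obtain u where u: "\<forall>a\<in>inn (ptarget Q p). (0, u a) \<in> W"
        "ev (ptarget Q p) r = (\<Sum>a\<in>inn (ptarget Q p). act a (u a))"
      using W_kernel_step Suc.prems by blast
    have "ev (ptarget Q p) r (i, p) \<noteq> 0" using Suc.prems by (simp add: ev_def)
    then obtain a where a: "a \<in> inn (ptarget Q p)" "act a (u a) (i, p) \<noteq> 0"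
      unfolding u(2) sum_fun_apply by (meson sum.not_neutral_contains_not_neutral)
    then have "snd p \<noteq> []" "u a (i, (fst p, butlast (snd p))) \<noteq> 0"
      by (auto simp: act_def split: if_splits)
    moreover from this have "k \<le> plength (fst p, butlast (snd p))"
      by (intro Suc.IH[OF bspec[OF u(1) a(1)]])
    ultimately show ?case by (cases "snd p" rule: rev_cases) (auto simp: plength_def)
  qed simp
  assume r: "(0, r) \<in> W"
  show "r = 0"
  proof
    fix j :: "nat \<times> ('v, 'e) path"
    obtain i p where j: "j = (i, p)" by (cases j)
    have "r (i, p) = 0"
    proof (rule ccontr)
      assume 0: "r (i, p) \<noteq> 0"
      then have "p \<in> gp" using W_mem[OF r] supportedD by blast
      then show False using n *[OF r 0, of n] by auto
    qed
    then show "r j = 0 j" by (simp add: j)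
  qed
qed

lemma W_unique: "(x, r) \<in> W \<Longrightarrow> (x, r') \<in> W \<Longrightarrow> r = r'"
  using W_kernel[of "r - r'"] W_diff[of x r x r'] by auto

end

context rep_submodule
begin

text \<open>Nakayama's lemma for the zero subspace shows that some complement is nonzero, and a
  nonzero \<open>t\<close> in it will generate a summand. The last clause confines the values of
  \<rho> to the right ideal generated by \<open>tag_elem \<tau>\<close>, phrased through all stable
  sets \<open>Z\<close> that contain this element.\<close>

theorem retraction:
  assumes "M \<noteq> {0}"
  obtains \<tau> t \<rho> where "\<tau> \<in> tags" "t \<in> M" "t \<noteq> 0" "\<And>i p. t (i, p) \<noteq> 0 \<Longrightarrow> ending \<tau> p"
    "\<And>a. \<tau> = Inr a \<Longrightarrow> t \<notin> act a ` M" "\<rho> t = tag_elem \<tau>"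
    "\<And>x y. x \<in> M \<Longrightarrow> y \<in> M \<Longrightarrow> \<rho> (x + y) = \<rho> x + \<rho> y"
    "\<And>c x. x \<in> M \<Longrightarrow> \<rho> (fscale c x) = fscale c (\<rho> x)"
    "\<And>w x. w \<in> verts Q \<Longrightarrow> x \<in> M \<Longrightarrow> \<rho> (ev w x) = ev w (\<rho> x)"
    "\<And>a x. a \<in> arcs Q \<Longrightarrow> x \<in> M \<Longrightarrow> \<rho> (act a x) = act a (\<rho> x)"
    "\<And>Z x. rep_closed Z \<Longrightarrow> tag_elem \<tau> \<in> Z \<Longrightarrow> x \<in> M \<Longrightarrow> \<rho> x \<in> Z"
proof -
  have "rep_closed {0}" by (auto simp: rep_closed_def)
  then obtain \<tau> where \<tau>: "\<tau> \<in> tags" "\<not> T \<tau> \<subseteq> {0}"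
    using rep_closed_nakayama[of "{0}"] assms M_closed(1) by blast
  then obtain t where t: "t \<in> T \<tau>" "t \<noteq> 0" by blast
  then obtain j where j: "t j \<noteq> 0" by (metis ext zero_fun_apply)
  \<comment> \<open>Evaluation at a coordinate where \<open>t\<close> does not vanish, normalised so
    that \<open>t\<close> is sent to \<open>1\<close>.\<close>
  interpret rep_retraction Q I M \<tau> "\<lambda>x. x j / t j"
    by unfold_locales (auto simp: \<tau> add_divide_distrib)
  define \<rho> where "\<rho> x = (THE r. (x, r) \<in> W)" for x
  have \<rho>: "\<rho> x = r" if "(x, r) \<in> W" for x r
    unfolding \<rho>_def using that W_unique by blast
  have \<rho>W: "(x, \<rho> x) \<in> W" if "x \<in> M" for x using W_total[OF that] \<rho> by blast
  have tM: "t \<in> M" "\<And>i p. t (i, p) \<noteq> 0 \<Longrightarrow> ending \<tau> p"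
    using T_ending \<tau> t by blast+
  have Z: "r \<in> Z" if "(x, r) \<in> W" "rep_closed Z" "tag_elem \<tau> \<in> Z" for x r Z
    using that
  proof (induction rule: W.induct)
    case (base \<tau>' s)
    have "tag_elem \<tau>' \<in> Z \<or> coeff \<tau>' s = 0" using base by (auto simp: coeff_def fun_eq_iff)
    then show ?case using base fs.subspace_scale[of Z] fs.subspace_0[of Z]
      unfolding coeff_def rep_closed_def by metis
  qed (auto simp: rep_closed_def fs.subspace_def)
  show ?thesis
  proof (rule that[of \<tau> t \<rho>])
    show "t \<notin> act a ` M" if "\<tau> = Inr a" for a
      using T_props(3)[OF \<tau>(1)] t that by (auto simp: D_def)
    have "(t, coeff \<tau> t) \<in> W" using \<tau> t by (intro W.base)
    moreover have "coeff \<tau> t = tag_elem \<tau>" using j by (auto simp: coeff_def)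
    ultimately show "\<rho> t = tag_elem \<tau>" using \<rho> by simp
    show "\<rho> x \<in> Z" if "rep_closed Z" "tag_elem \<tau> \<in> Z" "x \<in> M" for Z x
      using Z[OF \<rho>W] that by blast
    show "\<rho> (x + y) = \<rho> x + \<rho> y" if "x \<in> M" "y \<in> M" for x y
      by (intro \<rho> W.intros \<rho>W that)
    show "\<rho> (fscale c x) = fscale c (\<rho> x)" if "x \<in> M" for c x
      by (intro \<rho> W.intros \<rho>W that)
    show "\<rho> (ev w x) = ev w (\<rho> x)" if "w \<in> verts Q" "x \<in> M" for w x
      by (intro \<rho> W.intros \<rho>W that)
    show "\<rho> (act a x) = act a (\<rho> x)" if "a \<in> arcs Q" "x \<in> M" for a x
      by (intro \<rho> W.intros \<rho>W that)
  qed (use \<tau> t tM in blast)+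
qed

end


section \<open>Generalities on right modules\<close>

context right_module
begin

lemma smult_zero_right [simp]: "r \<in> carrier R \<Longrightarrow> r \<odot>\<^bsub>M\<^esub> \<zero>\<^bsub>M\<^esub> = \<zero>\<^bsub>M\<^esub>"
  using rsmult_add_module[of r "\<zero>\<^bsub>M\<^esub>" "\<zero>\<^bsub>M\<^esub>"] M.add.l_cancel_one' by fastforce

lemma smult_zero_left [simp]: "x \<in> carrier M \<Longrightarrow> \<zero>\<^bsub>R\<^esub> \<odot>\<^bsub>M\<^esub> x = \<zero>\<^bsub>M\<^esub>"
  using rsmult_add_ring[of "\<zero>\<^bsub>R\<^esub>" "\<zero>\<^bsub>R\<^esub>" x] M.add.l_cancel_one' by fastforce

lemma minus_eq_zeroD:
  assumes "x \<in> carrier M" "y \<in> carrier M" "x \<ominus>\<^bsub>M\<^esub> y = \<zero>\<^bsub>M\<^esub>"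
  shows "x = y"
proof -
  have "x = (x \<ominus>\<^bsub>M\<^esub> y) \<oplus>\<^bsub>M\<^esub> y" using assms(1,2) by (simp add: a_minus_def M.a_assoc M.l_neg)
  then show ?thesis using assms by simp
qed

lemma smult_minus_right:
  "r \<in> carrier R \<Longrightarrow> x \<in> carrier M \<Longrightarrow> r \<odot>\<^bsub>M\<^esub> (\<ominus>\<^bsub>M\<^esub> x) = \<ominus>\<^bsub>M\<^esub> (r \<odot>\<^bsub>M\<^esub> x)"
  using rsmult_add_module[of r "\<ominus>\<^bsub>M\<^esub> x" x] by (intro M.minus_equality[symmetric]) (auto simp: M.l_neg)

lemma smult_minus:
  "r \<in> carrier R \<Longrightarrow> x \<in> carrier M \<Longrightarrow> y \<in> carrier M \<Longrightarrow>
    r \<odot>\<^bsub>M\<^esub> (x \<ominus>\<^bsub>M\<^esub> y) = r \<odot>\<^bsub>M\<^esub> x \<ominus>\<^bsub>M\<^esub> r \<odot>\<^bsub>M\<^esub> y"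
  by (simp add: a_minus_def rsmult_add_module smult_minus_right)

lemma smult_finsum_right:
  "finite X \<Longrightarrow> r \<in> carrier R \<Longrightarrow> f \<in> X \<rightarrow> carrier M \<Longrightarrow>
    r \<odot>\<^bsub>M\<^esub> finsum M f X = finsum M (\<lambda>i. r \<odot>\<^bsub>M\<^esub> f i) X"
  by (induction X rule: finite_induct) (auto simp: rsmult_add_module Pi_iff)

lemma submoduleI:
  assumes "H \<subseteq> carrier M" "\<zero>\<^bsub>M\<^esub> \<in> H"
    "\<And>x y. x \<in> H \<Longrightarrow> y \<in> H \<Longrightarrow> x \<oplus>\<^bsub>M\<^esub> y \<in> H"
    "\<And>r x. r \<in> carrier R \<Longrightarrow> x \<in> H \<Longrightarrow> r \<odot>\<^bsub>M\<^esub> x \<in> H"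
  shows "submodule H R M"
proof -
  have "\<ominus>\<^bsub>M\<^esub> x \<in> H" if "x \<in> H" for x
  proof -
    have x: "x \<in> carrier M" using that assms(1) by auto
    have "(\<ominus>\<^bsub>R\<^esub> \<one>\<^bsub>R\<^esub>) \<odot>\<^bsub>M\<^esub> x \<oplus>\<^bsub>M\<^esub> x = \<zero>\<^bsub>M\<^esub>"
      using rsmult_add_ring[of "\<ominus>\<^bsub>R\<^esub> \<one>\<^bsub>R\<^esub>" "\<one>\<^bsub>R\<^esub>" x] x by (simp add: R.l_neg)
    then have "\<ominus>\<^bsub>M\<^esub> x = (\<ominus>\<^bsub>R\<^esub> \<one>\<^bsub>R\<^esub>) \<odot>\<^bsub>M\<^esub> x" using x by (intro M.minus_equality) auto
    then show ?thesis using that by (simp add: assms(4))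
  qed
  then have "subgroup H (add_monoid M)"
    using assms by (intro M.add.subgroupI) auto
  then show ?thesis by (intro submodule.intro submodule_axioms.intro assms(4))
qed

end

lemma submoduleD:
  assumes "submodule H R M"
  shows "H \<subseteq> carrier M" "\<zero>\<^bsub>M\<^esub> \<in> H" "x \<in> H \<Longrightarrow> y \<in> H \<Longrightarrow> x \<oplus>\<^bsub>M\<^esub> y \<in> H"
    "r \<in> carrier R \<Longrightarrow> x \<in> H \<Longrightarrow> r \<odot>\<^bsub>M\<^esub> x \<in> H"
proof -
  interpret submodule H R M by fact
  show "H \<subseteq> carrier M" "\<zero>\<^bsub>M\<^esub> \<in> H" "x \<in> H \<Longrightarrow> y \<in> H \<Longrightarrow> x \<oplus>\<^bsub>M\<^esub> y \<in> H"
    "r \<in> carrier R \<Longrightarrow> x \<in> H \<Longrightarrow> r \<odot>\<^bsub>M\<^esub> x \<in> H"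
    using subset one_closed m_closed smult_closed by auto
qed

lemma mod_homI:
  assumes "\<And>x. x \<in> carrier M \<Longrightarrow> f x \<in> carrier N"
    "\<And>x y. x \<in> carrier M \<Longrightarrow> y \<in> carrier M \<Longrightarrow> f (x \<oplus>\<^bsub>M\<^esub> y) = f x \<oplus>\<^bsub>N\<^esub> f y"
    "\<And>r x. r \<in> carrier R \<Longrightarrow> x \<in> carrier M \<Longrightarrow> f (r \<odot>\<^bsub>M\<^esub> x) = r \<odot>\<^bsub>N\<^esub> f x"
  shows "f \<in> mod_hom R M N"
  using assms by (auto simp: mod_hom_def hom_def)

lemma mod_homD:
  assumes "f \<in> mod_hom R M N"
  shows "x \<in> carrier M \<Longrightarrow> f x \<in> carrier N"
    "x \<in> carrier M \<Longrightarrow> y \<in> carrier M \<Longrightarrow> f (x \<oplus>\<^bsub>M\<^esub> y) = f x \<oplus>\<^bsub>N\<^esub> f y"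
    "r \<in> carrier R \<Longrightarrow> x \<in> carrier M \<Longrightarrow> f (r \<odot>\<^bsub>M\<^esub> x) = r \<odot>\<^bsub>N\<^esub> f x"
  using assms by (auto simp: mod_hom_def hom_def)

lemma mod_hom_zero:
  assumes "f \<in> mod_hom R M N" "right_module R M" "right_module R N"
  shows "f \<zero>\<^bsub>M\<^esub> = \<zero>\<^bsub>N\<^esub>"
proof -
  interpret M: right_module R M by fact
  interpret N: right_module R N by fact
  have "f (\<zero>\<^bsub>R\<^esub> \<odot>\<^bsub>M\<^esub> \<zero>\<^bsub>M\<^esub>) = \<zero>\<^bsub>R\<^esub> \<odot>\<^bsub>N\<^esub> f \<zero>\<^bsub>M\<^esub>"
    using mod_homD[OF assms(1)] by (intro mod_homD(3)[OF assms(1)]) auto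
  then show ?thesis using mod_homD(1)[OF assms(1)] by simp
qed

lemma mod_hom_minus:
  assumes "f \<in> mod_hom R M N" "right_module R M" "right_module R N" "x \<in> carrier M" "y \<in> carrier M"
  shows "f (x \<ominus>\<^bsub>M\<^esub> y) = f x \<ominus>\<^bsub>N\<^esub> f y"
proof -
  interpret M: right_module R M by fact
  interpret N: right_module R N by fact
  have "f (\<ominus>\<^bsub>M\<^esub> y) \<oplus>\<^bsub>N\<^esub> f y = \<zero>\<^bsub>N\<^esub>"
    using assms mod_hom_zero[OF assms(1-3)] by (simp flip: mod_homD(2)[OF assms(1)] add: M.M.l_neg)
  then have "\<ominus>\<^bsub>N\<^esub> f y = f (\<ominus>\<^bsub>M\<^esub> y)"
    using assms mod_homD(1)[OF assms(1)] by (intro N.M.minus_equality) auto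
  then show ?thesis using assms by (simp add: a_minus_def mod_homD(2)[OF assms(1)])
qed

lemma mod_hom_comp:
  "f \<in> mod_hom R M N \<Longrightarrow> g \<in> mod_hom R N K \<Longrightarrow> (\<lambda>x. g (f x)) \<in> mod_hom R M K"
  by (rule mod_homI) (simp_all add: mod_homD)

lemma mod_hom_inj:
  assumes "f \<in> mod_hom R M N" "right_module R M" "right_module R N"
    "\<And>x. x \<in> carrier M \<Longrightarrow> f x = \<zero>\<^bsub>N\<^esub> \<Longrightarrow> x = \<zero>\<^bsub>M\<^esub>"
  shows "inj_on f (carrier M)"
proof (rule inj_onI)
  interpret M: right_module R M by fact
  interpret N: right_module R N by fact
  fix x y assume xy: "x \<in> carrier M" "y \<in> carrier M" "f x = f y"
  then have "f (x \<ominus>\<^bsub>M\<^esub> y) = \<zero>\<^bsub>N\<^esub>"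
    using mod_homD(1)[OF assms(1)] by (simp add: mod_hom_minus[OF assms(1-3)] N.M.minus_eq N.M.r_neg)
  then have "x \<ominus>\<^bsub>M\<^esub> y = \<zero>\<^bsub>M\<^esub>" using xy assms(4) by simp
  then show "x = y" using xy M.minus_eq_zeroD by blast
qed

lemma mod_hom_id: "right_module R M \<Longrightarrow> (\<lambda>x. x) \<in> mod_hom R M M"
  by (rule mod_homI) auto

lemma mod_iso_refl: "mod_iso R M M"
  unfolding mod_iso_def by (rule bexI[of _ "\<lambda>x. x"]) (auto intro: mod_homI bij_betwI')

lemma mod_iso_trans: "mod_iso R M N \<Longrightarrow> mod_iso R N K \<Longrightarrow> mod_iso R M K"
  unfolding mod_iso_def using mod_hom_comp bij_betw_trans unfolding comp_def by blast

lemma mod_iso_inverse: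
  assumes "f \<in> mod_hom R M N" "bij_betw f (carrier M) (carrier N)" "right_module R M"
  shows "the_inv_into (carrier M) f \<in> mod_hom R N M"
proof (rule mod_homI)
  interpret M: right_module R M by fact
  let ?g = "the_inv_into (carrier M) f"
  have g: "?g y \<in> carrier M" "f (?g y) = y" if "y \<in> carrier N" for y
    using assms(2) that the_inv_into_into[of f "carrier M" y "carrier M"] f_the_inv_into_f[of f "carrier M" y]
    by (auto simp: bij_betw_def)
  have gI: "?g y = x" if "x \<in> carrier M" "f x = y" for x y
    using assms(2) that by (auto simp: bij_betw_def the_inv_into_f_f)
  fix x assume x: "x \<in> carrier N"
  then show "?g x \<in> carrier M" by (rule g)
  show "?g (r \<odot>\<^bsub>N\<^esub> x) = r \<odot>\<^bsub>M\<^esub> ?g x" if "r \<in> carrier R" for r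
    using that g[OF x] by (intro gI) (auto simp: mod_homD(3)[OF assms(1)])
  show "?g (x \<oplus>\<^bsub>N\<^esub> y) = ?g x \<oplus>\<^bsub>M\<^esub> ?g y" if "y \<in> carrier N" for y
    using g[OF that] g[OF x] by (intro gI) (auto simp: mod_homD(2)[OF assms(1)])
qed

lemma mod_iso_sym:
  assumes "mod_iso R M N" "right_module R M" shows "mod_iso R N M"
  using assms mod_iso_inverse[of _ R M N] bij_betw_the_inv_into[of _ "carrier M" "carrier N"]
  unfolding mod_iso_def by blast

lemma projective_iso:
  assumes "projective R P" "mod_iso R P P'" "P' \<in> fg_modules R"
  shows "projective R P'"
proof -
  have P: "right_module R P" using assms(1) by (auto simp: projective_def fg_modules_def)
  obtain u where u: "u \<in> mod_hom R P P'" "bij_betw u (carrier P) (carrier P')"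
    using assms(2) by (auto simp: mod_iso_def)
  let ?w = "the_inv_into (carrier P) u"
  have w: "?w \<in> mod_hom R P' P" "\<And>y. y \<in> carrier P' \<Longrightarrow> u (?w y) = y"
    using mod_iso_inverse[OF u P] u(2) by (auto simp: bij_betw_def f_the_inv_into_f)
  show ?thesis unfolding projective_def
  proof (intro conjI ballI impI)
    fix M N g f
    assume *: "M \<in> fg_modules R" "N \<in> fg_modules R" "g \<in> mod_hom R M N" "f \<in> mod_hom R P' N"
      "g ` carrier M = carrier N"
    obtain h where h: "h \<in> mod_hom R P M" "\<forall>x\<in>carrier P. g (h x) = f (u x)"
      using assms(1)[unfolded projective_def, THEN conjunct2, rule_format, OF *(1,2,3) mod_hom_comp[OF u(1) *(4)] *(5)]
      by blast
    show "\<exists>h\<in>mod_hom R P' M. \<forall>x\<in>carrier P'. g (h x) = f x"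
    proof (intro bexI[of _ "\<lambda>x. h (?w x)"] ballI)
      show "g (h (?w x)) = f x" if "x \<in> carrier P'" for x
        using h(2) mod_homD(1)[OF w(1) that] w(2)[OF that] by simp
    qed (rule mod_hom_comp[OF w(1) h(1)])
  qed fact
qed

subsection \<open>Free modules of finite rank\<close>

text \<open>Elements are coefficient lists, which have the carrier type required by
  \<open>fg_modules\<close>.\<close>

definition free_module :: "('a, 'b) ring_scheme \<Rightarrow> nat \<Rightarrow> ('a, 'a list) module" where
  "free_module R n =
     \<lparr>carrier = {xs. length xs = n \<and> set xs \<subseteq> carrier R}, mult = undefined, one = undefined,
      zero = replicate n \<zero>\<^bsub>R\<^esub>, add = map2 (add R), smult = (\<lambda>r. map (\<lambda>x. x \<otimes>\<^bsub>R\<^esub> r))\<rparr>"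

lemma free_module_simps [simp]:
  "xs \<in> carrier (free_module R n) \<longleftrightarrow> length xs = n \<and> set xs \<subseteq> carrier R"
  "\<zero>\<^bsub>free_module R n\<^esub> = replicate n \<zero>\<^bsub>R\<^esub>"
  "xs \<oplus>\<^bsub>free_module R n\<^esub> ys = map2 (add R) xs ys"
  "r \<odot>\<^bsub>free_module R n\<^esub> xs = map (\<lambda>x. x \<otimes>\<^bsub>R\<^esub> r) xs"
  by (simp_all add: free_module_def)

context ring
begin

lemma right_module_free: "right_module R (free_module R n)"
proof (intro right_module.intro right_module_axioms.intro abelian_groupI)
  let ?F = "free_module R n"
  have nth: "xs ! i \<in> carrier R" if "xs \<in> carrier ?F" "i < n" for xs i
    using that nth_mem by fastforce
  show "ring R" by (rule ring_axioms)
  fix xs assume xs: "xs \<in> carrier ?F"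
  show "\<exists>ys\<in>carrier ?F. ys \<oplus>\<^bsub>?F\<^esub> xs = \<zero>\<^bsub>?F\<^esub>"
    using xs nth[OF xs]
    by (intro bexI[of _ "map (a_inv R) xs"]) (auto simp: l_neg intro!: nth_equalityI)
  show "\<zero>\<^bsub>?F\<^esub> \<oplus>\<^bsub>?F\<^esub> xs = xs" "\<one> \<odot>\<^bsub>?F\<^esub> xs = xs" using xs nth[OF xs] by (auto intro!: nth_equalityI)
  show "r \<odot>\<^bsub>?F\<^esub> xs \<in> carrier ?F" if "r \<in> carrier R" for r using xs that by auto
  show "(r \<oplus> s) \<odot>\<^bsub>?F\<^esub> xs = r \<odot>\<^bsub>?F\<^esub> xs \<oplus>\<^bsub>?F\<^esub> s \<odot>\<^bsub>?F\<^esub> xs"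
    "(r \<otimes> s) \<odot>\<^bsub>?F\<^esub> xs = s \<odot>\<^bsub>?F\<^esub> (r \<odot>\<^bsub>?F\<^esub> xs)"
    if "r \<in> carrier R" "s \<in> carrier R" for r s
    using xs nth[OF xs] that by (auto simp: r_distr m_assoc intro!: nth_equalityI)
  fix ys assume ys: "ys \<in> carrier ?F"
  show "xs \<oplus>\<^bsub>?F\<^esub> ys \<in> carrier ?F" using xs ys by (auto simp: set_zip) (metis nth_mem subsetD a_closed)
  show "xs \<oplus>\<^bsub>?F\<^esub> ys = ys \<oplus>\<^bsub>?F\<^esub> xs" using xs ys nth[OF xs] nth[OF ys] by (auto simp: a_comm intro!: nth_equalityI)
  show "r \<odot>\<^bsub>?F\<^esub> (xs \<oplus>\<^bsub>?F\<^esub> ys) = r \<odot>\<^bsub>?F\<^esub> xs \<oplus>\<^bsub>?F\<^esub> r \<odot>\<^bsub>?F\<^esub> ys" if "r \<in> carrier R" for r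
    using xs ys nth[OF xs] nth[OF ys] that by (auto simp: l_distr intro!: nth_equalityI)
  fix zs assume zs: "zs \<in> carrier ?F"
  show "xs \<oplus>\<^bsub>?F\<^esub> ys \<oplus>\<^bsub>?F\<^esub> zs = xs \<oplus>\<^bsub>?F\<^esub> (ys \<oplus>\<^bsub>?F\<^esub> zs)"
    using xs ys zs nth[OF xs] nth[OF ys] nth[OF zs] by (auto simp: a_assoc intro!: nth_equalityI)
qed auto

lemma nth_finsum_free:
  assumes "finite X" "f \<in> X \<rightarrow> carrier (free_module R n)" "i < n"
  shows "finsum (free_module R n) f X ! i = (\<Oplus>x\<in>X. f x ! i)"
  using assms
proof (induction X rule: finite_induct)
  case empty
  interpret F: right_module R "free_module R n" by (rule right_module_free)
  show ?case using empty by (simp add: F.M.finsum_empty del: free_module_simps) simp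
next
  case (insert a X)
  interpret F: right_module R "free_module R n" by (rule right_module_free)
  have f: "f a \<in> carrier (free_module R n)" "f \<in> X \<rightarrow> carrier (free_module R n)" using insert by auto
  have c: "f x ! i \<in> carrier R" if "x \<in> insert a X" for x
  proof -
    have "f x \<in> carrier (free_module R n)" using insert.prems(1) that by blast
    then show ?thesis using insert.prems(2) nth_mem[of i "f x"] by auto
  qed
  have "finsum (free_module R n) f (insert a X) = f a \<oplus>\<^bsub>free_module R n\<^esub> finsum (free_module R n) f X"
    using insert.hyps f by (intro F.M.finsum_insert)
  moreover have "finsum (free_module R n) f X \<in> carrier (free_module R n)" using f by (intro F.M.finsum_closed)
  ultimately show ?case using insert f c by (auto simp: Pi_iff)
qed

lemma free_module_fg: "free_module R n \<in> fg_modules R"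
proof -
  let ?F = "free_module R n"
  interpret F: right_module R ?F by (rule right_module_free)
  have "finitely_generated R ?F"
  proof (cases "\<one> = \<zero>")
    \<comment> \<open>In the zero ring all unit vectors coincide, so generators cannot be indexed by
      \<open>u\<close>; the empty set generates instead.\<close>
    case True
    then have "carrier R = {\<zero>}" using one_zeroD by blast
    then have "x = replicate n \<zero>" if "x \<in> carrier ?F" for x
      using that by (auto intro!: nth_equalityI) (metis nth_mem singletonD subsetD)
    then show ?thesis unfolding finitely_generated_def
      by (intro exI[of _ "{}"]) (auto simp: F.M.finsum_empty)
  next
    case False
    define u where "u i = (replicate n \<zero>)[i := \<one>]" for i
    have u: "u i ! j = (if i = j then \<one> else \<zero>)" if "j < n" "i < n" for i j
      using that by (auto simp: u_def nth_list_update)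
    have uc: "u i \<in> carrier ?F" for i
      using set_update_subset_insert[of "replicate n \<zero>" i \<one>] by (auto simp: u_def)
    have inj: "inj_on u {..<n}"
      by (rule inj_onI) (metis False lessThan_iff u)
    show ?thesis unfolding finitely_generated_def
    proof (intro exI[of _ "u ` {..<n}"] conjI ballI)
      fix x assume x: "x \<in> carrier ?F"
      define r where "r = (\<lambda>s. x ! the_inv_into {..<n} u s)"
      have r: "r (u i) = x ! i" if "i < n" for i using that inj by (simp add: r_def the_inv_into_f_f)
      have xc: "x ! i \<in> carrier R" if "i < n" for i using x that nth_mem by fastforce
      have c: "(\<lambda>i. r (u i) \<odot>\<^bsub>?F\<^esub> u i) \<in> {..<n} \<rightarrow> carrier ?F"
      proof
        fix i assume i: "i \<in> {..<n}"
        then have "r (u i) \<in> carrier R" using r xc by simp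
        then show "r (u i) \<odot>\<^bsub>?F\<^esub> u i \<in> carrier ?F" using uc by (intro F.rsmult_closed)
      qed
      have "(\<Oplus>\<^bsub>?F\<^esub>s\<in>u ` {..<n}. r s \<odot>\<^bsub>?F\<^esub> s) = (\<Oplus>\<^bsub>?F\<^esub>i\<in>{..<n}. r (u i) \<odot>\<^bsub>?F\<^esub> u i)"
        by (rule F.M.finsum_reindex) (use inj c in auto)
      also have "\<dots> = x"
      proof (rule nth_equalityI)
        have cl: "(\<Oplus>\<^bsub>?F\<^esub>i\<in>{..<n}. r (u i) \<odot>\<^bsub>?F\<^esub> u i) \<in> carrier ?F" using c by (rule F.M.finsum_closed)
        then show "length (\<Oplus>\<^bsub>?F\<^esub>i\<in>{..<n}. r (u i) \<odot>\<^bsub>?F\<^esub> u i) = length x" using x by simp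
        fix j assume "j < length (\<Oplus>\<^bsub>?F\<^esub>i\<in>{..<n}. r (u i) \<odot>\<^bsub>?F\<^esub> u i)"
        then have j: "j < n" using cl by simp
        have "(\<Oplus>\<^bsub>?F\<^esub>i\<in>{..<n}. r (u i) \<odot>\<^bsub>?F\<^esub> u i) ! j = (\<Oplus>i\<in>{..<n}. (r (u i) \<odot>\<^bsub>?F\<^esub> u i) ! j)"
          by (rule nth_finsum_free) (use c j in auto)
        also have "\<dots> = (\<Oplus>i\<in>{..<n}. if j = i then x ! i else \<zero>)"
          using j r u uc xc by (intro add.finprod_cong') (auto simp: u_def)
        also have "\<dots> = x ! j"
          using j xc by (subst add.finprod_singleton[where f = "\<lambda>i. x ! i"]) auto
        finally show "(\<Oplus>\<^bsub>?F\<^esub>i\<in>{..<n}. r (u i) \<odot>\<^bsub>?F\<^esub> u i) ! j = x ! j" .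
      qed
      finally show "\<exists>r\<in>u ` {..<n} \<rightarrow> carrier R. x = (\<Oplus>\<^bsub>?F\<^esub>s\<in>u ` {..<n}. r s \<odot>\<^bsub>?F\<^esub> s)"
        using r xc by (intro bexI[of _ r]) auto
    qed (use uc in auto)
  qed
  then show ?thesis using right_module_free by (simp add: fg_modules_def)
qed

end

text \<open>An enumeration of a finite generating set gives a surjection from a free module, and
  projectivity lifts the identity along it. Computations in projective modules can thus be moved to
  free ones.\<close>

lemma projective_summand:
  assumes "projective R P"
  shows "\<exists>n. \<exists>g\<in>mod_hom R (free_module R n) P. \<exists>h\<in>mod_hom R P (free_module R n).
    \<forall>x\<in>carrier P. g (h x) = x"
proof -
  have P: "right_module R P" "finitely_generated R P" "P \<in> fg_modules R"
    using assms by (auto simp: projective_def fg_modules_def)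
  interpret P: right_module R P by (rule P)
  obtain S where S: "finite S" "S \<subseteq> carrier P"
    "\<And>x. x \<in> carrier P \<Longrightarrow> \<exists>r\<in>S \<rightarrow> carrier R. x = (\<Oplus>\<^bsub>P\<^esub>s\<in>S. r s \<odot>\<^bsub>P\<^esub> s)"
    using P(2) unfolding finitely_generated_def by blast
  define n where "n = card S"
  obtain e where e: "bij_betw e {..<n} S"
    using S(1) ex_bij_betw_nat_finite[of S] by (auto simp: n_def atLeast0LessThan)
  let ?F = "free_module R n"
  have ec: "e i \<in> carrier P" if "i < n" for i using e S(2) that by (auto simp: bij_betw_def)
  define g where "g xs = (\<Oplus>\<^bsub>P\<^esub>i\<in>{..<n}. (xs ! i) \<odot>\<^bsub>P\<^esub> e i)" for xs
  have nth: "xs ! i \<in> carrier R" if "xs \<in> carrier ?F" "i < n" for xs i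
    using that nth_mem by fastforce
  have gc: "(\<lambda>i. (xs ! i) \<odot>\<^bsub>P\<^esub> e i) \<in> {..<n} \<rightarrow> carrier P" if "xs \<in> carrier ?F" for xs
    using nth[OF that] ec by auto
  have g: "g \<in> mod_hom R ?F P"
  proof (rule mod_homI)
    fix xs assume xs: "xs \<in> carrier ?F"
    show "g xs \<in> carrier P" unfolding g_def using gc[OF xs] by (rule P.M.finsum_closed)
    show "g (r \<odot>\<^bsub>?F\<^esub> xs) = r \<odot>\<^bsub>P\<^esub> g xs" if "r \<in> carrier R" for r
      unfolding g_def using xs that gc[OF xs] nth[OF xs] ec
      by (subst P.smult_finsum_right) (auto simp: P.rsmult_assoc intro!: P.M.finsum_cong')
    fix ys assume ys: "ys \<in> carrier ?F"
    show "g (xs \<oplus>\<^bsub>?F\<^esub> ys) = g xs \<oplus>\<^bsub>P\<^esub> g ys"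
    proof -
      have "g xs \<oplus>\<^bsub>P\<^esub> g ys = (\<Oplus>\<^bsub>P\<^esub>i\<in>{..<n}. (xs ! i) \<odot>\<^bsub>P\<^esub> e i \<oplus>\<^bsub>P\<^esub> (ys ! i) \<odot>\<^bsub>P\<^esub> e i)"
        unfolding g_def by (rule P.M.finsum_addf[OF gc[OF xs] gc[OF ys], symmetric])
      also have "\<dots> = g (xs \<oplus>\<^bsub>?F\<^esub> ys)"
        unfolding g_def using xs ys nth[OF xs] nth[OF ys] ec
        by (intro P.M.finsum_cong') (auto simp: P.rsmult_add_ring)
      finally show ?thesis by simp
    qed
  qed
  have surj: "g ` carrier ?F = carrier P"
  proof (intro equalityI subsetI)
    fix x assume "x \<in> carrier P"
    then obtain r where r: "r \<in> S \<rightarrow> carrier R" "x = (\<Oplus>\<^bsub>P\<^esub>s\<in>S. r s \<odot>\<^bsub>P\<^esub> s)" using S(3) by blast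
    define xs where "xs = map (\<lambda>i. r (e i)) [0..<n]"
    have eS: "e i \<in> S" if "i < n" for i using e that by (auto simp: bij_betw_def)
    have rc: "r (e i) \<in> carrier R" if "i < n" for i using eS[OF that] r(1) by auto
    have "g xs = (\<Oplus>\<^bsub>P\<^esub>i\<in>{..<n}. r (e i) \<odot>\<^bsub>P\<^esub> e i)"
      unfolding g_def xs_def using rc ec by (intro P.M.finsum_cong') auto
    also have "\<dots> = (\<Oplus>\<^bsub>P\<^esub>s\<in>e ` {..<n}. r s \<odot>\<^bsub>P\<^esub> s)"
      by (rule P.M.finsum_reindex[symmetric]) (use e rc ec in \<open>auto simp: bij_betw_def\<close>)
    also have "\<dots> = x" using r(2) e by (simp add: bij_betw_def)
    finally have "x = g xs" by simp
    moreover have "xs \<in> carrier ?F" using rc by (auto simp: xs_def)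
    ultimately show "x \<in> g ` carrier ?F" by blast
  qed (use mod_homD(1)[OF g] in auto)
  have "?F \<in> fg_modules R" by (rule P.R.free_module_fg)
  then obtain h where "h \<in> mod_hom R P ?F" "\<forall>x\<in>carrier P. g (h x) = x"
    using assms[unfolded projective_def, THEN conjunct2, rule_format, OF _ P(3) g mod_hom_id[OF P(1)] surj]
    by blast
  then show ?thesis using g by blast
qed

subsection \<open>Principal right ideals\<close>

text \<open>The elements are wrapped as singleton lists, to have the carrier type of \<^const>\<open>fg_modules\<close>.\<close>

definition principal :: "('a, 'b) ring_scheme \<Rightarrow> 'a \<Rightarrow> ('a, 'a list) module" where
  "principal R a =
     \<lparr>carrier = {[a \<otimes>\<^bsub>R\<^esub> r] | r. r \<in> carrier R}, mult = undefined, one = undefined,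
      zero = [\<zero>\<^bsub>R\<^esub>], add = (\<lambda>x y. [hd x \<oplus>\<^bsub>R\<^esub> hd y]), smult = (\<lambda>r x. [hd x \<otimes>\<^bsub>R\<^esub> r])\<rparr>"

lemma principal_simps [simp]:
  "x \<in> carrier (principal R a) \<longleftrightarrow> (\<exists>r\<in>carrier R. x = [a \<otimes>\<^bsub>R\<^esub> r])"
  "\<zero>\<^bsub>principal R a\<^esub> = [\<zero>\<^bsub>R\<^esub>]"
  "x \<oplus>\<^bsub>principal R a\<^esub> y = [hd x \<oplus>\<^bsub>R\<^esub> hd y]"
  "r \<odot>\<^bsub>principal R a\<^esub> x = [hd x \<otimes>\<^bsub>R\<^esub> r]"
  by (auto simp: principal_def)

context ring
begin

lemma right_module_principal:
  assumes a: "a \<in> carrier R" shows "right_module R (principal R a)"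
proof (intro right_module.intro right_module_axioms.intro abelian_groupI)
  let ?P = "principal R a"
  show "ring R" by (rule ring_axioms)
  fix x assume "x \<in> carrier ?P"
  then obtain r where r: "r \<in> carrier R" "x = [a \<otimes> r]" by auto
  show "\<exists>y\<in>carrier ?P. y \<oplus>\<^bsub>?P\<^esub> x = \<zero>\<^bsub>?P\<^esub>"
  proof (intro bexI[of _ "[a \<otimes> (\<ominus> r)]"])
    show "[a \<otimes> (\<ominus> r)] \<in> carrier ?P" using r by (auto intro!: bexI[of _ "\<ominus> r"])
  qed (use r a in \<open>simp add: r_minus l_neg\<close>)
  show "\<zero>\<^bsub>?P\<^esub> \<oplus>\<^bsub>?P\<^esub> x = x" "\<one> \<odot>\<^bsub>?P\<^esub> x = x" using r a by auto
  show "s \<odot>\<^bsub>?P\<^esub> x \<in> carrier ?P" if "s \<in> carrier R" for s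
    using that r a by (auto simp: m_assoc)
  show "(s \<oplus> t) \<odot>\<^bsub>?P\<^esub> x = s \<odot>\<^bsub>?P\<^esub> x \<oplus>\<^bsub>?P\<^esub> t \<odot>\<^bsub>?P\<^esub> x"
    "(s \<otimes> t) \<odot>\<^bsub>?P\<^esub> x = t \<odot>\<^bsub>?P\<^esub> (s \<odot>\<^bsub>?P\<^esub> x)"
    if "s \<in> carrier R" "t \<in> carrier R" for s t using that r a by (auto simp: r_distr m_assoc)
  fix y assume "y \<in> carrier ?P"
  then obtain s where s: "s \<in> carrier R" "y = [a \<otimes> s]" by auto
  show "x \<oplus>\<^bsub>?P\<^esub> y \<in> carrier ?P" using r s a by (auto simp: r_distr[symmetric])
  show "x \<oplus>\<^bsub>?P\<^esub> y = y \<oplus>\<^bsub>?P\<^esub> x" using r s a by (auto simp: a_comm)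
  show "t \<odot>\<^bsub>?P\<^esub> (x \<oplus>\<^bsub>?P\<^esub> y) = t \<odot>\<^bsub>?P\<^esub> x \<oplus>\<^bsub>?P\<^esub> t \<odot>\<^bsub>?P\<^esub> y" if "t \<in> carrier R" for t
    using r s a that by (auto simp: l_distr)
  fix z assume "z \<in> carrier ?P"
  then show "x \<oplus>\<^bsub>?P\<^esub> y \<oplus>\<^bsub>?P\<^esub> z = x \<oplus>\<^bsub>?P\<^esub> (y \<oplus>\<^bsub>?P\<^esub> z)" using r s a by (auto simp: a_assoc)
qed (use a in \<open>auto intro!: bexI[of _ \<zero>]\<close>)

lemma principal_fg:
  assumes a: "a \<in> carrier R" shows "principal R a \<in> fg_modules R"
proof -
  interpret P: right_module R "principal R a" by (rule right_module_principal[OF a])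
  have "finitely_generated R (principal R a)" unfolding finitely_generated_def
  proof (intro exI[of _ "{[a]}"] conjI ballI)
    show "{[a]} \<subseteq> carrier (principal R a)" using a by (auto intro!: bexI[of _ \<one>])
    fix x assume "x \<in> carrier (principal R a)"
    then obtain r where r: "r \<in> carrier R" "x = [a \<otimes> r]" by auto
    have "(\<Oplus>\<^bsub>principal R a\<^esub>s\<in>{[a]}. r \<odot>\<^bsub>principal R a\<^esub> s) = r \<odot>\<^bsub>principal R a\<^esub> [a] \<oplus>\<^bsub>principal R a\<^esub> \<zero>\<^bsub>principal R a\<^esub>"
      using r a by (subst P.M.finsum_insert) (auto simp: P.M.finsum_empty)
    then show "\<exists>r\<in>{[a]} \<rightarrow> carrier R. x = (\<Oplus>\<^bsub>principal R a\<^esub>s\<in>{[a]}. r s \<odot>\<^bsub>principal R a\<^esub> s)"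
      using r a by (intro bexI[of _ "\<lambda>_. r"]) auto
  qed simp
  then show ?thesis using right_module_principal[OF a] by (simp add: fg_modules_def)
qed

text \<open>A homomorphism from \<open>e R\<close> is determined by the image of \<open>e\<close>;
  letting elements of \<open>e R\<close> act on a preimage \<open>m\<close> of that image defines
  the lift.\<close>

lemma principal_idempotent_projective:
  assumes e: "e \<in> carrier R" "e \<otimes> e = e" shows "projective R (principal R e)"
  unfolding projective_def
proof (intro conjI ballI impI principal_fg e)
  fix M N g f
  assume *: "M \<in> fg_modules R" "N \<in> fg_modules R" "g \<in> mod_hom R M N" "f \<in> mod_hom R (principal R e) N"
    "g ` carrier M = carrier N"
  interpret M: right_module R M using * by (simp add: fg_modules_def)
  interpret N: right_module R N using * by (simp add: fg_modules_def)
  have e_in: "[e] \<in> carrier (principal R e)" using e by (auto intro!: bexI[of _ \<one>])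
  then obtain m where m: "m \<in> carrier M" "g m = f [e]"
    using mod_homD(1)[OF *(4)] *(5) by (metis imageE)
  define h where "h x = hd x \<odot>\<^bsub>M\<^esub> m" for x
  show "\<exists>h\<in>mod_hom R (principal R e) M. \<forall>x\<in>carrier (principal R e). g (h x) = f x"
  proof (intro bexI[of _ h] ballI)
    show "h \<in> mod_hom R (principal R e) M"
      using m e by (intro mod_homI) (auto simp: h_def M.rsmult_add_ring M.rsmult_assoc)
    fix x assume "x \<in> carrier (principal R e)"
    then obtain r where r: "r \<in> carrier R" "x = [e \<otimes> r]" by auto
    have "x = (e \<otimes> r) \<odot>\<^bsub>principal R e\<^esub> [e]" using r e by (simp add: m_assoc[symmetric])
    then have "f x = (e \<otimes> r) \<odot>\<^bsub>N\<^esub> f [e]"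
      using mod_homD(3)[OF *(4), of "e \<otimes> r" "[e]"] e_in r e by simp
    then show "g (h x) = f x" using r e m by (simp add: h_def mod_homD(3)[OF *(3)])
  qed
qed

end


section \<open>Submodules of free modules over a gentle algebra\<close>

context gentle
begin

abbreviation F where "F \<equiv> free_module B"

text \<open>Coordinates in the path basis: this carries submodules of free modules into the function
  space in which complements are chosen.\<close>

definition emb where "emb xs = (\<lambda>(i, p). if i < length xs then cf (xs ! i) p else 0)"

definition gelem where "gelem \<tau> = (case \<tau> of Inl v \<Rightarrow> ce v 1 | Inr a \<Rightarrow> ar a)"

lemma gelem_carrier [simp]: "\<tau> \<in> tags \<Longrightarrow> gelem \<tau> \<in> carrier B"
  by (auto simp: gelem_def tags_def)

lemma F_nth: "xs \<in> carrier (F n) \<Longrightarrow> i < n \<Longrightarrow> xs ! i \<in> carrier B"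
  using nth_mem by fastforce

lemma emb_inj:
  assumes "xs \<in> carrier (F n)" "ys \<in> carrier (F n)" "emb xs = emb ys" shows "xs = ys"
proof (rule nth_equalityI)
  show "length xs = length ys" using assms by simp
  fix i assume "i < length xs"
  then have i: "i < n" using assms by simp
  have "cf (xs ! i) p = cf (ys ! i) p" for p
    using fun_cong[OF assms(3), of "(i, p)"] i assms by (simp add: emb_def)
  then show "xs ! i = ys ! i" using F_nth[OF assms(1) i] F_nth[OF assms(2) i] by (intro cf_eqI)
qed

lemma emb_zero: "emb (replicate n \<zero>\<^bsub>B\<^esub>) = 0"
  by (auto simp: emb_def fun_eq_iff)

lemma emb_add:
  assumes "xs \<in> carrier (F n)" "ys \<in> carrier (F n)"
  shows "emb (xs \<oplus>\<^bsub>F n\<^esub> ys) = emb xs + emb ys"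
proof
  fix j :: "nat \<times> ('v, 'e) path"
  show "emb (xs \<oplus>\<^bsub>F n\<^esub> ys) j = (emb xs + emb ys) j"
    using F_nth[OF assms(1)] F_nth[OF assms(2)] assms
    by (cases j) (auto simp: emb_def cf_add)
qed

lemma emb_ce:
  assumes "xs \<in> carrier (F n)" "v \<in> verts Q"
  shows "emb (ce v c \<odot>\<^bsub>F n\<^esub> xs) = fscale c (ev v (emb xs))"
proof
  fix j :: "nat \<times> ('v, 'e) path"
  show "emb (ce v c \<odot>\<^bsub>F n\<^esub> xs) j = fscale c (ev v (emb xs)) j"
    using F_nth[OF assms(1)] assms by (cases j) (auto simp: emb_def cf_mult_ce ev_def)
qed

lemma emb_ar:
  assumes "xs \<in> carrier (F n)" "a \<in> arcs Q"
  shows "emb (ar a \<odot>\<^bsub>F n\<^esub> xs) = act a (emb xs)"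
proof
  fix j :: "nat \<times> ('v, 'e) path"
  show "emb (ar a \<odot>\<^bsub>F n\<^esub> xs) j = act a (emb xs) j"
    using F_nth[OF assms(1)] assms by (cases j) (auto simp: emb_def cf_mult_ar act_def)
qed

lemma supported_emb: "supported (emb xs)"
  unfolding supported_def emb_def using cf_outside by auto

lemma emb_gelem: "\<tau> \<in> tags \<Longrightarrow> emb [gelem \<tau>] = tag_elem \<tau>"
  by (auto simp: emb_def gelem_def tag_elem_def tags_def tag_path_def cf_ce cf_ar fun_eq_iff)

text \<open>Divisibility is visible in the support: if all paths end as \<tau> prescribes, the
  generator splits off on the right in every coordinate.\<close>

lemma emb_factor:
  assumes "xs \<in> carrier (F n)" "\<tau> \<in> tags" and e: "\<And>i p. emb xs (i, p) \<noteq> 0 \<Longrightarrow> ending \<tau> p"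
  shows "\<exists>ys\<in>carrier (F n). xs = gelem \<tau> \<odot>\<^bsub>F n\<^esub> ys"
proof (cases \<tau>)
  case (Inl v)
  interpret F: right_module B "F n" by (rule B.right_module_free)
  have v: "v \<in> verts Q" using assms(2) Inl by simp
  have "ev v (emb xs) = emb xs" using ev_ending_vertex[of "emb xs" v v] e Inl by metis
  then have "emb (ce v 1 \<odot>\<^bsub>F n\<^esub> xs) = emb xs" using emb_ce[OF assms(1) v, of 1] by (simp only: fs.scale_one)
  moreover have "ce v 1 \<odot>\<^bsub>F n\<^esub> xs \<in> carrier (F n)" using assms(1) v by (intro F.rsmult_closed) auto
  ultimately have "xs = ce v 1 \<odot>\<^bsub>F n\<^esub> xs" using emb_inj[OF assms(1)] by simp
  then show ?thesis using assms(1) by (auto simp: gelem_def Inl)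
next
  case (Inr a)
  have a: "a \<in> arcs Q" using assms(2) Inr by simp
  have "\<exists>s\<in>carrier B. xs ! i = s \<bullet> ar a" if i: "i < n" for i
  proof -
    have "snd p \<noteq> [] \<and> last (snd p) = a" if "cf (xs ! i) p \<noteq> 0" for p
      using e[of i p] that i assms(1) Inr by (simp add: emb_def ending_def)
    then show ?thesis using right_factor[OF F_nth[OF assms(1) i] a] by metis
  qed
  then obtain s where s: "\<And>i. i < n \<Longrightarrow> s i \<in> carrier B \<and> xs ! i = s i \<bullet> ar a" by metis
  have "xs = ar a \<odot>\<^bsub>F n\<^esub> map s [0..<n]" using s assms(1) by (auto intro!: nth_equalityI)
  moreover have "map s [0..<n] \<in> carrier (F n)" using s by auto
  ultimately show ?thesis unfolding gelem_def Inr sum.case by blast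
qed

text \<open>\<open>act_kernel\<close> answers the question in a free module, and a projective module
  inherits the answer as a retract: the factorisation of \<open>h x\<close> is carried back by
  \<open>g\<close>.\<close>

lemma projective_kernel:
  assumes P: "projective B P" and x: "x \<in> carrier P" and a: "a \<in> arcs Q"
    and "ce (tail Q a) 1 \<odot>\<^bsub>P\<^esub> x = x" "ar a \<odot>\<^bsub>P\<^esub> x = \<zero>\<^bsub>P\<^esub>"
  shows "x = \<zero>\<^bsub>P\<^esub> \<or> (\<exists>b y. rel b a \<and> y \<in> carrier P \<and> x = ar b \<odot>\<^bsub>P\<^esub> y)"
proof -
  obtain n g h where gh: "g \<in> mod_hom B (F n) P" "h \<in> mod_hom B P (F n)"
    "\<And>x. x \<in> carrier P \<Longrightarrow> g (h x) = x" using projective_summand[OF P] by metis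
  interpret F: right_module B "F n" by (rule B.right_module_free)
  interpret P: right_module B P using P by (simp add: projective_def fg_modules_def)
  have h: "h x \<in> carrier (F n)" using mod_homD(1)[OF gh(2) x] .
  have h0: "h \<zero>\<^bsub>P\<^esub> = \<zero>\<^bsub>F n\<^esub>" and g0: "g \<zero>\<^bsub>F n\<^esub> = \<zero>\<^bsub>P\<^esub>"
    using mod_hom_zero gh(1,2) P.right_module_axioms F.right_module_axioms by blast+
  have "act a (emb (h x)) = emb (h (ar a \<odot>\<^bsub>P\<^esub> x))"
    using emb_ar[OF h a] mod_homD(3)[OF gh(2) ar_carrier[OF a] x] by simp
  also have "\<dots> = 0" using assms(5) h0 emb_zero by simp
  finally have 1: "act a (emb (h x)) = 0" .
  have "fscale 1 (ev (tail Q a) (emb (h x))) = emb (h (ce (tail Q a) 1 \<odot>\<^bsub>P\<^esub> x))"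
    using emb_ce[OF h] mod_homD(3)[OF gh(2) ce_carrier x] a by simp
  then have 2: "ev (tail Q a) (emb (h x)) = emb (h x)" using assms(4) by (simp only: fs.scale_one)
  consider "emb (h x) = 0" | b where "rel b a" "\<forall>i p. emb (h x) (i, p) \<noteq> 0 \<longrightarrow> ending (Inr b) p"
    using act_kernel[OF supported_emb 2 a 1] by blast
  then show ?thesis
  proof cases
    case 1
    then have "emb (h x) = emb (\<zero>\<^bsub>F n\<^esub>)" by (simp only: free_module_simps emb_zero)
    then have "h x = \<zero>\<^bsub>F n\<^esub>" using emb_inj h F.M.zero_closed by blast
    then show ?thesis using gh(3)[OF x] g0 by metis
  next
    case 2
    have b: "b \<in> arcs Q" using rel_in_arcs 2(1) by blast
    then obtain ys where ys: "ys \<in> carrier (F n)" "h x = ar b \<odot>\<^bsub>F n\<^esub> ys"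
      using emb_factor[OF h, of "Inr b"] 2(2) by (auto simp: gelem_def simp del: free_module_simps)
    then have "x = ar b \<odot>\<^bsub>P\<^esub> g ys"
      using gh(3)[OF x] mod_homD(3)[OF gh(1) ar_carrier[OF b] ys(1)] by metis
    then show ?thesis using 2(1) mod_homD(1)[OF gh(1) ys(1)] by blast
  qed
qed

lemma emb_hom:
  assumes "u \<in> mod_hom B G (F n)" "right_module B G" "x \<in> carrier G"
  shows "y \<in> carrier G \<Longrightarrow> emb (u (x \<oplus>\<^bsub>G\<^esub> y)) = emb (u x) + emb (u y)"
    "v \<in> verts Q \<Longrightarrow> emb (u (ce v c \<odot>\<^bsub>G\<^esub> x)) = fscale c (ev v (emb (u x)))"
    "a \<in> arcs Q \<Longrightarrow> emb (u (ar a \<odot>\<^bsub>G\<^esub> x)) = act a (emb (u x))"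
    "emb (u \<zero>\<^bsub>G\<^esub>) = 0"
proof -
  interpret F: right_module B "F n" by (rule B.right_module_free)
  have uc: "u z \<in> carrier (F n)" if "z \<in> carrier G" for z using mod_homD(1)[OF assms(1) that] .
  show "emb (u (x \<oplus>\<^bsub>G\<^esub> y)) = emb (u x) + emb (u y)" if "y \<in> carrier G"
    unfolding mod_homD(2)[OF assms(1,3) that] by (rule emb_add[OF uc[OF assms(3)] uc[OF that]])
  show "emb (u (ce v c \<odot>\<^bsub>G\<^esub> x)) = fscale c (ev v (emb (u x)))" if "v \<in> verts Q"
    unfolding mod_homD(3)[OF assms(1) ce_carrier[OF that] assms(3)] by (rule emb_ce[OF uc[OF assms(3)] that])
  show "emb (u (ar a \<odot>\<^bsub>G\<^esub> x)) = act a (emb (u x))" if "a \<in> arcs Q"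
    unfolding mod_homD(3)[OF assms(1) ar_carrier[OF that] assms(3)] by (rule emb_ar[OF uc[OF assms(3)] that])
  show "emb (u \<zero>\<^bsub>G\<^esub>) = 0"
    unfolding mod_hom_zero[OF assms(1,2) F.right_module_axioms] free_module_simps by (rule emb_zero)
qed

lemma rep_closed_image:
  assumes u: "u \<in> mod_hom B G (F n)" and G: "right_module B G"
  shows "rep_closed ((\<lambda>x. emb (u x)) ` carrier G)" (is "rep_closed ?M")
proof -
  interpret G: right_module B G by (rule G)
  have Mce: "fscale c (ev v x) \<in> ?M" if x: "x \<in> ?M" and v: "v \<in> verts Q" for x v c
  proof -
    obtain z where z: "z \<in> carrier G" "x = emb (u z)" using x by blast
    show ?thesis unfolding z(2) emb_hom(2)[OF u G z(1) v, symmetric]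
      by (rule imageI[of _ "carrier G" "\<lambda>x. emb (u x)"]) (use z v in auto)
  qed
  have M0: "0 \<in> ?M" unfolding emb_hom(4)[OF u G G.M.zero_closed, symmetric]
    by (rule imageI[of _ "carrier G" "\<lambda>x. emb (u x)"]) (rule G.M.zero_closed)
  have Madd: "x + y \<in> ?M" if xy: "x \<in> ?M" "y \<in> ?M" for x y
  proof -
    obtain x' y' where z: "x' \<in> carrier G" "x = emb (u x')" "y' \<in> carrier G" "y = emb (u y')"
      using xy by blast
    show ?thesis unfolding z(2,4) emb_hom(1)[OF u G z(1,3), symmetric]
      by (rule imageI[of _ "carrier G" "\<lambda>x. emb (u x)"]) (use z in auto)
  qed
  \<comment> \<open>Scalars act on \<open>G\<close> only through the elements \<open>ce v c\<close>,
    so multiplication by \<open>c\<close> is recovered as a sum over all vertices.\<close>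
  have Msum: "(\<Sum>v\<in>X. fscale c (ev v x)) \<in> ?M" if "x \<in> ?M" "finite X" "X \<subseteq> verts Q" for x c X
    using that(2,3)
  proof (induction X rule: finite_induct)
    case empty
    show ?case unfolding sum.empty by (rule M0)
  next
    case (insert v X)
    show ?case unfolding sum.insert[OF insert.hyps]
      by (intro Madd Mce that(1) insert.IH) (use insert.prems in auto)
  qed
  show ?thesis unfolding rep_closed_def
  proof (intro conjI ballI fs.subspaceI M0 Madd)
    fix x assume x: "x \<in> ?M"
    show "fscale c x \<in> ?M" for c
    proof -
      have "supported x" using x supported_emb by blast
      then have "(\<Sum>v\<in>verts Q. fscale c (ev v x)) = fscale c x"
        unfolding fs.scale_sum_right[symmetric] by (subst sum_ev) simp_all
      then show ?thesis using Msum[OF x _ order.refl, of c] by simp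
    qed
    show "ev v x \<in> ?M" if "v \<in> verts Q" for v using Mce[OF x that, of 1] by (simp only: fs.scale_one)
    show "act a x \<in> ?M" if a: "a \<in> arcs Q" for a
    proof -
      obtain z where z: "z \<in> carrier G" "x = emb (u z)" using x by blast
      show ?thesis unfolding z(2) emb_hom(3)[OF u G z(1) a, symmetric]
        by (rule imageI[of _ "carrier G" "\<lambda>x. emb (u x)"]) (use z a in auto)
    qed
  qed auto
qed

lemma mod_hom_generators:
  assumes M: "right_module B M" and N: "right_module B N"
    and f: "\<And>x. x \<in> carrier M \<Longrightarrow> f x \<in> carrier N"
    and add: "\<And>x y. x \<in> carrier M \<Longrightarrow> y \<in> carrier M \<Longrightarrow> f (x \<oplus>\<^bsub>M\<^esub> y) = f x \<oplus>\<^bsub>N\<^esub> f y"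
    and ce: "\<And>v c x. x \<in> carrier M \<Longrightarrow> v \<in> verts Q \<Longrightarrow> f (ce v c \<odot>\<^bsub>M\<^esub> x) = ce v c \<odot>\<^bsub>N\<^esub> f x"
    and ar: "\<And>a x. x \<in> carrier M \<Longrightarrow> a \<in> arcs Q \<Longrightarrow> f (ar a \<odot>\<^bsub>M\<^esub> x) = ar a \<odot>\<^bsub>N\<^esub> f x"
  shows "f \<in> mod_hom B M N"
proof -
  interpret M: right_module B M by (rule M)
  interpret N: right_module B N by (rule N)
  have f0: "f \<zero>\<^bsub>M\<^esub> = \<zero>\<^bsub>N\<^esub>"
    using add[of "\<zero>\<^bsub>M\<^esub>" "\<zero>\<^bsub>M\<^esub>"] f[of "\<zero>\<^bsub>M\<^esub>"] N.M.add.l_cancel_one' by fastforce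
  have "\<forall>x\<in>carrier M. f (b \<odot>\<^bsub>M\<^esub> x) = b \<odot>\<^bsub>N\<^esub> f x" if "b \<in> carrier B" for b
    using that
  proof (induction rule: B_induct)
    case (add r s)
    then show ?case by (simp add: M.rsmult_add_ring N.rsmult_add_ring assms(4) f)
  next
    case (mult r s)
    then show ?case by (simp add: M.rsmult_assoc N.rsmult_assoc f)
  qed (simp_all add: f0 f ce ar)
  then show ?thesis using f add by (intro mod_homI) auto
qed

text \<open>The retraction gives \<open>r\<close> from \<open>G\<close> onto the right ideal of the
  generator \<open>g\<close>, sending \<open>t\<close> to \<open>g\<close>. Because
  \<open>u t\<close> has the form \<open>y g\<close>, whatever annihilates \<open>g\<close> kills
  \<open>t\<close>, so \<open>G\<close> is the direct sum of the submodule generated by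
  \<open>t\<close> and the kernel of \<open>r\<close>; indecomposability removes the kernel. That
  \<open>t\<close> is not a multiple of its arrow is kept as the starting point for the chain of
  relations.\<close>

lemma torsionless_indecomposable:
  assumes G: "right_module B G" "indecomposable B G"
    and u: "u \<in> mod_hom B G (F n)" "inj_on u (carrier G)"
  shows "\<exists>\<tau>\<in>tags. \<exists>t\<in>carrier G. \<exists>y\<in>carrier (F n). u t = gelem \<tau> \<odot>\<^bsub>F n\<^esub> y \<and>
    (\<forall>a. \<tau> = Inr a \<longrightarrow> (\<forall>m\<in>carrier G. t \<noteq> ar a \<odot>\<^bsub>G\<^esub> m)) \<and> mod_iso B G (principal B (gelem \<tau>))"
proof -
  interpret F: right_module B "F n" by (rule B.right_module_free)
  interpret G: right_module B G by (rule G)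
  define \<phi> where "\<phi> x = emb (u x)" for x
  have uc: "u x \<in> carrier (F n)" if "x \<in> carrier G" for x using mod_homD(1)[OF u(1) that] .
  note \<phi>_hom = emb_hom[OF u(1) G(1), folded \<phi>_def]
  have \<phi>_inj: "x = y" if "x \<in> carrier G" "y \<in> carrier G" "\<phi> x = \<phi> y" for x y
    using emb_inj[OF uc[OF that(1)] uc[OF that(2)]] that u(2) by (auto simp: \<phi>_def inj_on_def)
  define M where "M = \<phi> ` carrier G"
  have \<phi>M: "\<phi> x \<in> M" if "x \<in> carrier G" for x using that unfolding M_def by (rule imageI)
  have Msupp: "supported x" if "x \<in> M" for x using that supported_emb by (auto simp: M_def \<phi>_def)
  have "rep_closed M" unfolding M_def \<phi>_def by (rule rep_closed_image[OF u(1) G(1)])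
  then interpret rep_submodule Q I M by unfold_locales (auto intro: Msupp)
  have "M \<noteq> {0}"
  proof
    assume M: "M = {0}"
    have "x = \<zero>\<^bsub>G\<^esub>" if "x \<in> carrier G" for x
    proof (rule \<phi>_inj[OF that G.M.zero_closed])
      show "\<phi> x = \<phi> \<zero>\<^bsub>G\<^esub>"
        using \<phi>M[OF that] \<phi>M[OF G.M.zero_closed] unfolding M singleton_iff by (rule trans[OF _ sym])
    qed
    then have "carrier G = {\<zero>\<^bsub>G\<^esub>}" using G.M.zero_closed by blast
    then show False using G(2) by (simp add: indecomposable_def)
  qed
  then obtain \<tau> s \<rho> where s: "\<tau> \<in> tags" "s \<in> M" "s \<noteq> 0" "\<And>i p. s (i, p) \<noteq> 0 \<Longrightarrow> ending \<tau> p"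
    "\<And>a. \<tau> = Inr a \<Longrightarrow> s \<notin> act a ` M" "\<rho> s = tag_elem \<tau>"
    and \<rho>: "\<And>x y. x \<in> M \<Longrightarrow> y \<in> M \<Longrightarrow> \<rho> (x + y) = \<rho> x + \<rho> y"
    "\<And>c x. x \<in> M \<Longrightarrow> \<rho> (fscale c x) = fscale c (\<rho> x)"
    "\<And>w x. w \<in> verts Q \<Longrightarrow> x \<in> M \<Longrightarrow> \<rho> (ev w x) = ev w (\<rho> x)"
    "\<And>a x. a \<in> arcs Q \<Longrightarrow> x \<in> M \<Longrightarrow> \<rho> (act a x) = act a (\<rho> x)"
    "\<And>Z x. rep_closed Z \<Longrightarrow> tag_elem \<tau> \<in> Z \<Longrightarrow> x \<in> M \<Longrightarrow> \<rho> x \<in> Z"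
    by (rule retraction) blast
  obtain t where t: "t \<in> carrier G" "s = \<phi> t" using s(2) unfolding M_def by blast
  let ?g = "gelem \<tau>" and ?P = "principal B (gelem \<tau>)"
  have g: "?g \<in> carrier B" using s(1) by simp
  interpret P: right_module B ?P by (rule B.right_module_principal[OF g])
  have idP: "(\<lambda>x. x) \<in> mod_hom B ?P (F 1)" by (rule mod_homI) (use g in auto)
  note P_hom = emb_hom[OF idP P.right_module_axioms]
  have P_inj: "x = y" if "x \<in> carrier ?P" "y \<in> carrier ?P" "emb x = emb y" for x y
    using emb_inj[OF mod_homD(1)[OF idP] mod_homD(1)[OF idP]] that by blast
  have g_in: "[?g] \<in> carrier ?P" using g by (auto intro!: bexI[of _ "\<one>\<^bsub>B\<^esub>"])
  have "\<exists>q\<in>carrier ?P. emb q = \<rho> (\<phi> x)" if x: "x \<in> carrier G" for x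
  proof -
    have "tag_elem \<tau> \<in> emb ` carrier ?P"
      unfolding emb_gelem[OF s(1), symmetric] by (rule imageI[OF g_in])
    then have "\<rho> (\<phi> x) \<in> emb ` carrier ?P"
      using \<rho>(5)[OF rep_closed_image[OF idP P.right_module_axioms] _ \<phi>M[OF x]] by blast
    then show ?thesis by force
  qed
  then obtain r where r: "\<And>x. x \<in> carrier G \<Longrightarrow> r x \<in> carrier ?P"
    and emb_r: "\<And>x. x \<in> carrier G \<Longrightarrow> emb (r x) = \<rho> (\<phi> x)" by metis
  have r_hom: "r \<in> mod_hom B G ?P"
  proof (rule mod_hom_generators[OF G(1) P.right_module_axioms r])
    fix x assume x: "x \<in> carrier G"
    show "r (x \<oplus>\<^bsub>G\<^esub> y) = r x \<oplus>\<^bsub>?P\<^esub> r y" if y: "y \<in> carrier G" for y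
    proof (rule P_inj[OF r[OF G.M.a_closed[OF x y]] P.M.a_closed[OF r[OF x] r[OF y]]])
      show "emb (r (x \<oplus>\<^bsub>G\<^esub> y)) = emb (r x \<oplus>\<^bsub>?P\<^esub> r y)"
        unfolding P_hom(1)[OF r[OF x] r[OF y]] emb_r[OF x] emb_r[OF y] emb_r[OF G.M.a_closed[OF x y]]
          \<phi>_hom(1)[OF x y] by (rule \<rho>(1)[OF \<phi>M[OF x] \<phi>M[OF y]])
    qed
    show "r (ce v c \<odot>\<^bsub>G\<^esub> x) = ce v c \<odot>\<^bsub>?P\<^esub> r x" if v: "v \<in> verts Q" for v c
    proof (rule P_inj)
      have cx: "ce v c \<odot>\<^bsub>G\<^esub> x \<in> carrier G" using v x by (intro G.rsmult_closed) auto
      then show "r (ce v c \<odot>\<^bsub>G\<^esub> x) \<in> carrier ?P" by (rule r)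
      show "emb (r (ce v c \<odot>\<^bsub>G\<^esub> x)) = emb (ce v c \<odot>\<^bsub>?P\<^esub> r x)"
        unfolding emb_r[OF cx] P_hom(2)[OF r[OF x] v] emb_r[OF x] \<phi>_hom(2)[OF x v]
          \<rho>(2)[OF M_closed(5)[OF v \<phi>M[OF x]]] \<rho>(3)[OF v \<phi>M[OF x]] ..
    qed (intro P.rsmult_closed ce_carrier v r x)
    show "r (ar a \<odot>\<^bsub>G\<^esub> x) = ar a \<odot>\<^bsub>?P\<^esub> r x" if a: "a \<in> arcs Q" for a
    proof (rule P_inj)
      have cx: "ar a \<odot>\<^bsub>G\<^esub> x \<in> carrier G" using a x by (intro G.rsmult_closed) auto
      then show "r (ar a \<odot>\<^bsub>G\<^esub> x) \<in> carrier ?P" by (rule r)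
      show "emb (r (ar a \<odot>\<^bsub>G\<^esub> x)) = emb (ar a \<odot>\<^bsub>?P\<^esub> r x)"
        unfolding emb_r[OF cx] P_hom(3)[OF r[OF x] a] emb_r[OF x] \<phi>_hom(3)[OF x a] \<rho>(4)[OF a \<phi>M[OF x]] ..
    qed (intro P.rsmult_closed ar_carrier a r x)
  qed
  have rt: "r t = [?g]"
  proof (rule P_inj[OF r[OF t(1)] g_in])
    show "emb (r t) = emb [?g]"
      unfolding emb_r[OF t(1)] t(2)[symmetric] s(6) emb_gelem[OF s(1)] ..
  qed
  obtain y where y: "y \<in> carrier (F n)" "u t = ?g \<odot>\<^bsub>F n\<^esub> y"
    using emb_factor[OF uc[OF t(1)] s(1)] s(4) unfolding t(2) \<phi>_def by blast
  have rbt: "r (b \<odot>\<^bsub>G\<^esub> t) = [?g \<bullet> b]" if "b \<in> carrier B" for b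
    using mod_homD(3)[OF r_hom that t(1)] rt by simp
  define X where "X = {b \<odot>\<^bsub>G\<^esub> t | b. b \<in> carrier B}"
  define K where "K = {x \<in> carrier G. r x = \<zero>\<^bsub>?P\<^esub>}"
  have r0: "r \<zero>\<^bsub>G\<^esub> = \<zero>\<^bsub>?P\<^esub>" by (rule mod_hom_zero[OF r_hom G(1) P.right_module_axioms])
  have subX: "submodule X B G"
  proof (rule G.submoduleI)
    show "\<zero>\<^bsub>G\<^esub> \<in> X" using t(1) by (auto simp: X_def intro!: exI[of _ "\<zero>\<^bsub>B\<^esub>"])
    fix x assume "x \<in> X"
    then obtain b where b: "b \<in> carrier B" "x = b \<odot>\<^bsub>G\<^esub> t" by (auto simp: X_def)
    show "c \<odot>\<^bsub>G\<^esub> x \<in> X" if "c \<in> carrier B" for c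
      using b that t(1) by (auto simp: X_def G.rsmult_assoc[symmetric])
    fix z assume "z \<in> X"
    then obtain c where c: "c \<in> carrier B" "z = c \<odot>\<^bsub>G\<^esub> t" by (auto simp: X_def)
    show "x \<oplus>\<^bsub>G\<^esub> z \<in> X"
      using b c t(1) by (auto simp: X_def G.rsmult_add_ring[symmetric])
  qed (use t(1) in \<open>auto simp: X_def\<close>)
  have subK: "submodule K B G"
  proof (rule G.submoduleI)
    show "\<zero>\<^bsub>G\<^esub> \<in> K" using r0 by (simp add: K_def del: principal_simps)
    show "x \<oplus>\<^bsub>G\<^esub> z \<in> K" if "x \<in> K" "z \<in> K" for x z
      using that mod_homD(2)[OF r_hom, of x z] by (simp add: K_def del: principal_simps)
    show "b \<odot>\<^bsub>G\<^esub> x \<in> K" if "b \<in> carrier B" "x \<in> K" for b x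
      using that mod_homD(3)[OF r_hom, of b x] by (simp add: K_def del: principal_simps)
  qed (auto simp: K_def)
  have "X <+>\<^bsub>G\<^esub> K = carrier G"
  proof (intro equalityI subsetI)
    fix x assume x: "x \<in> carrier G"
    obtain b where b: "b \<in> carrier B" "r x = [?g \<bullet> b]" using r[OF x] by auto
    have bt: "b \<odot>\<^bsub>G\<^esub> t \<in> carrier G" using b t by auto
    have "r (x \<ominus>\<^bsub>G\<^esub> b \<odot>\<^bsub>G\<^esub> t) = r x \<ominus>\<^bsub>?P\<^esub> r (b \<odot>\<^bsub>G\<^esub> t)"
      by (rule mod_hom_minus[OF r_hom G(1) P.right_module_axioms x bt])
    also have "\<dots> = \<zero>\<^bsub>?P\<^esub>" using rbt[OF b(1)] b(2) r[OF x] by (simp add: a_minus_def P.M.r_neg del: principal_simps)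
    finally have "x \<ominus>\<^bsub>G\<^esub> b \<odot>\<^bsub>G\<^esub> t \<in> K" using x bt by (simp add: K_def)
    moreover have "x = b \<odot>\<^bsub>G\<^esub> t \<oplus>\<^bsub>G\<^esub> (x \<ominus>\<^bsub>G\<^esub> b \<odot>\<^bsub>G\<^esub> t)"
      using x bt by (simp add: a_minus_def G.M.a_lcomm[of _ x] G.M.r_neg)
    ultimately show "x \<in> X <+>\<^bsub>G\<^esub> K" using b by (auto simp: set_add_def' X_def)
  qed (use t(1) in \<open>auto simp: set_add_def' X_def K_def\<close>)
  moreover have "X \<inter> K = {\<zero>\<^bsub>G\<^esub>}"
  proof (intro equalityI subsetI)
    fix x assume "x \<in> X \<inter> K"
    then obtain b where b: "b \<in> carrier B" "x = b \<odot>\<^bsub>G\<^esub> t" "r x = \<zero>\<^bsub>?P\<^esub>" by (auto simp: X_def K_def)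
    then have "?g \<bullet> b = \<zero>\<^bsub>B\<^esub>" using rbt by simp
    moreover have "u x = (?g \<bullet> b) \<odot>\<^bsub>F n\<^esub> y"
      unfolding b(2) mod_homD(3)[OF u(1) b(1) t(1)] y(2) by (rule F.rsmult_assoc[symmetric, OF g b(1) y(1)])
    ultimately have "u x = u \<zero>\<^bsub>G\<^esub>"
      using mod_hom_zero[OF u(1) G(1) F.right_module_axioms] y(1) F.smult_zero_left by metis
    then show "x \<in> {\<zero>\<^bsub>G\<^esub>}" using u(2) b t(1) by (auto simp: inj_on_def)
  next
    fix x assume "x \<in> {\<zero>\<^bsub>G\<^esub>}"
    then show "x \<in> X \<inter> K" using submoduleD(2)[OF subX] submoduleD(2)[OF subK] by blast
  qed
  ultimately have "X = {\<zero>\<^bsub>G\<^esub>} \<or> K = {\<zero>\<^bsub>G\<^esub>}"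
    using G(2) subX subK unfolding indecomposable_def by blast
  moreover have "X \<noteq> {\<zero>\<^bsub>G\<^esub>}"
  proof
    assume "X = {\<zero>\<^bsub>G\<^esub>}"
    moreover have "t \<in> X" using t(1) by (auto simp: X_def intro!: exI[of _ "\<one>\<^bsub>B\<^esub>"])
    ultimately have "t = \<zero>\<^bsub>G\<^esub>" by blast
    then show False using s(3) \<phi>_hom(4)[OF t(1)] t(2) by metis
  qed
  ultimately have K: "K = {\<zero>\<^bsub>G\<^esub>}" by blast
  have "inj_on r (carrier G)"
    by (rule mod_hom_inj[OF r_hom G(1) P.right_module_axioms]) (use K in \<open>auto simp: K_def\<close>)
  moreover have "carrier ?P \<subseteq> r ` carrier G"
  proof
    fix x assume "x \<in> carrier ?P"
    then obtain b where b: "b \<in> carrier B" "x = [?g \<bullet> b]" by auto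
    then have "x = r (b \<odot>\<^bsub>G\<^esub> t)" "b \<odot>\<^bsub>G\<^esub> t \<in> carrier G" using rbt t(1) by auto
    then show "x \<in> r ` carrier G" by blast
  qed
  ultimately have iso: "mod_iso B G ?P"
    unfolding mod_iso_def bij_betw_def using r_hom r by (intro bexI[of _ r]) auto
  have not_rad: "t \<noteq> ar a \<odot>\<^bsub>G\<^esub> m" if "\<tau> = Inr a" "m \<in> carrier G" for a m
  proof
    assume "t = ar a \<odot>\<^bsub>G\<^esub> m"
    then have "s = act a (\<phi> m)" using \<phi>_hom(3)[OF that(2), of a] s(1) that(1) t(2) by auto
    then show False using s(5)[OF that(1)] \<phi>M[OF that(2)] by blast
  qed
  show ?thesis using s(1) t(1) y iso not_rad by blast
qed

section \<open>From exact complexes of projectives to cycles of relations\<close>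

definition on_cycle :: "'e \<Rightarrow> bool" where
  "on_cycle a \<longleftrightarrow> (\<exists>es. full_relation_cycle Q I es \<and> a \<in> set es)"

lemma arrow_list_in_paths:
  assumes "es \<noteq> []" "set es \<subseteq> arcs Q" "\<And>i. Suc i < length es \<Longrightarrow> head Q (es ! i) = tail Q (es ! Suc i)"
  shows "(tail Q (hd es), es) \<in> paths Q"
  using assms
proof (induction es)
  case (Cons a es)
  show ?case
  proof (cases "es = []")
    case True
    then show ?thesis using Cons.prems by (simp add: Cons_in_paths Nil_in_paths)
  next
    case False
    have "(tail Q (hd es), es) \<in> paths Q"
      using False Cons.prems(2) Cons.prems(3)[of "Suc i" for i] by (intro Cons.IH) auto
    moreover have "tail Q (hd es) = head Q a" using Cons.prems(3)[of 0] False by (cases es) auto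
    ultimately show ?thesis using Cons.prems(2) by (simp add: Cons_in_paths)
  qed
qed simp

lemma full_relation_cycleI:
  assumes "es \<noteq> []" "distinct es" "\<And>i. i < length es \<Longrightarrow> rel (es ! i) (es ! (Suc i mod length es))"
  shows "full_relation_cycle Q I es"
proof -
  have sub: "set es \<subseteq> arcs Q" using assms(3) rel_in_arcs(1) by (fastforce simp: in_set_conv_nth)
  have "head Q (es ! i) = tail Q (es ! Suc i)" if "Suc i < length es" for i
    using rel_in_arcs(3)[OF assms(3)[of i]] that by simp
  then have "(tail Q (hd es), es) \<in> paths Q" using arrow_list_in_paths assms(1) sub by blast
  moreover have "head Q (last es) = tail Q (hd es)"
    using rel_in_arcs(3)[OF assms(3)[of "length es - 1"]] assms(1)
    by (simp add: last_conv_nth hd_conv_nth)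
  ultimately show ?thesis using assms by (simp add: full_relation_cycle_def ptarget_code)
qed

text \<open>A chain in a finite set repeats. Since an arrow determines its successor under
  \<open>rel\<close>, a repetition \<open>\<alpha> i = \<alpha> j\<close> can be shifted down to
  index \<open>0\<close>.\<close>

lemma backward_chain_on_cycle:
  assumes chain: "\<And>n. rel (\<alpha> (Suc n)) (\<alpha> n)"
  shows "on_cycle (\<alpha> 0)"
proof -
  have shift: "\<alpha> i = \<alpha> j \<Longrightarrow> i \<le> j \<Longrightarrow> \<alpha> 0 = \<alpha> (j - i)" for i j
  proof (induction i arbitrary: j)
    case (Suc i)
    then obtain k where k: "j = Suc k" by (cases j) auto
    have "\<alpha> i = \<alpha> k" using rel_unique_post[of "\<alpha> (Suc i)"] chain[of i] chain[of k] Suc.prems k by metis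
    then show ?case using Suc k by simp
  qed simp
  have "\<not> inj \<alpha>"
  proof
    assume "inj \<alpha>"
    moreover have "range \<alpha> \<subseteq> arcs Q" using chain rel_in_arcs(2) by blast
    ultimately show False using finite_subset finite_arcs range_inj_infinite by blast
  qed
  then obtain i j where "\<alpha> i = \<alpha> j" "i < j" by (metis injI linorder_neqE_nat)
  then have ex: "0 < j - i \<and> \<alpha> (j - i) = \<alpha> 0" using shift[of i j] by simp
  \<comment> \<open>The least period, so that the arrows of the cycle are pairwise distinct.\<close>
  define m where "m = (LEAST k. 0 < k \<and> \<alpha> k = \<alpha> 0)"
  have m: "0 < m" "\<alpha> m = \<alpha> 0" using LeastI[of "\<lambda>k. 0 < k \<and> \<alpha> k = \<alpha> 0", OF ex] by (simp_all add: m_def)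
  have m_least: "\<alpha> k \<noteq> \<alpha> 0" if "0 < k" "k < m" for k
    using not_less_Least[of k "\<lambda>k. 0 < k \<and> \<alpha> k = \<alpha> 0"] that by (simp add: m_def)
  have inj: "inj_on \<alpha> {..<m}"
  proof (rule linorder_inj_onI)
    fix i j assume "i < j" "i \<in> {..<m}" "j \<in> {..<m}"
    then have "0 < j - i" "j - i < m" "i \<le> j" by auto
    then show "\<alpha> i \<noteq> \<alpha> j" using shift[of i j] m_least[of "j - i"] by metis
  qed auto
  \<comment> \<open>The chain runs against the direction of paths, hence the reversal.\<close>
  define es where "es = rev (map \<alpha> [0..<m])"
  have nth: "es ! i = \<alpha> (m - Suc i)" if "i < m" for i using that by (simp add: es_def rev_nth)
  have "full_relation_cycle Q I es"
  proof (rule full_relation_cycleI)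
    show "es \<noteq> []" "distinct es" using m(1) inj by (auto simp: es_def distinct_map atLeast0LessThan)
    fix i assume "i < length es"
    then have i: "i < m" by (simp add: es_def)
    have len: "length es = m" by (simp add: es_def)
    show "rel (es ! i) (es ! (Suc i mod length es))"
    proof (cases "Suc i = m")
      case True
      then have "m - Suc 0 = i" by simp
      then show ?thesis using nth[of i] nth[of 0] m(1,2) chain[of i] len True by simp
    next
      case False
      then have "es ! i = \<alpha> (Suc (m - Suc (Suc i)))" "es ! (Suc i mod length es) = \<alpha> (m - Suc (Suc i))"
        using i nth[of i] nth[of "Suc i"] len by (simp_all add: Suc_diff_Suc)
      then show ?thesis using chain by simp
    qed
  qed
  moreover have "\<alpha> 0 \<in> set es" using m(1) by (auto simp: es_def)
  ultimately show ?thesis unfolding on_cycle_def by blast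
qed

text \<open>The property passed along is that some \<open>y b\<close> lies in the kernel
  \<open>K\<close> of the differential but not in \<open>K b\<close>. Applying the differential to
  \<open>y\<close>, cut down to the tail of \<open>b\<close>, gives a nonzero element killed by
  \<open>b\<close>. It is a multiple of an arrow \<open>c\<close> with \<open>rel c b\<close> and
  has the same property one degree further.\<close>

lemma exact_complex_chain:
  fixes P :: "nat \<Rightarrow> ((('v, 'e) path \<Rightarrow>\<^sub>0 'k) set, (('v, 'e) path \<Rightarrow>\<^sub>0 'k) set list) module"
  assumes P: "\<And>i. projective B (P i)" and d: "\<And>i. d i \<in> mod_hom B (P i) (P (Suc i))"
    and exact: "\<And>i. d i ` carrier (P i) = {x \<in> carrier (P (Suc i)). d (Suc i) x = \<zero>\<^bsub>P (Suc (Suc i))\<^esub>}"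
    and y: "y \<in> carrier (P 0)" "d 0 (ar a \<odot>\<^bsub>P 0\<^esub> y) = \<zero>\<^bsub>P 1\<^esub>" and a: "a \<in> arcs Q"
    and m: "\<And>m. m \<in> carrier (P 0) \<Longrightarrow> d 0 m = \<zero>\<^bsub>P 1\<^esub> \<Longrightarrow> ar a \<odot>\<^bsub>P 0\<^esub> y \<noteq> ar a \<odot>\<^bsub>P 0\<^esub> m"
  shows "on_cycle a"
proof -
  define stage where "stage i b \<longleftrightarrow> b \<in> arcs Q \<and> (\<exists>y\<in>carrier (P i). d i (ar b \<odot>\<^bsub>P i\<^esub> y) = \<zero>\<^bsub>P (Suc i)\<^esub> \<and>
     (\<forall>m\<in>carrier (P i). d i m = \<zero>\<^bsub>P (Suc i)\<^esub> \<longrightarrow> ar b \<odot>\<^bsub>P i\<^esub> y \<noteq> ar b \<odot>\<^bsub>P i\<^esub> m))" for i b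
  have rm: "right_module B (P i)" for i using P[of i] by (simp add: projective_def fg_modules_def)
  have step: "\<exists>c. stage (Suc i) c \<and> rel c b" if st: "stage i b" for i b
  proof -
    interpret Pi: right_module B "P i" by (rule rm)
    interpret Ps: right_module B "P (Suc i)" by (rule rm)
    interpret Pss: right_module B "P (Suc (Suc i))" by (rule rm)
    have b: "b \<in> arcs Q" using st by (simp add: stage_def)
    obtain y where y: "y \<in> carrier (P i)" "d i (ar b \<odot>\<^bsub>P i\<^esub> y) = \<zero>\<^bsub>P (Suc i)\<^esub>"
      "\<And>m. m \<in> carrier (P i) \<Longrightarrow> d i m = \<zero>\<^bsub>P (Suc i)\<^esub> \<Longrightarrow> ar b \<odot>\<^bsub>P i\<^esub> y \<noteq> ar b \<odot>\<^bsub>P i\<^esub> m"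
      using st by (auto simp: stage_def)
    let ?e = "ce (tail Q b) 1"
    have e: "?e \<in> carrier B" using b by auto
    have ab: "ar b \<in> carrier B" using b by auto
    \<comment> \<open>Cutting \<open>y\<close> down to the tail of \<open>b\<close> leaves
      \<open>y b\<close> unchanged and makes \<open>d i z\<close> meet the hypotheses of
      \<open>projective_kernel\<close>.\<close>
    define z where "z = ?e \<odot>\<^bsub>P i\<^esub> y"
    have z: "z \<in> carrier (P i)" using y e by (simp add: z_def)
    have bz: "ar b \<odot>\<^bsub>P i\<^esub> z = ar b \<odot>\<^bsub>P i\<^esub> y"
      using Pi.rsmult_assoc[OF e ab y(1)] by (simp add: z_def ce_mult_ar[OF b])
    have ee: "?e \<bullet> ?e = ?e" using b by (intro ce_idem) auto
    have ez: "?e \<odot>\<^bsub>P i\<^esub> z = z"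
      using Pi.rsmult_assoc[OF e e y(1)] by (simp add: z_def ee)
    define x where "x = d i z"
    have x: "x \<in> carrier (P (Suc i))" using mod_homD(1)[OF d z] by (simp add: x_def)
    have "?e \<odot>\<^bsub>P (Suc i)\<^esub> x = x" using mod_homD(3)[OF d e z] ez by (simp add: x_def)
    moreover have "ar b \<odot>\<^bsub>P (Suc i)\<^esub> x = \<zero>\<^bsub>P (Suc i)\<^esub>"
      using mod_homD(3)[OF d ab z] bz y(2) by (simp add: x_def)
    moreover have "x \<noteq> \<zero>\<^bsub>P (Suc i)\<^esub>" using y(3)[OF z] bz by (auto simp: x_def)
    ultimately obtain c w where c: "rel c b" "w \<in> carrier (P (Suc i))" "x = ar c \<odot>\<^bsub>P (Suc i)\<^esub> w"
      using projective_kernel[OF P x b] by blast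
    have ca: "c \<in> arcs Q" "ar c \<in> carrier B" using rel_in_arcs c(1) by auto
    have "d (Suc i) x = \<zero>\<^bsub>P (Suc (Suc i))\<^esub>" using exact[of i] z by (auto simp: x_def)
    moreover have "x \<noteq> ar c \<odot>\<^bsub>P (Suc i)\<^esub> m"
      if m: "m \<in> carrier (P (Suc i))" "d (Suc i) m = \<zero>\<^bsub>P (Suc (Suc i))\<^esub>" for m
    proof
      assume xm: "x = ar c \<odot>\<^bsub>P (Suc i)\<^esub> m"
      \<comment> \<open>By exactness \<open>m\<close> is some \<open>d i n\<close>. Then
        \<open>z - n c\<close> lies in the kernel of \<open>d i\<close>, and its product with
        \<open>b\<close> is still \<open>y b\<close> since \<open>c\<close> followed by
        \<open>b\<close> is zero; this contradicts the choice of \<open>y\<close>.\<close>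
      have "m \<in> d i ` carrier (P i)" using m exact[of i] by blast
      then obtain n where n: "n \<in> carrier (P i)" "m = d i n" by blast
      have cn: "ar c \<odot>\<^bsub>P i\<^esub> n \<in> carrier (P i)" using ca n by auto
      have "d i (z \<ominus>\<^bsub>P i\<^esub> ar c \<odot>\<^bsub>P i\<^esub> n) = x \<ominus>\<^bsub>P (Suc i)\<^esub> ar c \<odot>\<^bsub>P (Suc i)\<^esub> m"
        unfolding mod_hom_minus[OF d rm rm z cn] mod_homD(3)[OF d ca(2) n(1)] x_def n(2) ..
      also have "\<dots> = \<zero>\<^bsub>P (Suc i)\<^esub>" unfolding xm[symmetric] using x by (simp add: a_minus_def Ps.M.r_neg)
      finally have "ar b \<odot>\<^bsub>P i\<^esub> y \<noteq> ar b \<odot>\<^bsub>P i\<^esub> (z \<ominus>\<^bsub>P i\<^esub> ar c \<odot>\<^bsub>P i\<^esub> n)"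
        using z cn by (intro y(3)) auto
      moreover have "ar b \<odot>\<^bsub>P i\<^esub> (ar c \<odot>\<^bsub>P i\<^esub> n) = \<zero>\<^bsub>P i\<^esub>"
        using Pi.rsmult_assoc[OF ca(2) ab n(1)] ar_mult_ar[OF c(1)] n(1) by simp
      then have "ar b \<odot>\<^bsub>P i\<^esub> (z \<ominus>\<^bsub>P i\<^esub> ar c \<odot>\<^bsub>P i\<^esub> n) = ar b \<odot>\<^bsub>P i\<^esub> y"
        using Pi.smult_minus[OF ab z cn] bz ab y(1) by (simp add: a_minus_def)
      ultimately show False by simp
    qed
    ultimately have "stage (Suc i) c" using c ca unfolding stage_def by metis
    then show ?thesis using c(1) by blast
  qed
  have s0: "stage 0 a" using y m a unfolding stage_def by (metis One_nat_def)
  have "\<exists>\<alpha>. \<forall>n. (stage n (\<alpha> n) \<and> (n = 0 \<longrightarrow> \<alpha> n = a)) \<and> rel (\<alpha> (Suc n)) (\<alpha> n)"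
    by (rule dependent_nat_choice[of "\<lambda>n b. stage n b \<and> (n = 0 \<longrightarrow> b = a)" "\<lambda>n b c. rel c b"])
      (use s0 step in auto)
  then obtain \<alpha> where \<alpha>: "\<alpha> 0 = a" "\<And>n. rel (\<alpha> (Suc n)) (\<alpha> n)" by blast
  then show ?thesis using backward_chain_on_cycle[of \<alpha>] by simp
qed

text \<open>As a kernel in a complex of projectives, \<open>G\<close> embeds in a free module, so it
  is isomorphic to \<open>e_v B\<close> or \<open>a B\<close>. The former is projective and hence
  excluded; for the latter, the half of the complex from degree \<open>0\<close> onwards provides
  the chain of relations.\<close>

lemma gproj_classification:
  assumes G: "gorenstein_projective B G" "indecomposable B G" "\<not> projective B G"
  shows "\<exists>a. on_cycle a \<and> mod_iso B G (principal B (ar a))"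
proof -
  obtain P d where tot: "totally_acyclic B P d"
    and iso: "mod_iso B G ((P 0)\<lparr>carrier := d (-1) ` carrier (P (-1))\<rparr>)"
    and fg: "G \<in> fg_modules B"
    using G(1) by (auto simp: gorenstein_projective_def)
  have P: "projective B (P i)" and d: "d i \<in> mod_hom B (P i) (P (i + 1))"
    and exact: "d (i - 1) ` carrier (P (i - 1)) = {x \<in> carrier (P i). d i x = \<zero>\<^bsub>P (i + 1)\<^esub>}" for i
    using tot by (auto simp: totally_acyclic_def)
  have rmG: "right_module B G" using fg by (simp add: fg_modules_def)
  have rmP: "right_module B (P i)" for i using P[of i] by (simp add: projective_def fg_modules_def)
  let ?M = "{x \<in> carrier (P 0). d 0 x = \<zero>\<^bsub>P 1\<^esub>}"
  have im: "d (-1) ` carrier (P (-1)) = ?M" using exact[of 0] by simp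
  obtain f where f: "f \<in> mod_hom B G ((P 0)\<lparr>carrier := ?M\<rparr>)" "bij_betw f (carrier G) ?M"
    using iso by (auto simp: mod_iso_def im)
  have f_in: "f x \<in> ?M" if "x \<in> carrier G" for x using mod_homD(1)[OF f(1) that] by simp
  have f_hom: "f \<in> mod_hom B G (P 0)"
    by (rule mod_homI) (use mod_homD[OF f(1)] f_in in auto)
  obtain n g h where gh: "g \<in> mod_hom B (F n) (P 0)" "h \<in> mod_hom B (P 0) (F n)"
    "\<And>x. x \<in> carrier (P 0) \<Longrightarrow> g (h x) = x" using projective_summand[OF P] by metis
  define u where "u x = h (f x)" for x
  have u: "u \<in> mod_hom B G (F n)" unfolding u_def by (rule mod_hom_comp[OF f_hom gh(2)])
  have f_inj: "x = y" if "x \<in> carrier G" "y \<in> carrier G" "f x = f y" for x y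
    using f(2) that by (auto simp: bij_betw_def inj_on_def)
  have gu: "g (u x) = f x" if "x \<in> carrier G" for x using gh(3) f_in[OF that] by (simp add: u_def)
  have "inj_on u (carrier G)" by (rule inj_onI) (metis f_inj gu)
  then obtain \<tau> t y where t: "\<tau> \<in> tags" "t \<in> carrier G" "y \<in> carrier (F n)" "u t = gelem \<tau> \<odot>\<^bsub>F n\<^esub> y"
    "\<And>a m. \<tau> = Inr a \<Longrightarrow> m \<in> carrier G \<Longrightarrow> t \<noteq> ar a \<odot>\<^bsub>G\<^esub> m"
    "mod_iso B G (principal B (gelem \<tau>))"
    using torsionless_indecomposable[OF rmG G(2) u] by metis
  show ?thesis
  proof (cases \<tau>)
    case (Inl v)
    have v: "v \<in> verts Q" using t(1) Inl by simp
    have "projective B (principal B (ce v 1))"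
      by (rule B.principal_idempotent_projective[OF ce_carrier[OF v] ce_idem[OF v]])
    moreover have "mod_iso B (principal B (ce v 1)) G"
      using mod_iso_sym[OF t(6) rmG] by (simp add: Inl gelem_def)
    ultimately show ?thesis using projective_iso fg G(3) by blast
  next
    case (Inr a)
    have a: "a \<in> arcs Q" using t(1) Inr by simp
    have ft: "f t = ar a \<odot>\<^bsub>P 0\<^esub> g y"
      using gu[OF t(2)] t(4) mod_homD(3)[OF gh(1) ar_carrier[OF a] t(3)] by (simp add: Inr gelem_def)
    have "on_cycle a"
    proof (rule exact_complex_chain[of "\<lambda>i. P (int i)" "\<lambda>i. d (int i)" "g y" a])
      show "projective B (P (int i))" for i by (rule P)
      show "d (int i) \<in> mod_hom B (P (int i)) (P (int (Suc i)))" for i using d[of "int i"] by (simp add: add.commute)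
      show "d (int i) ` carrier (P (int i)) = {x \<in> carrier (P (int (Suc i))). d (int (Suc i)) x = \<zero>\<^bsub>P (int (Suc (Suc i)))\<^esub>}" for i
        using exact[of "int i + 1"] by (simp add: add.commute)
      show "g y \<in> carrier (P (int 0))" using mod_homD(1)[OF gh(1) t(3)] by simp
      show "d (int 0) (ar a \<odot>\<^bsub>P (int 0)\<^esub> g y) = \<zero>\<^bsub>P (int 1)\<^esub>" using f_in[OF t(2)] ft by simp
      fix m assume "m \<in> carrier (P (int 0))" "d (int 0) m = \<zero>\<^bsub>P (int 1)\<^esub>"
      \<comment> \<open>Kernel elements are values of \<open>f\<close>, so non-divisibility of
        \<open>t\<close> in \<open>G\<close> becomes non-divisibility of \<open>f t\<close> within
        the kernel.\<close>
      then have "m \<in> f ` carrier G" using f(2) by (auto simp: bij_betw_def)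
      then obtain m' where m': "m' \<in> carrier G" "m = f m'" by blast
      have "f t \<noteq> f (ar a \<odot>\<^bsub>G\<^esub> m')"
        using t(5)[OF Inr m'(1)] f_inj[OF t(2)] right_module.rsmult_closed[OF rmG ar_carrier[OF a] m'(1)] by blast
      then show "ar a \<odot>\<^bsub>P (int 0)\<^esub> g y \<noteq> ar a \<odot>\<^bsub>P (int 0)\<^esub> m"
        using ft mod_homD(3)[OF f_hom ar_carrier[OF a] m'(1)] m'(2) by simp
    qed (rule a)
    then show ?thesis using t(6) by (auto simp: Inr gelem_def)
  qed
qed

end


section \<open>The modules generated by arrows on cycles with full relations\<close>

context gentle
begin

text \<open>As in \<open>act_kernel\<close>, a path in the support that could be prolonged by
  \<open>a\<close> would survive in the product. This gives exactness of the dual of the cycle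
  complex, and \<open>left_kernel\<close> exactness of the complex itself.\<close>

lemma right_kernel:
  assumes "rel b a" and r: "r \<in> carrier B" "r \<bullet> ce (tail Q a) 1 = r" "r \<bullet> ar a = \<zero>\<^bsub>B\<^esub>"
  obtains s where "s \<in> carrier B" "r = s \<bullet> ar b"
proof -
  have ab: "a \<in> arcs Q" "b \<in> arcs Q" using rel_in_arcs assms(1) by auto
  have "snd p \<noteq> [] \<and> last (snd p) = b" if p: "cf r p \<noteq> 0" for p
  proof -
    obtain u es where [simp]: "p = (u, es)" by (cases p)
    have "p \<in> gp" using p cf_outside by blast
    moreover have "cf (r \<bullet> ce (tail Q a) 1) p \<noteq> 0" using p r(2) by simp
    then have "ptarget Q p = tail Q a" using r(1) ab by (simp add: cf_mult_ce split: if_splits)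
    moreover have "(u, es @ [a]) \<notin> gp"
    proof
      assume g: "(u, es @ [a]) \<in> gp"
      have "cf (r \<bullet> ar a) (u, es @ [a]) = 0" using r(3) by simp
      then show False using g p by (simp add: cf_mult_ar[OF r(1) ab(1)])
    qed
    ultimately have "es \<noteq> [] \<and> rel (last es) a" using ab by (auto simp: gp_snoc)
    then show ?thesis using rel_unique_pre assms(1) by auto
  qed
  then show ?thesis using right_factor[OF r(1) ab(2)] that by blast
qed

lemma left_kernel:
  assumes "rel b a" and r: "r \<in> carrier B" "ce (head Q b) 1 \<bullet> r = r" "ar b \<bullet> r = \<zero>\<^bsub>B\<^esub>"
  obtains s where "s \<in> carrier B" "r = ar a \<bullet> s"
proof -
  have ab: "a \<in> arcs Q" "b \<in> arcs Q" using rel_in_arcs assms(1) by auto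
  have "snd p \<noteq> [] \<and> hd (snd p) = a" if p: "cf r p \<noteq> 0" for p
  proof -
    obtain u es where [simp]: "p = (u, es)" by (cases p)
    have "p \<in> gp" using p cf_outside by blast
    moreover have "cf (ce (head Q b) 1 \<bullet> r) p \<noteq> 0" using p r(2) by simp
    then have u: "u = head Q b" using r(1) ab by (simp add: cf_ce_mult psource_def split: if_splits)
    moreover have "(tail Q b, b # es) \<notin> gp"
    proof
      assume g: "(tail Q b, b # es) \<in> gp"
      have "cf (ar b \<bullet> r) (tail Q b, b # es) = 0" using r(3) by simp
      then show False using g p u by (simp add: cf_ar_mult[OF r(1) ab(2)])
    qed
    ultimately have "es \<noteq> [] \<and> rel b (hd es)" using ab by (auto simp: gp_Cons)
    then show ?thesis using rel_unique_post assms(1) by auto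
  qed
  then show ?thesis using left_factor[OF r(1) ab(1)] that by blast
qed

lemma mem_principal_ce:
  assumes "v \<in> verts Q"
  shows "x \<in> carrier (principal B (ce v 1)) \<longleftrightarrow> (\<exists>r\<in>carrier B. ce v 1 \<bullet> r = r \<and> x = [r])"
proof
  assume "x \<in> carrier (principal B (ce v 1))"
  then obtain r where r: "r \<in> carrier B" "x = [ce v 1 \<bullet> r]" by auto
  then show "\<exists>r\<in>carrier B. ce v 1 \<bullet> r = r \<and> x = [r]"
    using assms by (intro bexI[of _ "ce v 1 \<bullet> r"]) (auto simp: B.m_assoc[symmetric] ce_idem)
qed auto

text \<open>Growing indices run backwards along the cycle because the differentials are left
  multiplications. The arrow \<open>a\<close> sits at index \<open>-1\<close>, so that it gives the
  differential whose image represents the module.\<close>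

lemma on_cycle_chain:
  assumes "on_cycle a"
  obtains \<beta> :: "int \<Rightarrow> 'e" where "\<beta> (- 1) = a" "\<And>i. rel (\<beta> (i + 1)) (\<beta> i)"
proof -
  obtain es where es: "full_relation_cycle Q I es" "a \<in> set es" using assms by (auto simp: on_cycle_def)
  obtain k where k: "k < length es" "es ! k = a" using es(2) by (auto simp: in_set_conv_nth)
  let ?n = "int (length es)"
  have n: "?n > 0" using k by (cases es) auto
  \<comment> \<open>Integer \<open>mod\<close> stays in range for negative arguments, so one formula
    serves the whole bi-infinite sequence.\<close>
  define \<beta> where "\<beta> i = es ! nat ((int k - 1 - i) mod ?n)" for i
  have "rel (\<beta> (i + 1)) (\<beta> i)" for i
  proof -
    let ?x = "int k - 1 - (i + 1)"
    let ?j = "nat (?x mod ?n)"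
    have j: "int ?j = ?x mod ?n" using n by simp
    have "?j < length es" using n by (simp add: nat_less_iff)
    then have "rel (es ! ?j) (es ! (Suc ?j mod length es))" using es(1) by (simp add: full_relation_cycle_def)
    moreover have "int (Suc ?j mod length es) = (1 + ?x mod ?n) mod ?n"
      unfolding zmod_int using j by simp
    then have "int (Suc ?j mod length es) = (int k - 1 - i) mod ?n"
      unfolding mod_add_right_eq by (simp add: algebra_simps)
    then have "Suc ?j mod length es = nat ((int k - 1 - i) mod ?n)" by (metis nat_int)
    ultimately show ?thesis by (simp add: \<beta>_def)
  qed
  moreover have "\<beta> (- 1) = a" using k by (simp add: \<beta>_def)
  ultimately show ?thesis using that by blast
qed

text \<open>A homomorphism from \<open>e B\<close> to \<open>B\<close> is left multiplication by the
  image of \<open>e\<close>, so both exactness conditions become kernel computations in the algebra.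
  Consecutive modules match since the tail of \<open>\<beta> i\<close> is the head of
  \<open>\<beta> (i + 1)\<close>.\<close>

lemma cycle_complex_totally_acyclic:
  fixes \<beta> :: "int \<Rightarrow> 'e"
  assumes \<beta>: "\<And>i. rel (\<beta> (i + 1)) (\<beta> i)"
  shows "totally_acyclic B (\<lambda>i. principal B (ce (head Q (\<beta> i)) 1)) (\<lambda>i x. [ar (\<beta> i) \<bullet> hd x])"
    (is "totally_acyclic B ?P ?d")
proof -
  have arc: "\<beta> i \<in> arcs Q" for i using \<beta>[of i] rel_in_arcs by blast
  have ht: "head Q (\<beta> (i + 1)) = tail Q (\<beta> i)" for i using \<beta>[of i] rel_in_arcs by blast
  have v: "head Q (\<beta> i) \<in> verts Q" for i using arc by auto
  have mem: "x \<in> carrier (?P i) \<longleftrightarrow> (\<exists>r\<in>carrier B. ce (head Q (\<beta> i)) 1 \<bullet> r = r \<and> x = [r])" for x i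
    by (rule mem_principal_ce[OF v])
  have rm: "right_module B (?P i)" for i by (intro B.right_module_principal ce_carrier v)
  have proj: "projective B (?P i)" for i
    by (intro B.principal_idempotent_projective ce_carrier v ce_idem)
  have d_in: "?d i x \<in> carrier (?P (i + 1))" if x: "x \<in> carrier (?P i)" for i x
  proof -
    obtain r where r: "r \<in> carrier B" "x = [r]" using x mem by blast
    have "ce (tail Q (\<beta> i)) 1 \<bullet> (ar (\<beta> i) \<bullet> r) = ar (\<beta> i) \<bullet> r"
      using r(1) arc[of i] by (simp add: B.m_assoc[symmetric] ce_mult_ar)
    then show ?thesis unfolding mem using r arc[of i] by (simp add: ht)
  qed
  have d: "?d i \<in> mod_hom B (?P i) (?P (i + 1))" for i
  proof (rule mod_homI)
    show "?d i (r \<odot>\<^bsub>?P i\<^esub> x) = r \<odot>\<^bsub>?P (i + 1)\<^esub> ?d i x" if "r \<in> carrier B" "x \<in> carrier (?P i)" for r x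
      using that arc[of i] unfolding mem by (auto simp: B.m_assoc)
    show "?d i (x \<oplus>\<^bsub>?P i\<^esub> y) = ?d i x \<oplus>\<^bsub>?P (i + 1)\<^esub> ?d i y" if "x \<in> carrier (?P i)" "y \<in> carrier (?P i)" for x y
      using that arc[of i] unfolding mem by (auto simp: B.r_distr)
  qed (rule d_in)
  have exact: "?d (i - 1) ` carrier (?P (i - 1)) = {x \<in> carrier (?P i). ?d i x = \<zero>\<^bsub>?P (i + 1)\<^esub>}" for i
  proof (intro equalityI subsetI)
    have rl: "rel (\<beta> i) (\<beta> (i - 1))" using \<beta>[of "i - 1"] by simp
    fix x assume "x \<in> ?d (i - 1) ` carrier (?P (i - 1))"
    then obtain y where y: "y \<in> carrier (?P (i - 1))" "x = ?d (i - 1) y" by blast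
    then obtain r where r: "r \<in> carrier B" "y = [r]" using mem by blast
    have "x \<in> carrier (?P i)" using d_in[OF y(1)] y(2) by simp
    moreover have "?d i x = \<zero>\<^bsub>?P (i + 1)\<^esub>"
      using r y(2) arc[of i] arc[of "i - 1"] by (simp add: B.m_assoc[symmetric] ar_mult_ar[OF rl])
    ultimately show "x \<in> {x \<in> carrier (?P i). ?d i x = \<zero>\<^bsub>?P (i + 1)\<^esub>}" by blast
  next
    have rl: "rel (\<beta> i) (\<beta> (i - 1))" using \<beta>[of "i - 1"] by simp
    fix x assume "x \<in> {x \<in> carrier (?P i). ?d i x = \<zero>\<^bsub>?P (i + 1)\<^esub>}"
    then obtain r where r: "r \<in> carrier B" "ce (head Q (\<beta> i)) 1 \<bullet> r = r" "x = [r]"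
      "ar (\<beta> i) \<bullet> r = \<zero>\<^bsub>B\<^esub>" unfolding mem by auto
    obtain s where s: "s \<in> carrier B" "r = ar (\<beta> (i - 1)) \<bullet> s" by (rule left_kernel[OF rl r(1,2,4)])
    let ?e = "ce (head Q (\<beta> (i - 1))) 1"
    have "x = ?d (i - 1) [?e \<bullet> s]"
      using s r(3) arc[of "i - 1"] v[of "i - 1"] by (simp add: B.m_assoc[symmetric] ar_mult_ce)
    moreover have "[?e \<bullet> s] \<in> carrier (?P (i - 1))" using s by auto
    ultimately show "x \<in> ?d (i - 1) ` carrier (?P (i - 1))" by blast
  qed
  have hom_exact: "{f \<in> mod_hom B (?P i) (regular_module B).
             \<forall>x\<in>carrier (?P (i - 1)). f (?d (i - 1) x) = \<zero>\<^bsub>B\<^esub>} =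
          {f \<in> mod_hom B (?P i) (regular_module B).
             \<exists>g\<in>mod_hom B (?P (i + 1)) (regular_module B). \<forall>x\<in>carrier (?P i). f x = g (?d i x)}"
    (is "?L = ?R") for i
  proof (intro equalityI subsetI)
    fix f assume f: "f \<in> ?L"
    then have fh: "f \<in> mod_hom B (?P i) (regular_module B)" by blast
    let ?h = "head Q (\<beta> i)"
    have rl: "rel (\<beta> i) (\<beta> (i - 1))" using \<beta>[of "i - 1"] by simp
    have tl: "tail Q (\<beta> (i - 1)) = ?h" using rel_in_arcs(3)[OF rl] by simp
    have e_in: "[ce ?h 1] \<in> carrier (?P i)" unfolding mem using v ce_idem by auto
    define b where "b = f [ce ?h 1]"
    have b: "b \<in> carrier B" using mod_homD(1)[OF fh e_in] by (simp add: b_def regular_module_def)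
    have f_eq: "f [r] = b \<bullet> r" if "r \<in> carrier B" "ce ?h 1 \<bullet> r = r" for r
      using mod_homD(3)[OF fh that(1) e_in] that(2) by (simp add: b_def regular_module_def)
    have be: "b \<bullet> ce (tail Q (\<beta> (i - 1))) 1 = b"
      using f_eq[of "ce ?h 1"] v ce_idem by (simp add: tl b_def)
    have "[ce (head Q (\<beta> (i - 1))) 1] \<in> carrier (?P (i - 1))" unfolding mem using v ce_idem by auto
    then have "f (?d (i - 1) [ce (head Q (\<beta> (i - 1))) 1]) = \<zero>\<^bsub>B\<^esub>" using f by blast
    then have "f [ar (\<beta> (i - 1))] = \<zero>\<^bsub>B\<^esub>" using arc by (simp add: ar_mult_ce)
    then have "b \<bullet> ar (\<beta> (i - 1)) = \<zero>\<^bsub>B\<^esub>"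
      using f_eq[of "ar (\<beta> (i - 1))"] ce_mult_ar[OF arc[of "i - 1"]] arc by (simp add: tl)
    \<comment> \<open>Left multiplication by \<open>c\<close> is the homomorphism on the next module
      through which \<open>f\<close> factors.\<close>
    then obtain c where c: "c \<in> carrier B" "b = c \<bullet> ar (\<beta> i)" using right_kernel[OF rl b be] by blast
    show "f \<in> ?R"
    proof (intro CollectI conjI fh bexI[of _ "\<lambda>x. c \<bullet> hd x"] ballI)
      fix x assume "x \<in> carrier (?P i)"
      then obtain r where r: "r \<in> carrier B" "ce ?h 1 \<bullet> r = r" "x = [r]" unfolding mem by blast
      show "f x = c \<bullet> hd (?d i x)"
        using f_eq[OF r(1,2)] c r arc[of i] by (simp add: B.m_assoc)
    next
      show "(\<lambda>x. c \<bullet> hd x) \<in> mod_hom B (?P (i + 1)) (regular_module B)"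
      proof (rule mod_homI)
        fix x assume "x \<in> carrier (?P (i + 1))"
        then obtain r where r: "r \<in> carrier B" "x = [r]" unfolding mem by blast
        show "c \<bullet> hd x \<in> carrier (regular_module B)" using c r by (simp add: regular_module_def)
        show "c \<bullet> hd (s \<odot>\<^bsub>?P (i + 1)\<^esub> x) = s \<odot>\<^bsub>regular_module B\<^esub> (c \<bullet> hd x)" if "s \<in> carrier B" for s
          using c r that by (simp add: regular_module_def B.m_assoc)
        fix y assume "y \<in> carrier (?P (i + 1))"
        then obtain s where s: "s \<in> carrier B" "y = [s]" unfolding mem by blast
        show "c \<bullet> hd (x \<oplus>\<^bsub>?P (i + 1)\<^esub> y) = c \<bullet> hd x \<oplus>\<^bsub>regular_module B\<^esub> c \<bullet> hd y"
          using c r s by (simp add: regular_module_def B.r_distr)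
      qed
    qed
  next
    fix f assume f: "f \<in> ?R"
    then obtain g where g: "g \<in> mod_hom B (?P (i + 1)) (regular_module B)"
      "\<And>x. x \<in> carrier (?P i) \<Longrightarrow> f x = g (?d i x)" by blast
    have "g \<zero>\<^bsub>?P (i + 1)\<^esub> = \<zero>\<^bsub>B\<^esub>"
    proof -
      interpret P: right_module B "?P (i + 1)" by (rule rm)
      have "g (\<zero>\<^bsub>B\<^esub> \<odot>\<^bsub>?P (i + 1)\<^esub> \<zero>\<^bsub>?P (i + 1)\<^esub>) = \<zero>\<^bsub>B\<^esub> \<odot>\<^bsub>regular_module B\<^esub> g \<zero>\<^bsub>?P (i + 1)\<^esub>"
        by (intro mod_homD(3)[OF g(1)] B.zero_closed P.M.zero_closed)
      also have "\<dots> = \<zero>\<^bsub>B\<^esub>"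
        using mod_homD(1)[OF g(1) P.M.zero_closed] by (simp add: regular_module_def)
      finally show ?thesis by (simp only: P.smult_zero_right[OF B.zero_closed])
    qed
    then have "f (?d (i - 1) x) = \<zero>\<^bsub>B\<^esub>" if "x \<in> carrier (?P (i - 1))" for x
    proof -
      have "?d (i - 1) x \<in> ?d (i - 1) ` carrier (?P (i - 1))" using that by (rule imageI)
      then have "?d (i - 1) x \<in> carrier (?P i)" "?d i (?d (i - 1) x) = \<zero>\<^bsub>?P (i + 1)\<^esub>"
        unfolding exact[of i] by blast+
      then show ?thesis using g(2) \<open>g \<zero>\<^bsub>?P (i + 1)\<^esub> = \<zero>\<^bsub>B\<^esub>\<close> by (simp del: principal_simps)
    qed
    then show "f \<in> ?L" using f by blast
  qed
  show ?thesis unfolding totally_acyclic_def using proj d exact hom_exact by blast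
qed

lemma principal_ar_gorenstein:
  assumes "on_cycle a"
  shows "gorenstein_projective B (principal B (ar a))"
proof -
  obtain \<beta> :: "int \<Rightarrow> 'e" where \<beta>: "\<beta> (- 1) = a" "\<And>i. rel (\<beta> (i + 1)) (\<beta> i)"
    using on_cycle_chain[OF assms] by blast
  let ?P = "\<lambda>i. principal B (ce (head Q (\<beta> i)) 1)" and ?d = "\<lambda>i x. [ar (\<beta> i) \<bullet> hd x]"
  have a: "a \<in> arcs Q" using \<beta>(2)[of "- 1"] \<beta>(1) rel_in_arcs by auto
  have "carrier (principal B (ar a)) = ?d (-1) ` carrier (?P (-1))"
  proof (intro equalityI subsetI)
    fix x assume "x \<in> carrier (principal B (ar a))"
    then obtain r where r: "r \<in> carrier B" "x = [ar a \<bullet> r]" by auto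
    have "x = ?d (-1) [ce (head Q a) 1 \<bullet> r]"
      using r a by (simp add: \<beta>(1) B.m_assoc[symmetric] ar_mult_ce)
    moreover have "[ce (head Q a) 1 \<bullet> r] \<in> carrier (?P (-1))" using r by (auto simp: \<beta>(1))
    ultimately show "x \<in> ?d (-1) ` carrier (?P (-1))" by blast
  next
    fix x assume "x \<in> ?d (-1) ` carrier (?P (-1))"
    then obtain r where "r \<in> carrier B" "x = [ar a \<bullet> (ce (head Q a) 1 \<bullet> r)]" by (auto simp: \<beta>(1))
    moreover from this have "ce (head Q a) 1 \<bullet> r \<in> carrier B" using a by simp
    ultimately show "x \<in> carrier (principal B (ar a))" unfolding principal_simps by blast
  qed
  then have "mod_iso B (principal B (ar a)) ((?P 0)\<lparr>carrier := ?d (-1) ` carrier (?P (-1))\<rparr>)"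
    unfolding mod_iso_def
    by (intro bexI[of _ "\<lambda>x. x"] mod_homI) (auto simp: bij_betw_def)
  then show ?thesis unfolding gorenstein_projective_def
    using cycle_complex_totally_acyclic[of \<beta>, OF \<beta>(2)] B.principal_fg[OF ar_carrier[OF a]] by blast
qed

text \<open>The module \<open>a B\<close> is local: \<open>a r\<close> is a nonzero scalar multiple
  of \<open>a\<close> plus terms with longer paths, and a nilpotent correction removes those
  terms.\<close>

lemma principal_ar_generator:
  assumes a: "a \<in> arcs Q" and r: "r \<in> carrier B" "cf r (head Q a, []) \<noteq> 0"
  shows "\<exists>s\<in>carrier B. ar a \<bullet> r \<bullet> s = ar a"
proof -
  let ?h = "head Q a"
  let ?e = "ce ?h 1" and ?c = "ce ?h (1 / cf r (?h, []))"
  have h: "?h \<in> verts Q" using a by auto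
  \<comment> \<open>Scaling makes the constant term at the head of \<open>a\<close> equal to
    \<open>1\<close>, and the idempotent removes paths ending elsewhere; hence no trivial path
    occurs in \<open>n\<close>.\<close>
  define q where "q = r \<bullet> ?c"
  define n where "n = ?e \<oplus>\<^bsub>B\<^esub> (\<ominus>\<^bsub>B\<^esub> (?e \<bullet> q))"
  have q: "q \<in> carrier B" using r h by (auto simp: q_def)
  have eq: "?e \<bullet> q \<in> carrier B" using q h by auto
  have n: "n \<in> carrier B" using eq h by (auto simp: n_def)
  have "ar a \<bullet> n = ar a \<oplus>\<^bsub>B\<^esub> (\<ominus>\<^bsub>B\<^esub> (ar a \<bullet> q))"
    using a q h eq by (simp add: n_def B.r_distr B.r_minus B.m_assoc[symmetric] ar_mult_ce)
  then have an: "ar a = ar a \<bullet> q \<oplus>\<^bsub>B\<^esub> ar a \<bullet> n"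
    using a q n by (simp add: B.a_lcomm[of _ "ar a"] B.r_neg)
  have n1: "1 \<le> plength p" if p: "cf n p \<noteq> 0" for p
  proof (rule ccontr)
    assume "\<not> 1 \<le> plength p"
    then obtain v where [simp]: "p = (v, [])" by (cases p; cases "snd p") (auto simp: plength_def)
    have "cf n p = cf ?e p - cf (?e \<bullet> q) p"
      using h eq unfolding n_def by (simp add: cf_add cf_uminus)
    also have "\<dots> = 0"
      using r h q by (auto simp: cf_ce cf_ce_mult q_def cf_mult_ce psource_def ptarget_code)
    finally show False using p by simp
  qed
  \<comment> \<open>\<open>n\<close> is nilpotent, so that iterating \<open>a = a q + a n\<close> gives \<open>a \<in> a q B\<close>\<close>
  have "\<exists>s\<in>carrier B. \<exists>u\<in>carrier B. ar a = ar a \<bullet> q \<bullet> s \<oplus>\<^bsub>B\<^esub> ar a \<bullet> u \<and>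
      (\<forall>p. cf u p \<noteq> 0 \<longrightarrow> k \<le> plength p)" for k
  proof (induction k)
    case 0
    show ?case using a q by (intro bexI[of _ "\<zero>\<^bsub>B\<^esub>"] bexI[of _ "\<one>\<^bsub>B\<^esub>"]) auto
  next
    case (Suc k)
    then obtain s u where su: "s \<in> carrier B" "u \<in> carrier B"
      "ar a = ar a \<bullet> q \<bullet> s \<oplus>\<^bsub>B\<^esub> ar a \<bullet> u" "\<forall>p. cf u p \<noteq> 0 \<longrightarrow> k \<le> plength p" by blast
    have aa: "ar a \<in> carrier B" using a by simp
    have "ar a \<bullet> u = (ar a \<bullet> q \<oplus>\<^bsub>B\<^esub> ar a \<bullet> n) \<bullet> u" using an by simp
    also have "\<dots> = ar a \<bullet> q \<bullet> u \<oplus>\<^bsub>B\<^esub> ar a \<bullet> (n \<bullet> u)"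
      using aa q n su by (simp add: B.l_distr B.m_assoc)
    finally have "ar a \<bullet> q \<bullet> s \<oplus>\<^bsub>B\<^esub> ar a \<bullet> u =
        ar a \<bullet> q \<bullet> (s \<oplus>\<^bsub>B\<^esub> u) \<oplus>\<^bsub>B\<^esub> ar a \<bullet> (n \<bullet> u)"
      using aa q n su(1,2) by (simp add: B.r_distr B.a_assoc)
    moreover have "Suc k \<le> plength p" if "cf (n \<bullet> u) p \<noteq> 0" for p
      using cf_mult_length[OF n su(2) n1 _ that, of k] su(4) by auto
    ultimately show ?case using su n by (intro bexI[of _ "s \<oplus>\<^bsub>B\<^esub> u"] bexI[of _ "n \<bullet> u"]) auto
  qed
  moreover obtain N where N: "\<forall>p\<in>gp. plength p < N" using good_path_bound by blast
  ultimately obtain s u where su: "s \<in> carrier B" "u \<in> carrier B"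
      "ar a = ar a \<bullet> q \<bullet> s \<oplus>\<^bsub>B\<^esub> ar a \<bullet> u" "\<forall>p. cf u p \<noteq> 0 \<longrightarrow> N \<le> plength p" by blast
  have "cf u p = 0" for p using su(4) N cf_outside[of p u] by (meson not_le)
  then have "u = \<zero>\<^bsub>B\<^esub>" using su(2) by (intro cf_eqI) auto
  then have "ar a = ar a \<bullet> r \<bullet> (?c \<bullet> s)"
    using su(1,3) a r h by (simp add: q_def B.m_assoc)
  then show ?thesis using su(1) h by (intro bexI[of _ "?c \<bullet> s"]) auto
qed

lemma ar_in_principal: "a \<in> arcs Q \<Longrightarrow> [ar a] \<in> carrier (principal B (ar a))"
  by (auto intro!: bexI[of _ "\<one>\<^bsub>B\<^esub>"])

lemma cf_ar_mult_self:
  "r \<in> carrier B \<Longrightarrow> a \<in> arcs Q \<Longrightarrow> cf (ar a \<bullet> r) (tail Q a, [a]) = cf r (head Q a, [])"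
  by (simp add: cf_ar_mult gp_single)

text \<open>If \<open>a\<close> is a sum of elements \<open>a r\<close> and \<open>a s\<close> of
  two submodules, the constant terms of \<open>r\<close> and \<open>s\<close> at the head of
  \<open>a\<close> add up to \<open>1\<close>, so one of the submodules contains a generator and is
  everything.\<close>

lemma principal_ar_indecomposable:
  assumes a: "a \<in> arcs Q"
  shows "indecomposable B (principal B (ar a))"
proof -
  let ?P = "principal B (ar a)"
  interpret P: right_module B ?P by (rule B.right_module_principal[OF ar_carrier[OF a]])
  have top: "X = carrier ?P" if X: "submodule X B ?P" "[ar a \<bullet> r] \<in> X" "r \<in> carrier B"
    "cf r (head Q a, []) \<noteq> 0" for X r
  proof -
    obtain s where s: "s \<in> carrier B" "ar a \<bullet> r \<bullet> s = ar a"
      using principal_ar_generator[OF a X(3,4)] by blast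
    have "s \<odot>\<^bsub>?P\<^esub> [ar a \<bullet> r] \<in> X" by (rule submoduleD(4)[OF X(1) s(1) X(2)])
    then have "[ar a] \<in> X" using s(2) by simp
    then have "[ar a \<bullet> t] \<in> X" if "t \<in> carrier B" for t using submoduleD(4)[OF X(1) that, of "[ar a]"] by simp
    then show ?thesis using submoduleD(1)[OF X(1)] by auto
  qed
  have "ar a \<noteq> \<zero>\<^bsub>B\<^esub>" using cf_ar[OF a, of "(tail Q a, [a])"] by auto
  then have "[ar a] \<noteq> \<zero>\<^bsub>?P\<^esub>" by simp
  then have "carrier ?P \<noteq> {\<zero>\<^bsub>?P\<^esub>}" using ar_in_principal[OF a] by blast
  moreover have "X = {\<zero>\<^bsub>?P\<^esub>} \<or> Y = {\<zero>\<^bsub>?P\<^esub>}"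
    if XY: "submodule X B ?P" "submodule Y B ?P" "X <+>\<^bsub>?P\<^esub> Y = carrier ?P" "X \<inter> Y = {\<zero>\<^bsub>?P\<^esub>}" for X Y
  proof -
    have "[ar a] \<in> X <+>\<^bsub>?P\<^esub> Y" using XY(3) ar_in_principal[OF a] by simp
    then obtain x y where xy: "x \<in> X" "y \<in> Y" "[ar a] = x \<oplus>\<^bsub>?P\<^esub> y" by (auto simp: set_add_def')
    obtain r s where rs: "r \<in> carrier B" "x = [ar a \<bullet> r]" "s \<in> carrier B" "y = [ar a \<bullet> s]"
      using subsetD[OF submoduleD(1)[OF XY(1)] xy(1)] subsetD[OF submoduleD(1)[OF XY(2)] xy(2)]
      unfolding principal_simps by blast
    then have "ar a = ar a \<bullet> r \<oplus>\<^bsub>B\<^esub> ar a \<bullet> s" using xy(3) by simp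
    then have "cf (ar a) (tail Q a, [a]) = cf (ar a \<bullet> r \<oplus>\<^bsub>B\<^esub> ar a \<bullet> s) (tail Q a, [a])" by simp
    then have "cf r (head Q a, []) + cf s (head Q a, []) = 1"
      using rs a by (simp add: cf_add cf_ar_mult_self) (simp add: cf_ar)
    then consider "cf r (head Q a, []) \<noteq> 0" | "cf s (head Q a, []) \<noteq> 0" by fastforce
    then show ?thesis
    proof cases
      case 1
      then have "X = carrier ?P" using top[OF XY(1)] xy rs by blast
      then show ?thesis using XY(4) submoduleD(1)[OF XY(2)] by blast
    next
      case 2
      then have "Y = carrier ?P" using top[OF XY(2)] xy rs by blast
      then show ?thesis using XY(4) submoduleD(1)[OF XY(1)] by blast
    qed
  qed
  ultimately show ?thesis unfolding indecomposable_def by blast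
qed

text \<open>A splitting of the cover of \<open>a B\<close> by \<open>e B\<close> would send
  \<open>a\<close> to some \<open>r\<close> with constant term \<open>1\<close>. As
  \<open>a b\<close> is zero, so is \<open>r b\<close>, although its coefficient at \<open>b\<close>
  is that constant term.\<close>

lemma principal_ar_not_projective:
  assumes "rel a b"
  shows "\<not> projective B (principal B (ar a))"
proof
  assume P: "projective B (principal B (ar a))"
  have ab: "a \<in> arcs Q" "b \<in> arcs Q" "head Q a = tail Q b" using rel_in_arcs assms by auto
  let ?h = "head Q a" and ?P = "principal B (ar a)"
  let ?E = "principal B (ce ?h 1)"
  have h: "?h \<in> verts Q" using ab by auto
  interpret P: right_module B ?P by (rule B.right_module_principal[OF ar_carrier[OF ab(1)]])
  interpret E: right_module B ?E by (rule B.right_module_principal[OF ce_carrier[OF h]])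
  define g where "g x = [ar a \<bullet> hd x]" for x
  have g: "g \<in> mod_hom B ?E ?P"
    using ab h by (intro mod_homI) (auto simp: g_def mem_principal_ce[OF h] B.m_assoc B.r_distr)
  have "g ` carrier ?E = carrier ?P"
  proof (intro equalityI subsetI)
    fix x assume "x \<in> carrier ?P"
    then obtain r where r: "r \<in> carrier B" "x = [ar a \<bullet> r]" by auto
    then have "x = g [ce ?h 1 \<bullet> r]" using ab(1,2) h by (simp add: g_def B.m_assoc[symmetric] ar_mult_ce)
    moreover have "[ce ?h 1 \<bullet> r] \<in> carrier ?E" using r by auto
    ultimately show "x \<in> g ` carrier ?E" by blast
  qed (use mod_homD(1)[OF g] in blast)
  then obtain k where k: "k \<in> mod_hom B ?P ?E" "\<forall>x\<in>carrier ?P. g (k x) = x"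
    using P[unfolded projective_def, THEN conjunct2, rule_format,
        OF B.principal_fg[OF ce_carrier[OF h]] B.principal_fg[OF ar_carrier[OF ab(1)]] g
           mod_hom_id[OF P.right_module_axioms]] by blast
  obtain r where r: "r \<in> carrier B" "k [ar a] = [r]"
    using mod_homD(1)[OF k(1) ar_in_principal[OF ab(1)]] mem_principal_ce[OF h] by blast
  have "g (k [ar a]) = [ar a]" using k(2) ar_in_principal[OF ab(1)] by blast
  then have "ar a \<bullet> r = ar a" unfolding r(2) g_def by simp
  then have 1: "cf r (?h, []) = 1" using cf_ar_mult_self[OF r(1) ab(1)] ab(1) by (simp add: cf_ar)
  have "k (ar b \<odot>\<^bsub>?P\<^esub> [ar a]) = ar b \<odot>\<^bsub>?E\<^esub> [r]"
    using mod_homD(3)[OF k(1) ar_carrier[OF ab(2)] ar_in_principal[OF ab(1)]] r(2) by simp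
  moreover have "ar b \<odot>\<^bsub>?P\<^esub> [ar a] = \<zero>\<^bsub>?P\<^esub>" by (simp add: ar_mult_ar[OF assms])
  ultimately have "r \<bullet> ar b = \<zero>\<^bsub>B\<^esub>"
    using mod_hom_zero[OF k(1) P.right_module_axioms E.right_module_axioms] by simp
  then have "cf (r \<bullet> ar b) (tail Q b, [b]) = 0" by simp
  then show False using 1 r(1) ab by (simp add: cf_mult_ar gp_single)
qed

text \<open>An isomorphism sends \<open>a\<close> to \<open>c r\<close> where, by surjectivity,
  \<open>r\<close> has a nonzero constant term. Multiplying by \<open>b\<close> gives
  \<open>c r b = 0\<close>, whose coefficient at the path \<open>c b\<close> would be that constant
  term if \<open>c b\<close> were good. So \<open>a\<close> and \<open>c\<close> both precede
  \<open>b\<close> in a relation.\<close>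

lemma principal_ar_iso_imp_eq:
  assumes "rel a b" "c \<in> arcs Q" "mod_iso B (principal B (ar a)) (principal B (ar c))"
  shows "a = c"
proof -
  have ab: "a \<in> arcs Q" "b \<in> arcs Q" "head Q a = tail Q b" using rel_in_arcs assms by auto
  let ?P = "principal B (ar a)" and ?C = "principal B (ar c)"
  interpret P: right_module B ?P by (rule B.right_module_principal[OF ar_carrier[OF ab(1)]])
  interpret C: right_module B ?C by (rule B.right_module_principal[OF ar_carrier[OF assms(2)]])
  obtain f where f: "f \<in> mod_hom B ?P ?C" "bij_betw f (carrier ?P) (carrier ?C)"
    using assms(3) by (auto simp: mod_iso_def)
  let ?e = "ce (head Q a) 1"
  have e: "?e \<in> carrier B" using ab by auto
  obtain r0 where r0: "r0 \<in> carrier B" "f [ar a] = [ar c \<bullet> r0]"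
    using mod_homD(1)[OF f(1) ar_in_principal[OF ab(1)]] by auto
  \<comment> \<open>Right multiplication by the idempotent at the head of \<open>a\<close> preserves
    the image of \<open>a\<close>; a nonzero constant term of \<open>r\<close> at the head of
    \<open>c\<close> then forces the two heads to agree.\<close>
  define r where "r = r0 \<bullet> ?e"
  have r: "r \<in> carrier B" using r0 e by (simp add: r_def)
  have "f (?e \<odot>\<^bsub>?P\<^esub> [ar a]) = ?e \<odot>\<^bsub>?C\<^esub> f [ar a]" by (rule mod_homD(3)[OF f(1) e ar_in_principal[OF ab(1)]])
  then have fr: "f [ar a] = [ar c \<bullet> r]"
    using r0 e assms(2) ab(1,2) by (simp add: r_def ar_mult_ce B.m_assoc)
  have fs: "f [ar a \<bullet> s] = [ar c \<bullet> (r \<bullet> s)]" if s: "s \<in> carrier B" for s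
    using mod_homD(3)[OF f(1) s ar_in_principal[OF ab(1)]] r s assms(2) by (simp add: fr B.m_assoc)
  have "[ar c] \<in> f ` carrier ?P" using f(2) ar_in_principal[OF assms(2)] unfolding bij_betw_def by blast
  then obtain s where s: "s \<in> carrier B" "[ar c] = f [ar a \<bullet> s]" by auto
  then have "ar c = ar c \<bullet> (r \<bullet> s)" using fs by simp
  then have "cf (r \<bullet> s) (head Q c, []) = 1"
    using cf_ar_mult_self[of "r \<bullet> s" c] r s assms(2) by (simp add: cf_ar)
  then have 1: "cf r (head Q c, []) \<noteq> 0" using r s by (auto simp: cf_mult_trivial)
  then have hd: "head Q c = head Q a"
    using r0 ab by (auto simp: r_def cf_mult_ce ptarget_code split: if_splits)
  have "ar c \<bullet> (r \<bullet> ar b) = \<zero>\<^bsub>B\<^esub>"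
    using fs[OF ar_carrier[OF ab(2)]] mod_hom_zero[OF f(1) P.right_module_axioms C.right_module_axioms]
    by (simp add: ar_mult_ar[OF assms(1)])
  then have 0: "cf (ar c \<bullet> (r \<bullet> ar b)) (tail Q c, [c, b]) = 0" by simp
  have "rel c b"
  proof (rule ccontr)
    assume "\<not> rel c b"
    then have "(tail Q c, [c, b]) \<in> gp" "(head Q c, [b]) \<in> gp"
      using assms(2) ab hd by (auto simp: gp_Cons gp_Nil)
    then have "cf (ar c \<bullet> (r \<bullet> ar b)) (tail Q c, [c, b]) = cf r (head Q c, [])"
      using r ab assms(2) by (simp add: cf_ar_mult cf_mult_ar)
    then show False using 0 1 by simp
  qed
  then show ?thesis using rel_unique_pre assms(1) by blast
qed

lemma on_cycle_rel:
  assumes "on_cycle a" obtains b where "rel a b"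
proof -
  obtain \<beta> :: "int \<Rightarrow> 'e" where \<beta>: "\<beta> (- 1) = a" "\<And>i. rel (\<beta> (i + 1)) (\<beta> i)"
    using on_cycle_chain[OF assms] by blast
  then have "rel a (\<beta> (- 2))" using \<beta>(2)[of "- 2"] by simp
  then show ?thesis by (rule that)
qed

text \<open>The map from arrows on cycles to isomorphism classes is onto by
  \<open>gproj_classification\<close> and injective by \<open>principal_ar_iso_imp_eq\<close>.
  Finiteness is recorded because \<open>card\<close> of an infinite set would be
  \<open>0\<close>.\<close>

theorem gproj_iso_classes_arrows:
  "finite (gproj_iso_classes B)" "num_gproj B = card {a. on_cycle a}"
proof -
  define X where "X = {G. gorenstein_projective B G \<and> indecomposable B G \<and> \<not> projective B G}"
  define R where "R = {(M, N). M \<in> X \<and> N \<in> X \<and> mod_iso B M N}"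
  let ?p = "\<lambda>a. principal B (ar a)"
  have rm: "right_module B G" if "G \<in> X" for G
    using that by (auto simp: X_def gorenstein_projective_def fg_modules_def)
  have arc: "a \<in> arcs Q" if "on_cycle a" for a using on_cycle_rel[OF that] rel_in_arcs by blast
  have p: "?p a \<in> X" if a: "on_cycle a" for a
  proof -
    obtain b where "rel a b" by (rule on_cycle_rel[OF a])
    then show ?thesis
      using principal_ar_gorenstein[OF a] principal_ar_indecomposable[OF arc[OF a]]
        principal_ar_not_projective by (simp add: X_def)
  qed
  have cl: "R `` {G} = R `` {H}" if "G \<in> X" "H \<in> X" "mod_iso B G H" for G H
    using that mod_iso_sym[OF that(3) rm[OF that(1)]] mod_iso_trans unfolding R_def by blast
  have "gproj_iso_classes B = (\<lambda>a. R `` {?p a}) ` {a. on_cycle a}"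
  proof (intro equalityI subsetI)
    fix C assume "C \<in> gproj_iso_classes B"
    then obtain G where G: "G \<in> X" "C = R `` {G}"
      by (auto simp: gproj_iso_classes_def Let_def X_def[symmetric] R_def[symmetric] elim!: quotientE)
    obtain a where a: "on_cycle a" "mod_iso B G (?p a)"
      using gproj_classification[of G] G(1) by (auto simp: X_def)
    then have "C = R `` {?p a}" using cl[OF G(1) p[OF a(1)] a(2)] G(2) by simp
    then show "C \<in> (\<lambda>a. R `` {?p a}) ` {a. on_cycle a}" using a(1) by blast
  next
    fix C assume "C \<in> (\<lambda>a. R `` {?p a}) ` {a. on_cycle a}"
    then show "C \<in> gproj_iso_classes B"
      using p by (auto simp: gproj_iso_classes_def Let_def X_def[symmetric] R_def[symmetric] intro!: quotientI)
  qed
  moreover have "inj_on (\<lambda>a. R `` {?p a}) {a. on_cycle a}"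
  proof (rule inj_onI)
    fix a c assume ac: "a \<in> {a. on_cycle a}" "c \<in> {a. on_cycle a}" "R `` {?p a} = R `` {?p c}"
    have "?p c \<in> R `` {?p c}" using p ac mod_iso_refl by (auto simp: R_def)
    then have "?p c \<in> R `` {?p a}" using ac(3) by simp
    then have iso: "mod_iso B (?p a) (?p c)" by (simp add: R_def)
    obtain b where "rel a b" using on_cycle_rel ac(1) by blast
    then show "a = c" using principal_ar_iso_imp_eq[OF _ _ iso] arc ac(2) by blast
  qed
  moreover have "finite {a. on_cycle a}"
    by (rule finite_subset[OF _ finite_arcs]) (use arc in auto)
  ultimately show "finite (gproj_iso_classes B)" "num_gproj B = card {a. on_cycle a}"
    unfolding num_gproj_def by (simp_all add: card_image)
qed

end


section \<open>Counting arrows on cycles with full relations\<close>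

text \<open>Rotation by \<open>j\<close> is undone by a further \<open>(length es - 1) * j\<close>
  steps, in total a multiple of the length.\<close>

lemma rotation_class_rotate: "rotation_class (rotate j es) = rotation_class es"
proof (cases "es = []")
  case False
  have "\<exists>k'. rotate k es = rotate k' (rotate j es)" for k
  proof -
    have eq: "(k + (length es - 1) * j + j) = k + length es * j"
      using False by (cases "length es") (auto simp: algebra_simps)
    have "rotate (k + (length es - 1) * j) (rotate j es) = rotate (k + length es * j) es"
      by (simp only: rotate_rotate eq)
    also have "\<dots> = rotate k es" by (metis mod_mult_self2 rotate_conv_mod)
    finally show ?thesis by metis
  qed
  then show ?thesis by (auto simp: rotation_class_def rotate_rotate)
qed (simp add: rotation_class_def)

lemma Union_set_rotation_class: "\<Union> (set ` rotation_class es) = set es"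
  by (auto simp: rotation_class_def)

context gentle
begin

definition cycle_classes :: "nat \<Rightarrow> 'e list set set" where
  "cycle_classes l = {rotation_class es | es. full_relation_cycle Q I es \<and> length es = l}"

lemma full_relation_cycle_subset: "full_relation_cycle Q I es \<Longrightarrow> set es \<subseteq> arcs Q"
  unfolding full_relation_cycle_def using rel_in_arcs(1) by (fastforce simp: in_set_conv_nth)

lemma finite_full_relation_cycles: "finite {es. full_relation_cycle Q I es}"
proof (rule finite_subset)
  show "{es. full_relation_cycle Q I es} \<subseteq> {es. set es \<subseteq> arcs Q \<and> length es \<le> card (arcs Q)}"
  proof safe
    fix es assume es: "full_relation_cycle Q I es"
    then show "x \<in> arcs Q" if "x \<in> set es" for x using full_relation_cycle_subset that by blast
    have "length es = card (set es)" using es by (simp add: full_relation_cycle_def distinct_card)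
    then show "length es \<le> card (arcs Q)" using full_relation_cycle_subset[OF es] by (simp add: card_mono)
  qed
qed (simp add: finite_lists_length_le)

lemma finite_cycle_classes: "finite (cycle_classes l)"
  by (rule finite_subset[OF _ finite_imageI[OF finite_full_relation_cycles, of rotation_class]])
    (auto simp: cycle_classes_def)

text \<open>The thread part of the invariant vanishes at \<open>m = 0\<close>, since a recorded
  round has \<open>m\<close> at least \<open>1\<close>.\<close>

lemma ag_invariant_zero: "ag_invariant Q I (0, l) = card (cycle_classes l)"
  by (simp add: ag_invariant_def records_def cycle_classes_def)

text \<open>Uniqueness of successors makes both cycles run in step from the common arrow. As the
  arrows of a cycle are distinct, each length divides the other, so the lists are rotations of one
  another.\<close>

lemma common_arrow_rotation_class:
  assumes es: "full_relation_cycle Q I es" and es': "full_relation_cycle Q I es'"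
    and a: "a \<in> set es" "a \<in> set es'"
  shows "rotation_class es = rotation_class es'"
proof -
  obtain j where j: "j < length es" "es ! j = a" using a(1) by (auto simp: in_set_conv_nth)
  obtain j' where j': "j' < length es'" "es' ! j' = a" using a(2) by (auto simp: in_set_conv_nth)
  let ?n = "length es" and ?n' = "length es'"
  have eq: "es ! ((j + i) mod ?n) = es' ! ((j' + i) mod ?n')" for i
  proof (induction i)
    case (Suc i)
    have "rel (es ! ((j + i) mod ?n)) (es ! (Suc ((j + i) mod ?n) mod ?n))"
      using es j by (simp add: full_relation_cycle_def)
    moreover have "rel (es' ! ((j' + i) mod ?n')) (es' ! (Suc ((j' + i) mod ?n') mod ?n'))"
      using es' j' by (simp add: full_relation_cycle_def)
    ultimately have "es ! (Suc ((j + i) mod ?n) mod ?n) = es' ! (Suc ((j' + i) mod ?n') mod ?n')"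
      using rel_unique_post Suc by metis
    then show ?case by (simp add: mod_Suc_eq)
  qed (use j j' in simp)
  have dvd: "length ys dvd length xs"
    if "full_relation_cycle Q I ys" "i' < length ys"
      "\<And>k. xs ! ((i + k) mod length xs) = ys ! ((i' + k) mod length ys)" for xs ys :: "'e list" and i i'
  proof -
    have "ys ! ((i' + length xs) mod length ys) = ys ! (i' mod length ys)"
      using that(3)[of "length xs"] that(3)[of 0] by simp
    then have "(i' + length xs) mod length ys = i' mod length ys"
      using that(1,2) by (subst (asm) nth_eq_iff_index_eq) (auto simp: full_relation_cycle_def)
    then have "(i' + length xs) mod length ys = (i' + 0) mod length ys" by simp
    then show ?thesis by (metis add_diff_cancel_left' add.right_neutral mod_eq_dvd_iff_nat le_add1)
  qed
  have "?n' dvd ?n" using dvd[OF es' j'(1)] eq by blast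
  moreover have "?n dvd ?n'" using dvd[OF es j(1)] eq by metis
  ultimately have n: "?n = ?n'" using dvd_antisym by blast
  have "rotate j es = rotate j' es'"
    by (rule nth_equalityI) (use n eq in \<open>auto simp: nth_rotate\<close>)
  then show ?thesis using rotation_class_rotate by metis
qed

lemma card_cycle_class: "C \<in> cycle_classes l \<Longrightarrow> card (\<Union> (set ` C)) = l"
  by (auto simp: cycle_classes_def Union_set_rotation_class full_relation_cycle_def distinct_card)

lemma cycle_classes_disjoint:
  assumes "C \<in> cycle_classes l" "D \<in> cycle_classes m" "a \<in> \<Union> (set ` C)" "a \<in> \<Union> (set ` D)"
  shows "C = D"
proof -
  obtain es es' where es: "full_relation_cycle Q I es" "C = rotation_class es"
      "full_relation_cycle Q I es'" "D = rotation_class es'"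
    using assms(1,2) by (auto simp: cycle_classes_def)
  show ?thesis
    unfolding es(2,4) using assms(3,4) unfolding es(2,4) Union_set_rotation_class
    by (rule common_arrow_rotation_class[OF es(1,3)])
qed

text \<open>Arrows on cycles are partitioned by length and then by rotation class, and a class of
  length \<open>l\<close> accounts for \<open>l\<close> arrows. The second assumption guarantees
  that every occurring length is in \<open>L\<close>.\<close>

lemma card_on_cycle:
  assumes L: "finite L" "\<And>l. l \<notin> L \<Longrightarrow> ag_invariant Q I (0, l) = 0"
  shows "card {a. on_cycle a} = (\<Sum>l\<in>L. l * ag_invariant Q I (0, l))"
proof -
  let ?U = "\<lambda>C. \<Union> (set ` C)"
  have fin: "finite (?U C)" if "C \<in> cycle_classes l" for C l
    using that by (auto simp: cycle_classes_def Union_set_rotation_class simp del: Union_iff UN_iff)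
  have "{a. on_cycle a} = (\<Union>l\<in>L. \<Union>C\<in>cycle_classes l. ?U C)"
  proof (intro equalityI subsetI)
    fix a assume "a \<in> {a. on_cycle a}"
    then obtain es where es: "full_relation_cycle Q I es" "a \<in> set es" by (auto simp: on_cycle_def)
    then have C: "rotation_class es \<in> cycle_classes (length es)" by (auto simp: cycle_classes_def)
    have "length es \<in> L"
      using C finite_cycle_classes L(2)[of "length es"] unfolding ag_invariant_zero by fastforce
    moreover have "a \<in> ?U (rotation_class es)" using es(2) by (simp add: Union_set_rotation_class)
    ultimately show "a \<in> (\<Union>l\<in>L. \<Union>C\<in>cycle_classes l. ?U C)" using C by blast
  next
    fix a assume "a \<in> (\<Union>l\<in>L. \<Union>C\<in>cycle_classes l. ?U C)"
    then obtain l C where "C \<in> cycle_classes l" "a \<in> ?U C" by blast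
    then obtain es where "full_relation_cycle Q I es" "a \<in> ?U (rotation_class es)"
      unfolding cycle_classes_def by blast
    then show "a \<in> {a. on_cycle a}" unfolding Union_set_rotation_class on_cycle_def by blast
  qed
  then have "card {a. on_cycle a} = (\<Sum>l\<in>L. card (\<Union>C\<in>cycle_classes l. ?U C))"
  proof (simp only:, intro card_UN_disjoint ballI impI)
    show "finite (\<Union>C\<in>cycle_classes l. ?U C)" for l using finite_cycle_classes fin by blast
    fix l m :: nat assume "l \<noteq> m"
    show "(\<Union>C\<in>cycle_classes l. ?U C) \<inter> (\<Union>C\<in>cycle_classes m. ?U C) = {}"
    proof (rule ccontr)
      assume "\<not> ?thesis"
      then obtain a C D where "C \<in> cycle_classes l" "D \<in> cycle_classes m" "a \<in> ?U C" "a \<in> ?U D" by blast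
      then have "C = D" "C \<in> cycle_classes l" "D \<in> cycle_classes m" using cycle_classes_disjoint by blast+
      then show False using card_cycle_class \<open>l \<noteq> m\<close> by blast
    qed
  qed (use L(1) in auto)
  also have "\<dots> = (\<Sum>l\<in>L. l * ag_invariant Q I (0, l))"
  proof (intro sum.cong refl)
    fix l
    have "card (\<Union>C\<in>cycle_classes l. ?U C) = (\<Sum>C\<in>cycle_classes l. card (?U C))"
    proof (intro card_UN_disjoint ballI impI finite_cycle_classes)
      show "finite (?U C)" if "C \<in> cycle_classes l" for C using fin[OF that] .
      fix C D assume "C \<in> cycle_classes l" "D \<in> cycle_classes l" "C \<noteq> D"
      then show "?U C \<inter> ?U D = {}" using cycle_classes_disjoint by blast
    qed
    also have "\<dots> = (\<Sum>C\<in>cycle_classes l. l)" by (intro sum.cong refl card_cycle_class)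
    finally show "card (\<Union>C\<in>cycle_classes l. ?U C) = l * ag_invariant Q I (0, l)"
      by (simp add: ag_invariant_zero)
  qed
  finally show ?thesis .
qed

lemma finite_ag_support: "finite {l. ag_invariant Q I (0, l) \<noteq> 0}"
proof (rule finite_subset)
  show "{l. ag_invariant Q I (0, l) \<noteq> 0} \<subseteq> length ` {es. full_relation_cycle Q I es}"
  proof
    fix l assume "l \<in> {l. ag_invariant Q I (0, l) \<noteq> 0}"
    then have "cycle_classes l \<noteq> {}" by (auto simp: ag_invariant_zero)
    then show "l \<in> length ` {es. full_relation_cycle Q I es}" by (auto simp: cycle_classes_def)
  qed
qed (intro finite_imageI finite_full_relation_cycles)

text \<open>With the support of the invariant as index set, the right-hand side depends on the
  AG-invariant alone; this yields invariance under AG-equivalence.\<close>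

lemma num_gproj_sum: "num_gproj B = (\<Sum>l | ag_invariant Q I (0, l) \<noteq> 0. l * ag_invariant Q I (0, l))"
  unfolding gproj_iso_classes_arrows(2) by (rule card_on_cycle) (use finite_ag_support in auto)

end

theorem proposition6p12:
  fixes Q :: "('v, 'e) pre_digraph" and I :: "(('v, 'e) path \<Rightarrow>\<^sub>0 'k::alg_closed_field) set"
    and Q' :: "('w, 'f) pre_digraph" and I' :: "(('w, 'f) path \<Rightarrow>\<^sub>0 'k) set"
  assumes "gentle Q I"
  shows "(\<forall>L. finite L \<and> 0 \<notin> L \<and>
              (\<forall>l. (l \<in> L \<longrightarrow> ag_invariant Q I (0, l) > 0) \<and>
                   (l \<notin> L \<longrightarrow> ag_invariant Q I (0, l) = 0)) \<longrightarrow>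
            finite (gproj_iso_classes (bound_quiver_algebra Q I)) \<and>
            num_gproj (bound_quiver_algebra Q I) = (\<Sum>l\<in>L. l * ag_invariant Q I (0, l)) \<and>
            num_gproj (bound_quiver_algebra Q I) =
              card {a. \<exists>es. full_relation_cycle Q I es \<and> a \<in> set es}) \<and>
         (gentle Q' I' \<and> ag_invariant Q I = ag_invariant Q' I' \<longrightarrow>
            num_gproj (bound_quiver_algebra Q I) = num_gproj (bound_quiver_algebra Q' I'))"
proof -
  interpret gentle Q I by fact
  show ?thesis
  proof (intro conjI allI impI)
    fix L
    assume L: "finite L \<and> 0 \<notin> L \<and>
              (\<forall>l. (l \<in> L \<longrightarrow> ag_invariant Q I (0, l) > 0) \<and>
                   (l \<notin> L \<longrightarrow> ag_invariant Q I (0, l) = 0))"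
    show "finite (gproj_iso_classes (bound_quiver_algebra Q I))" by (rule gproj_iso_classes_arrows(1))
    show "num_gproj (bound_quiver_algebra Q I) = (\<Sum>l\<in>L. l * ag_invariant Q I (0, l))"
      unfolding gproj_iso_classes_arrows(2) using L by (intro card_on_cycle) auto
    show "num_gproj (bound_quiver_algebra Q I) = card {a. \<exists>es. full_relation_cycle Q I es \<and> a \<in> set es}"
      using gproj_iso_classes_arrows(2) by (simp add: on_cycle_def)
  next
    assume "gentle Q' I' \<and> ag_invariant Q I = ag_invariant Q' I'"
    then show "num_gproj (bound_quiver_algebra Q I) = num_gproj (bound_quiver_algebra Q' I')"
      using num_gproj_sum gentle.num_gproj_sum[of Q' I'] by simp
  qed
qed

end
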